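(* For every even integer $h\ge 2$ there exists a fullerene $5_n$ with $n=18h-8$ vertices having two simple zigzags that intersect in exactly $h$ edges. It has symmetry group $T_d$ if $h=2$, and, for $h\geq 4$, symmetry group $D_{2h}$ if $\frac h2$ is even and $D_{2d}$ if $\frac h2$ is odd.
   Context: A fullerene $5_n$ is (the skeleton of) a simple convex polyhedron with $n$ vertices, i.e. a $3$-connected $3$-valent finite simple plane graph, all of whose faces are pentagons or hexagons; it has exactly twelve pentagons. A zigzag is a circuit of edges obtained by alternately taking the left and the right neighbouring edge at successive vertices (so any two, but no three, consecutive edges lie on a common face); zigzags are considered up to direction and starting point. Each edge is covered exactly twice by zigzags. A zigzag is simple if it does not traverse any edge twice. The intersection of two zigzags is the set of edges belonging to both. The symmetry group of such a graph is its group of combinatorial automorphisms, identified (by a theorem of Mani) with the point group (isometry group, a finite subgroup of $O(3)$ up to conjugacy) of a suitable polyhedron with that skeleton. In Schoenflies notation, $T_d$ is the symmetry group of the regular Tetrahedron; with $C_{2v}$ the group generated by the rotation of order $2$ about an axis $\Delta$ and a reflection in a plane containing $\Delta$, the group $D_{2h}$ (resp. $D_{2d}$) is generated by $C_{2v}$ and a rotation by $\pi$ about an axis orthogonal to $\Delta$ and contained in a plane of symmetry (resp. lying between two planes of symmetry). *)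

theory Defs
  imports
    "HOL-Analysis.Analysis"
    "HOL-Algebra.Generated_Groups"
    "HOL-Combinatorics.Orbits"
    "Graph_Theory.Graph_Theory"
begin

section \<open>Plane graphs\<close>

text \<open>
  A plane graph is a finite simple graph \<open>G\<close> (locale \<open>pair_graph\<close>: every edge is present as two
  opposite arcs) with a rotation system \<open>rot\<close>: \<open>rot v\<close> is the cyclic permutation of the
  neighbours of \<open>v\<close> sending \<open>u\<close> to the next neighbour of \<open>v\<close> in the positive sense.  The faces are
  traced by \<open>face_step\<close>, and the surface is the sphere by Euler's formula.
\<close>

definition nbrs :: "'v pair_pre_digraph \<Rightarrow> 'v \<Rightarrow> 'v set" where
  "nbrs G v = {w. (v, w) \<in> parcs G}"

definition edges :: "'v pair_pre_digraph \<Rightarrow> 'v set set" where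
  "edges G = (\<lambda>(u, v). {u, v}) ` parcs G"

definition face_step :: "('v \<Rightarrow> 'v \<Rightarrow> 'v) \<Rightarrow> 'v \<times> 'v \<Rightarrow> 'v \<times> 'v" where
  "face_step rot = (\<lambda>(u, v). (v, rot v u))"

definition faces :: "'v pair_pre_digraph \<Rightarrow> ('v \<Rightarrow> 'v \<Rightarrow> 'v) \<Rightarrow> ('v \<times> 'v) set set" where
  "faces G rot = orbit (face_step rot) ` parcs G"

definition plane_graph :: "'v pair_pre_digraph \<Rightarrow> ('v \<Rightarrow> 'v \<Rightarrow> 'v) \<Rightarrow> bool" where
  "plane_graph G rot \<longleftrightarrow>
     pair_graph G \<and> Digraph_Component.connected (with_proj G) \<and>
     (\<forall>v\<in>pverts G. rot v permutes nbrs G v \<and> cyclic_on (rot v) (nbrs G v)) \<and>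
     card (pverts G) + card (faces G rot) = card (edges G) + 2"

definition three_connected :: "'v pair_pre_digraph \<Rightarrow> bool" where
  "three_connected G \<longleftrightarrow> card (pverts G) > 3 \<and>
     (\<forall>S\<subseteq>pverts G. card S < 3 \<longrightarrow>
        Digraph_Component.connected (with_proj G \<restriction> (pverts G - S)))"

definition fullerene :: "'v pair_pre_digraph \<Rightarrow> ('v \<Rightarrow> 'v \<Rightarrow> 'v) \<Rightarrow> bool" where
  "fullerene G rot \<longleftrightarrow> plane_graph G rot \<and> three_connected G \<and>
     (\<forall>v\<in>pverts G. card (nbrs G v) = 3) \<and> (\<forall>F\<in>faces G rot. card F \<in> {5, 6})"

section \<open>Zigzags\<close>

text \<open>
  A state \<open>((u, v), b)\<close> of a traversal: the edge \<open>{u, v}\<close> is being run through from \<open>u\<close> to \<open>v\<close>, and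
  the turn at \<open>v\<close> will be to the one side if \<open>b\<close> and to the other side if \<open>\<not> b\<close>.  Run backwards, the
  traversal has the state \<open>((v, u), b)\<close>: turns alternate and change side under reversal, so the turn
  taken at \<open>u\<close> is again of kind \<open>b\<close>.
\<close>

definition zigzag_step :: "('v \<Rightarrow> 'v \<Rightarrow> 'v) \<Rightarrow> ('v \<times> 'v) \<times> bool \<Rightarrow> ('v \<times> 'v) \<times> bool" where
  "zigzag_step rot =
     (\<lambda>((u, v), b). ((v, if b then rot v u else inv_into UNIV (rot v) u), \<not> b))"

definition reverse_state :: "('v \<times> 'v) \<times> bool \<Rightarrow> ('v \<times> 'v) \<times> bool" where
  "reverse_state = (\<lambda>((u, v), b). ((v, u), b))"

definition state_edge :: "('v \<times> 'v) \<times> bool \<Rightarrow> 'v set" where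
  "state_edge = (\<lambda>((u, v), b). {u, v})"

text \<open>
  An orbit of \<open>zigzag_step\<close> is a closed traversal up to its starting point; a zigzag is the pair
  consisting of a traversal and its reverse.
\<close>

definition zigzags ::
    "'v pair_pre_digraph \<Rightarrow> ('v \<Rightarrow> 'v \<Rightarrow> 'v) \<Rightarrow> (('v \<times> 'v) \<times> bool) set set set" where
  "zigzags G rot =
     {{orbit (zigzag_step rot) s, reverse_state ` orbit (zigzag_step rot) s} |s. fst s \<in> parcs G}"

definition simple_zigzag :: "(('v \<times> 'v) \<times> bool) set set \<Rightarrow> bool" where
  "simple_zigzag Z \<longleftrightarrow> (\<forall>C\<in>Z. inj_on state_edge C)"

definition zigzag_edges :: "(('v \<times> 'v) \<times> bool) set set \<Rightarrow> 'v set set" where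
  "zigzag_edges Z = (\<Union>C\<in>Z. state_edge ` C)"

section \<open>Combinatorial automorphisms\<close>

text \<open>
  Vertices, edges and faces, each represented by its set of vertices.  In a 3-connected plane graph
  an edge or a face is determined by this set.
\<close>

definition cells :: "'v pair_pre_digraph \<Rightarrow> ('v \<Rightarrow> 'v \<Rightarrow> 'v) \<Rightarrow> 'v set set" where
  "cells G rot = (\<lambda>v. {v}) ` pverts G \<union> edges G \<union> (\<lambda>F. fst ` F) ` faces G rot"

definition aut_group :: "'v pair_pre_digraph \<Rightarrow> ('v \<Rightarrow> 'v \<Rightarrow> 'v) \<Rightarrow> ('v \<Rightarrow> 'v) monoid" where
  "aut_group G rot =
     \<lparr>carrier = {f. f permutes pverts G \<and> (`) f ` cells G rot = cells G rot},
      mult = (\<circ>), one = id\<rparr>"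

definition orientation_preserving ::
    "'v pair_pre_digraph \<Rightarrow> ('v \<Rightarrow> 'v \<Rightarrow> 'v) \<Rightarrow> ('v \<Rightarrow> 'v) \<Rightarrow> bool" where
  "orientation_preserving G rot f \<longleftrightarrow> (\<forall>(v, u)\<in>parcs G. f (rot v u) = rot (f v) (f u))"

section \<open>Point groups\<close>

definition O3 :: "(real^3^3) monoid" where
  "O3 = \<lparr>carrier = {A. orthogonal_matrix A}, mult = (**), one = mat 1\<rparr>"

definition half_turn :: "real^3 \<Rightarrow> real^3^3" where
  "half_turn a = matrix (\<lambda>x. (2 * (x \<bullet> a) / (a \<bullet> a)) *\<^sub>R a - x)"

definition mirror :: "real^3 \<Rightarrow> real^3^3" where
  "mirror a = matrix (\<lambda>x. x - (2 * (x \<bullet> a) / (a \<bullet> a)) *\<^sub>R a)"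

definition tetrahedron :: "(real^3) set" where
  "tetrahedron =
     convex hull {vector [1, 1, 1], vector [1, -1, -1], vector [-1, 1, -1], vector [-1, -1, 1]}"

definition T_d :: "(real^3^3) set" where
  "T_d = {A. orthogonal_matrix A \<and> (*v) A ` tetrahedron = tetrahedron}"

text \<open>
  The axis \<open>\<Delta>\<close> is the third coordinate axis; the planes of symmetry of \<open>C_2v\<close> are the two
  coordinate planes containing it.
\<close>

definition C_2v :: "(real^3^3) set" where
  "C_2v = generate O3 {half_turn (vector [0, 0, 1]), mirror (vector [1, 0, 0])}"

definition D_2h :: "(real^3^3) set" where
  "D_2h = generate O3 (insert (half_turn (vector [1, 0, 0])) C_2v)"

definition D_2d :: "(real^3^3) set" where
  "D_2d = generate O3 (insert (half_turn (vector [1, 1, 0])) C_2v)"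

text \<open>
  By Mani's theorem the combinatorial automorphisms are the isometries of a suitable polyhedron with
  the given skeleton.  Under this identification an automorphism is a rotation iff it preserves the
  orientation, and it fixes a point of the unit sphere (onto which the surface is projected from the
  centre) iff it maps some vertex, edge or face to itself.  An identification of the automorphism
  group with a finite subgroup \<open>\<Gamma>\<close> of \<open>O3\<close> has to respect both.  This is needed, as the
  abstract group does not determine the point group (e.g. the rotation group of the cube is isomorphic
  to \<open>T_d\<close>); two finite subgroups of \<open>O3\<close> with an isomorphism respecting the determinant and the
  existence of fixed points on the sphere are conjugate in \<open>O3\<close>.
\<close>

definition has_symmetry_group ::
    "'v pair_pre_digraph \<Rightarrow> ('v \<Rightarrow> 'v \<Rightarrow> 'v) \<Rightarrow> (real^3^3) set \<Rightarrow> bool" where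
  "has_symmetry_group G rot \<Gamma> \<longleftrightarrow>
     (\<exists>\<phi>\<in>iso (aut_group G rot) (O3\<lparr>carrier := \<Gamma>\<rparr>). \<forall>f\<in>carrier (aut_group G rot).
        (rotation_matrix (\<phi> f) \<longleftrightarrow> orientation_preserving G rot f) \<and>
        ((\<exists>x. norm x = 1 \<and> \<phi> f *v x = x) \<longleftrightarrow> (\<exists>c\<in>cells G rot. f ` c = c)))"

end

theory Submission
  imports Defs
begin

text \<open>
  For \<open>h = 2 m\<close> the fullerene is a tube of \<open>n = 3 m\<close> layers of circumference twelve, closed at each end
  by two pentagons that share a chord and four further pentagons.  A zigzag winds up the tube as a
  helix and comes back on the opposite side, so it is simple.  The mirror image of this zigzag winds in
  the other direction; the two meet in the two chords and in two vertical edges each time the winding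
  number grows by a quarter, which gives \<open>2 + 2 (m - 1) = h\<close> common edges.

  The rotations, reflections and reversals of the tube that respect the positions of the two chords
  form a group of order eight, isomorphic to \<open>D_2h\<close> or \<open>D_2d\<close> according to the parity of \<open>n\<close>.  An
  automorphism of a 3-connected cubic plane graph is determined by its values at a vertex and the three
  neighbours.  If \<open>n \<ge> 6\<close>, then every automorphism maps the pentagons at the ends of the tube to each
  other, which leaves only these eight possibilities.  If \<open>n = 3\<close>, then the automorphisms permute the four
  vertices at which three pentagons meet.  There is one more rotation of order three, about one of these
  vertices, and all 24 permutations occur.  Conjugation in the symmetric group of the four vertices
  reduces the comparison of fixed cells with fixed points to the rotations and reflections of the tube.
\<close>

section \<open>Cubic rotation systems\<close>

text \<open>The circumference twelve ties the numbers together. A helix moves by one site per layer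
  and its two strands are six sites apart, so it meets its mirror image where twice the number of
  layers passed is divisible by six, that is, every third layer. The chord of the top layer is
  placed at the sites \<open>n\<close> and \<open>n + 6\<close>; as 3 divides \<open>n\<close>, it
  is parallel to the bottom chord if \<open>n\<close> is even and perpendicular to it if
  \<open>n\<close> is odd. An automorphism is given only by its action on vertex sets of cells,
  without an orientation. Rigidity needs a reason why two continuations of a fixed path cannot be
  exchanged: a path that turns twice to the same side lies on a face, one that turns to different
  sides does not. For \<open>n = 3\<close> the ends of the tube cannot be recognised, since the
  rotation of order three maps an end pentagon to a pentagon between two layers. Among the eight
  symmetries of a tube only the rotary reflections (\<open>t\<close>, \<open>e = 1\<close>, shift
  not divisible by 12) fix neither a cell nor a point of the sphere.\<close>

lemma self_in_orbit_finite:
  assumes "finite A" "inj_on f A" "f ` A \<subseteq> A" "x \<in> A"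
  shows "x \<in> orbit f x"
proof -
  \<comment> \<open>Outside \<open>A\<close> the function may move infinitely many points, as
    \<open>face_step rot\<close> swaps pairs of non-vertices. Its restriction to \<open>A\<close> is
    a permutation of finite support with the same orbit at \<open>x\<close>.\<close>
  let ?g = "perm_restrict f A"
  have "bij_betw f A A"
    using assms by (simp add: bij_betw_def endo_inj_surj)
  then have "bij_betw ?g A A"
    by (simp add: perm_restrict_def cong: bij_betw_cong)
  then have "?g permutes A"
    by (intro bij_imp_permutes) (auto simp: perm_restrict_def)
  then have "x \<in> orbit ?g x"
    using assms(1) by (meson permutation_permutes permutation_self_in_orbit)
  moreover have "orbit ?g x = orbit f x"
    using assms(3,4) by (intro orbit_cong0[of x A]) (auto simp: perm_restrict_def)
  ultimately show ?thesis by simp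
qed

lemma orbit_closed:
  assumes "y \<in> orbit f x" "f x \<in> C" "\<And>z. z \<in> C \<Longrightarrow> f z \<in> C"
  shows "y \<in> C"
  using assms by induction auto

lemma orbit_eqI_cycle:
  assumes "x \<in> C" "\<And>z. z \<in> C \<Longrightarrow> f z \<in> C" "\<And>z. z \<in> C \<Longrightarrow> z \<in> orbit f x"
  shows "orbit f x = C"
  using orbit_closed[of _ f x C] assms by auto

text \<open>Connectedness refers to walks in the symmetric closure. Paths along arcs inside
  \<open>W\<close> remain such walks, so it is enough to exhibit a reflexive transitive
  closure.\<close>

lemma connected_induceI:
  assumes "W \<noteq> {}" "\<And>u v. u \<in> W \<Longrightarrow> v \<in> W \<Longrightarrow> (u, v) \<in> (parcs G \<inter> W \<times> W)\<^sup>*"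
  shows "Digraph_Component.connected (with_proj G \<restriction> W)"
proof -
  let ?M = "mk_symmetric (with_proj G \<restriction> W)"
  have sub: "parcs G \<inter> W \<times> W \<subseteq> parcs ?M"
    by (force simp: parcs_mk_symmetric induce_subgraph_def)
  have "u \<rightarrow>\<^sup>*\<^bsub>?M\<^esub> v" if "u \<in> W" "v \<in> W" for u v
  proof -
    have "(u, v) \<in> rtrancl_on W (parcs G \<inter> W \<times> W)"
      using assms(2)[OF that] that by (intro rtrancl_consistent_rtrancl_on) auto
    then show ?thesis
      unfolding reachable_def using sub
      by (auto simp: induce_subgraph_def intro: rtrancl_on_mono)
  qed
  then show ?thesis
    using assms(1)
    by (auto simp: Digraph_Component.connected_def strongly_connected_def induce_subgraph_def)
qed

text \<open>The three functions encode graph and embedding together: their values form the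
  neighbourhood, their cyclic order the rotation. The genus is left open; Euler's formula is
  established later for the tube.\<close>

locale cubic_rotation =
  fixes V :: "'v set" and na nb nc :: "'v \<Rightarrow> 'v"
  assumes finite_V: "finite V"
    and closed: "v \<in> V \<Longrightarrow> na v \<in> V \<and> nb v \<in> V \<and> nc v \<in> V"
    and dist: "v \<in> V \<Longrightarrow> distinct [v, na v, nb v, nc v]"
    and nb_sym: "v \<in> V \<Longrightarrow> u \<in> {na v, nb v, nc v} \<Longrightarrow> v \<in> {na u, nb u, nc u}"
begin

definition N :: "'v \<Rightarrow> 'v set" where
  "N v = {na v, nb v, nc v}"

text \<open>The triple \<open>(na v, nb v, nc v)\<close> lists the neighbours of \<open>v\<close> in the positive sense.\<close>

definition rot :: "'v \<Rightarrow> 'v \<Rightarrow> 'v" where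
  "rot v = (if v \<in> V then id(na v := nb v, nb v := nc v, nc v := na v) else id)"

definition G :: "'v pair_pre_digraph" where
  "G = \<lparr>pverts = V, parcs = {(v, u). v \<in> V \<and> u \<in> N v}\<rparr>"

lemma pverts_G [simp]: "pverts G = V"
  and parcs_G: "parcs G = {(v, u). v \<in> V \<and> u \<in> N v}"
  by (simp_all add: G_def)

lemma N_V: "v \<in> V \<Longrightarrow> u \<in> N v \<Longrightarrow> u \<in> V"
  using closed by (auto simp: N_def)

lemma N_sym: "v \<in> V \<Longrightarrow> u \<in> N v \<Longrightarrow> v \<in> N u"
  using nb_sym by (auto simp: N_def)

lemma N_irrefl: "v \<in> V \<Longrightarrow> v \<notin> N v"
  using dist[of v] by (auto simp: N_def)

lemma card_N: "v \<in> V \<Longrightarrow> card (N v) = 3"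
  using dist[of v] by (auto simp: N_def)

lemma arc_iff: "(v, u) \<in> parcs G \<longleftrightarrow> v \<in> V \<and> u \<in> N v"
  by (simp add: parcs_G)

lemma arc_sym: "(v, u) \<in> parcs G \<Longrightarrow> (u, v) \<in> parcs G"
  by (auto simp: arc_iff intro: N_V N_sym)

lemma finite_arcs: "finite (parcs G)"
proof (rule finite_subset)
  show "parcs G \<subseteq> V \<times> V" by (auto simp: parcs_G dest: N_V)
qed (simp add: finite_V)

lemma nbrs_G: "v \<in> V \<Longrightarrow> nbrs G v = N v"
  by (simp add: nbrs_def parcs_G)

lemma pair_graph_G: "pair_graph G"
proof unfold_locales
  show "finite (parcs G)" by (rule finite_arcs)
  show "symmetric (with_proj G)"
    using arc_sym by (auto simp: symmetric_def sym_def)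
qed (auto simp: parcs_G finite_V dest: N_V N_irrefl)

lemma rot_na: "v \<in> V \<Longrightarrow> rot v (na v) = nb v"
  and rot_nb: "v \<in> V \<Longrightarrow> rot v (nb v) = nc v"
  and rot_nc: "v \<in> V \<Longrightarrow> rot v (nc v) = na v"
  using dist[of v] by (auto simp: rot_def)

lemma rot_other: "u \<notin> N v \<Longrightarrow> rot v u = u"
  by (auto simp: rot_def N_def)

lemma rot_N: "v \<in> V \<Longrightarrow> u \<in> N v \<Longrightarrow> rot v u \<in> N v"
  using rot_na rot_nb rot_nc by (auto simp: N_def)

lemma rot_neq: "v \<in> V \<Longrightarrow> u \<in> N v \<Longrightarrow> rot v u \<noteq> u"
  using rot_na rot_nb rot_nc dist[of v] by (auto simp: N_def)

lemma rot3: "v \<in> V \<Longrightarrow> rot v (rot v (rot v u)) = u"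
  using rot_na rot_nb rot_nc by (cases "u \<in> N v") (auto simp: N_def rot_other)

lemma N_rot: "v \<in> V \<Longrightarrow> u \<in> N v \<Longrightarrow> N v = {u, rot v u, rot v (rot v u)}"
  using rot_na rot_nb rot_nc by (auto simp: N_def)

lemma rot2_neq: "v \<in> V \<Longrightarrow> u \<in> N v \<Longrightarrow> rot v (rot v u) \<noteq> u"
  using rot_na rot_nb rot_nc dist[of v] by (auto simp: N_def)

lemma bij_rot: "bij (rot v)"
proof (cases "v \<in> V")
  case True
  then show ?thesis
    by (intro bij_betw_byWitness[where f' = "\<lambda>u. rot v (rot v u)"]) (auto simp: rot3)
qed (simp add: rot_def)

lemma inv_rot: "v \<in> V \<Longrightarrow> inv_into UNIV (rot v) u = rot v (rot v u)"
  using bij_rot rot3 by (intro inv_f_eq) (auto simp: bij_def)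

lemma rot_permutes: "v \<in> V \<Longrightarrow> rot v permutes N v"
  using bij_rot[of v] by (auto simp: permutes_def rot_other bij_iff)

lemma rot_cyclic:
  assumes v: "v \<in> V"
  shows "cyclic_on (rot v) (N v)"
proof -
  have "orbit (rot v) (na v) = N v"
  proof (rule orbit_eqI_cycle)
    have "nb v \<in> orbit (rot v) (na v)" using rot_na[OF v] orbit.base by metis
    moreover from this have "nc v \<in> orbit (rot v) (na v)" using rot_nb[OF v] orbit.step by metis
    moreover from this have "na v \<in> orbit (rot v) (na v)" using rot_nc[OF v] orbit.step by metis
    ultimately show "z \<in> orbit (rot v) (na v)" if "z \<in> N v" for z
      using that by (auto simp: N_def)
  qed (use rot_N[OF v] in \<open>auto simp: N_def\<close>)
  then show ?thesis by (auto simp: cyclic_on_def N_def)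
qed

section \<open>Faces as orbits of arcs, and the count of edges\<close>

abbreviation fs :: "'v \<times> 'v \<Rightarrow> 'v \<times> 'v" where
  "fs \<equiv> face_step rot"

lemma fs_eq: "fs (u, v) = (v, rot v u)"
  by (simp add: face_step_def)

lemma fs_arc: "d \<in> parcs G \<Longrightarrow> fs d \<in> parcs G"
  by (cases d) (auto simp: fs_eq arc_iff intro: rot_N N_sym N_V)

lemma inj_fs: "inj fs"
  by (rule injI) (auto simp: face_step_def inj_eq[OF bij_is_inj[OF bij_rot]])

lemma self_in_face: "d \<in> parcs G \<Longrightarrow> d \<in> orbit fs d"
  using finite_arcs fs_arc inj_fs
  by (intro self_in_orbit_finite[of "parcs G"]) (auto intro: inj_on_subset)

lemma face_arcs: "d \<in> parcs G \<Longrightarrow> orbit fs d \<subseteq> parcs G"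
  using orbit_closed[of _ fs d "parcs G"] fs_arc by auto

lemma face_sym: "d \<in> parcs G \<Longrightarrow> e \<in> orbit fs d \<Longrightarrow> d \<in> orbit fs e"
  using self_in_face orbit_swap by metis

lemma face_eq:
  assumes "d \<in> parcs G" "e \<in> orbit fs d"
  shows "orbit fs e = orbit fs d"
  using orbit_trans[OF _ assms(2)] orbit_trans[OF _ face_sym[OF assms]] by blast

lemma face_step_face:
  assumes "d \<in> parcs G" shows "fs ` orbit fs d = orbit fs d"
proof
  show "fs ` orbit fs d \<subseteq> orbit fs d" by (auto intro: orbit.step)
  show "orbit fs d \<subseteq> fs ` orbit fs d"
  proof
    fix x assume "x \<in> orbit fs d"
    then show "x \<in> fs ` orbit fs d"
      by (cases rule: orbit.cases) (use self_in_face[OF assms] in auto)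
  qed
qed

definition fverts :: "'v \<times> 'v \<Rightarrow> 'v set" where
  "fverts d = fst ` orbit fs d"

lemma fverts_snd:
  assumes "d \<in> parcs G" shows "fverts d = snd ` orbit fs d"
proof -
  have "fverts d = fst ` fs ` orbit fs d" by (simp add: fverts_def face_step_face[OF assms])
  also have "\<dots> = snd ` orbit fs d"
    by (force simp: face_step_def image_image)
  finally show ?thesis .
qed

lemma cardArcs: "card (parcs G) = 3 * card V"
proof -
  have "parcs G = Sigma V N" by (auto simp: parcs_G)
  then show ?thesis using finite_V by (simp add: card_SigmaI N_def card_N[unfolded N_def])
qed

lemma edges_G: "edges G = {{v, u} |v u. v \<in> V \<and> u \<in> N v}"
  by (auto simp: edges_def parcs_G)

lemma edge_iff: "{u, v} \<in> edges G \<longleftrightarrow> u \<in> V \<and> v \<in> N u"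
  by (auto simp: edges_G doubleton_eq_iff intro: N_V N_sym)

text \<open>Double counting: three arcs leave every vertex, and every edge comes from exactly two
  opposite arcs.\<close>

lemma card_edges: "2 * card (edges G) = 3 * card V"
proof -
  have "card (parcs G) = (\<Sum>e\<in>edges G. card {d \<in> parcs G. (\<lambda>(u, v). {u, v}) d = e})"
    unfolding edges_def using sum.image_gen[OF finite_arcs, of "\<lambda>_. 1::nat" "\<lambda>(u, v). {u, v}"]
    by simp
  also have "\<dots> = (\<Sum>e\<in>edges G. 2)"
  proof (rule sum.cong)
    fix e assume "e \<in> edges G"
    then obtain v u where e: "e = {v, u}" and arc: "(v, u) \<in> parcs G"
      by (auto simp: edges_def)
    from arc have arc': "(u, v) \<in> parcs G" by (rule arc_sym)
    have "{d \<in> parcs G. (\<lambda>(u, v). {u, v}) d = e} = {(v, u), (u, v)}"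
    proof
      show "{(v, u), (u, v)} \<subseteq> {d \<in> parcs G. (\<lambda>(u, v). {u, v}) d = e}"
        using arc arc' e by auto
      show "{d \<in> parcs G. (\<lambda>(u, v). {u, v}) d = e} \<subseteq> {(v, u), (u, v)}"
        unfolding e by (clarsimp simp: doubleton_eq_iff)
    qed
    moreover have "v \<noteq> u" using arc N_irrefl by (auto simp: arc_iff)
    ultimately show "card {d \<in> parcs G. (\<lambda>(u, v). {u, v}) d = e} = 2" by simp
  qed simp
  finally show ?thesis using cardArcs by simp
qed

end

section \<open>Automorphisms\<close>

context cubic_rotation
begin

text \<open>A face enters each of its vertices \<open>v\<close> by some arc \<open>(p, v)\<close>
  and can be traced from there. This turns statements about the vertex set of a face into local
  statements at \<open>v\<close>.\<close>

lemma fverts_corner: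
  assumes "d \<in> parcs G" "v \<in> fverts d"
  obtains p where "v \<in> V" "p \<in> N v" "fverts d = fverts (p, v)"
proof -
  from assms obtain p where p: "(p, v) \<in> orbit fs d"
    by (auto simp: fverts_snd)
  then have "(p, v) \<in> parcs G" using face_arcs[OF assms(1)] by blast
  then have "(v, p) \<in> parcs G" by (rule arc_sym)
  then have "v \<in> V" "p \<in> N v" by (simp_all add: arc_iff)
  moreover have "fverts d = fverts (p, v)"
    using face_eq[OF assms(1) p] by (simp add: fverts_def)
  ultimately show ?thesis by (rule that)
qed

lemma arcI: "v \<in> V \<Longrightarrow> p \<in> N v \<Longrightarrow> (p, v) \<in> parcs G"
  by (rule arc_sym) (simp add: arc_iff)

lemma corner_fverts:
  assumes "v \<in> V" "p \<in> N v"
  shows "p \<in> fverts (p, v)" "v \<in> fverts (p, v)" "rot v p \<in> fverts (p, v)"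
    "rot (rot v p) v \<in> fverts (p, v)"
proof -
  have 1: "(p, v) \<in> orbit fs (p, v)" using self_in_face arcI assms by simp
  then have 2: "(v, rot v p) \<in> orbit fs (p, v)"
    by (metis fs_eq orbit.step)
  then have 3: "(rot v p, rot (rot v p) v) \<in> orbit fs (p, v)"
    by (metis fs_eq orbit.step)
  then have "fs (rot v p, rot (rot v p) v) \<in> orbit fs (p, v)"
    by (rule orbit.step)
  with 1 2 3 show "p \<in> fverts (p, v)" "v \<in> fverts (p, v)" "rot v p \<in> fverts (p, v)"
    "rot (rot v p) v \<in> fverts (p, v)"
    unfolding fverts_def by (metis fs_eq fst_conv imageI)+
qed

lemma fverts_V: "d \<in> parcs G \<Longrightarrow> fverts d \<subseteq> V"
  by (auto elim: fverts_corner)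

lemma cells_G: "cells G rot = (\<lambda>v. {v}) ` V \<union> edges G \<union> fverts ` parcs G"
  by (simp add: cells_def faces_def fverts_def image_image)

lemma edges_V: "e \<in> edges G \<Longrightarrow> e \<subseteq> V"
  by (auto simp: edges_G dest: N_V)

lemma card_edge:
  assumes "e \<in> edges G" shows "card e = 2"
proof -
  obtain v u where "e = {v, u}" "v \<in> V" "u \<in> N v" using assms by (auto simp: edges_G)
  then show ?thesis using N_irrefl[of v] by (cases "v = u") auto
qed

lemma finite_cells: "finite (cells G rot)"
proof (rule finite_subset)
  show "cells G rot \<subseteq> Pow V"
    unfolding cells_G using edges_V fverts_V by blast
qed (simp add: finite_V)

abbreviation "Aut \<equiv> carrier (aut_group G rot)"

lemma Aut_iff: "f \<in> Aut \<longleftrightarrow> f permutes V \<and> (`) f ` cells G rot = cells G rot"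
  by (simp add: aut_group_def)

text \<open>Mapping cells to cells suffices: there are finitely many cells, and taking images under
  a permutation is injective on sets.\<close>

lemma AutI:
  assumes f: "f permutes V"
    and edge: "\<And>v u. v \<in> V \<Longrightarrow> u \<in> N v \<Longrightarrow> f u \<in> N (f v)"
    and face: "\<And>d. d \<in> parcs G \<Longrightarrow> f ` fverts d \<in> fverts ` parcs G"
  shows "f \<in> Aut"
proof -
  have "f ` c \<in> cells G rot" if "c \<in> cells G rot" for c
  proof -
    consider v where "v \<in> V" "c = {v}" | v u where "v \<in> V" "u \<in> N v" "c = {v, u}"
      | d where "d \<in> parcs G" "c = fverts d"
      using \<open>c \<in> cells G rot\<close> by (auto simp: cells_G edges_G)
    then show ?thesis
    proof cases
      case 1
      then show ?thesis using f by (auto simp: cells_G permutes_in_image)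
    next
      case 2
      then have "{f v, f u} \<in> edges G"
        using f edge by (simp add: edge_iff permutes_in_image)
      with 2 show ?thesis by (simp add: cells_G)
    next
      case 3
      then show ?thesis using face by (simp add: cells_G)
    qed
  qed
  moreover have "inj_on ((`) f) (cells G rot)"
    using permutes_inj[OF f] by (simp add: inj_on_def inj_image_eq_iff)
  ultimately have "(`) f ` cells G rot = cells G rot"
    by (intro endo_inj_surj finite_cells) auto
  with f show ?thesis by (simp add: Aut_iff)
qed

section \<open>Maps that preserve or reverse the cyclic order at every vertex\<close>

definition preserving :: "('v \<Rightarrow> 'v) \<Rightarrow> bool" where
  "preserving f \<longleftrightarrow> f permutes V \<and>
     (\<forall>v\<in>V. \<forall>u\<in>N v. f u \<in> N (f v) \<and> f (rot v u) = rot (f v) (f u))"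

text \<open>The rotation at a vertex has order three, so applying \<open>rot\<close> twice is
  applying its inverse.\<close>

definition reversing :: "('v \<Rightarrow> 'v) \<Rightarrow> bool" where
  "reversing f \<longleftrightarrow> f permutes V \<and>
     (\<forall>v\<in>V. \<forall>u\<in>N v. f u \<in> N (f v) \<and> f (rot v u) = rot (f v) (rot (f v) (f u)))"

lemma preserving_Aut:
  assumes "preserving f" shows "f \<in> Aut"
proof (rule AutI)
  show edge: "f u \<in> N (f v)" if "v \<in> V" "u \<in> N v" for u v
    using assms that by (auto simp: preserving_def)
  show "f permutes V" using assms by (simp add: preserving_def)
  show "f ` fverts d \<in> fverts ` parcs G" if d: "d \<in> parcs G" for d
  proof -
    have "map_prod f f ` orbit fs d = orbit fs (map_prod f f d)"
    proof (rule orbit_inverse[OF self_in_face[OF d]])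
      fix x assume "x \<in> orbit fs d"
      then have "x \<in> parcs G" using face_arcs[OF d] by blast
      then obtain u v where x: "x = (u, v)" "u \<in> V" "v \<in> N u"
        by (cases x) (simp add: arc_iff)
      then have "v \<in> V" "u \<in> N v" using N_V N_sym by blast+
      then have "f (rot v u) = rot (f v) (f u)"
        using assms unfolding preserving_def by blast
      then show "fs (map_prod f f x) = map_prod f f (fs x)"
        by (simp add: x fs_eq)
    qed
    moreover have "map_prod f f d \<in> parcs G"
    proof (cases d)
      case (Pair u v)
      then have "v \<in> N u" "u \<in> V" using d by (auto simp: arc_iff)
      moreover from this have "f u \<in> V"
        using assms by (simp add: preserving_def permutes_in_image)
      ultimately show ?thesis using edge Pair by (simp add: arc_iff)
    qed
    moreover have "fst ` map_prod f f ` orbit fs d = f ` fverts d"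
      by (simp add: image_image fverts_def)
    ultimately show ?thesis unfolding fverts_def by (metis imageI)
  qed
qed

lemma preserving_orientation: "preserving f \<Longrightarrow> orientation_preserving G rot f"
  by (auto simp: preserving_def orientation_preserving_def parcs_G)

text \<open>A reversing map runs the boundary of the image face backwards, hence the swapped arc
  \<open>(f v, f u)\<close>. With \<open>h\<close> sending \<open>(x, y)\<close> to
  \<open>(f y, f x)\<close>, the identity \<open>fs (h (fs e)) = h e\<close> says that
  \<open>h\<close> carries \<open>fs\<close> to its inverse; on finite cycles both have the same
  orbits.\<close>

lemma reversing_face:
  assumes f: "reversing f" and d: "(u, v) \<in> parcs G"
  shows "f ` fverts (u, v) = fverts (f v, f u)" "(f v, f u) \<in> parcs G"
proof -
  define h where "h = (\<lambda>(x, y). (f y, f x))"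
  have arc: "h e \<in> parcs G" if "e \<in> parcs G" for e
  proof -
    obtain x y where e: "e = (x, y)" by (cases e)
    with that have "(y, x) \<in> parcs G" by (blast intro: arc_sym)
    then have "y \<in> V" "x \<in> N y" by (auto simp: arc_iff)
    then have "f y \<in> V" "f x \<in> N (f y)"
      using f by (auto simp: reversing_def permutes_in_image)
    then show ?thesis by (simp add: e h_def arc_iff)
  qed
  have step: "fs (h (fs e)) = h e" if "e \<in> parcs G" for e
  proof -
    obtain x y where e: "e = (x, y)" by (cases e)
    with that have "(y, x) \<in> parcs G" by (blast intro: arc_sym)
    then have y: "y \<in> V" "x \<in> N y" by (auto simp: arc_iff)
    then have "f y \<in> V" using f by (simp add: reversing_def permutes_in_image)
    moreover have "f (rot y x) = rot (f y) (rot (f y) (f x))"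
      using f y unfolding reversing_def by blast
    ultimately show ?thesis by (simp add: e h_def fs_eq rot3)
  qed
  have "orbit fs (h (u, v)) = h ` orbit fs (u, v)"
  proof (rule orbit_eqI_cycle)
    show "h (u, v) \<in> h ` orbit fs (u, v)" using self_in_face[OF d] by simp
    show "fs z \<in> h ` orbit fs (u, v)" if "z \<in> h ` orbit fs (u, v)" for z
    proof -
      from that obtain e where "e \<in> orbit fs (u, v)" "z = h e" by auto
      moreover from this obtain e' where e': "e' \<in> orbit fs (u, v)" "e = fs e'"
        using face_step_face[OF d] by blast
      ultimately have "fs z = h e'" using step face_arcs[OF d] by blast
      with e' show ?thesis by blast
    qed
    show "z \<in> orbit fs (h (u, v))" if "z \<in> h ` orbit fs (u, v)" for z
    proof -
      from that obtain e where "e \<in> orbit fs (u, v)" "z = h e" by auto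
      from this(1) have "h e \<in> orbit fs (h (u, v))"
      proof induction
        case base
        have "h (u, v) \<in> orbit fs (h (fs (u, v)))"
          using step[OF d] by (metis orbit.base)
        then show ?case using face_sym arc fs_arc d by blast
      next
        case (step e)
        then have "e \<in> parcs G" using face_arcs[OF d] by auto
        then have "h e \<in> orbit fs (h (fs e))"
          using \<open>\<And>e. e \<in> parcs G \<Longrightarrow> fs (h (fs e)) = h e\<close> by (metis orbit.base)
        then have "h (fs e) \<in> orbit fs (h e)"
          using face_sym arc fs_arc \<open>e \<in> parcs G\<close> by blast
        then show ?case using step orbit_trans by metis
      qed
      with \<open>z = h e\<close> show ?thesis by simp
    qed
  qed
  then have "fverts (f v, f u) = fst ` h ` orbit fs (u, v)"
    by (simp add: fverts_def h_def)
  also have "\<dots> = f ` snd ` orbit fs (u, v)"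
    by (simp add: image_image h_def case_prod_unfold)
  finally show "f ` fverts (u, v) = fverts (f v, f u)"
    by (simp add: fverts_snd[OF d])
  show "(f v, f u) \<in> parcs G" using arc[OF d] by (simp add: h_def)
qed

lemma reversing_Aut:
  assumes "reversing f" shows "f \<in> Aut"
proof (rule AutI)
  show "f permutes V" using assms by (simp add: reversing_def)
  show "f u \<in> N (f v)" if "v \<in> V" "u \<in> N v" for u v
    using assms that by (auto simp: reversing_def)
  show "f ` fverts d \<in> fverts ` parcs G" if "d \<in> parcs G" for d
    using reversing_face[OF assms] that by (cases d) auto
qed

text \<open>At \<open>v\<close> both conditions together would give a rotation with a fixed
  neighbour. The vertex excludes the empty graph, on which the two notions coincide.\<close>

lemma reversing_orientation:
  assumes "reversing f" "v \<in> V" shows "\<not> orientation_preserving G rot f"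
proof
  assume *: "orientation_preserving G rot f"
  obtain u where u: "u \<in> N v" by (auto simp: N_def)
  have "f (rot v u) = rot (f v) (f u)"
    using * assms u by (auto simp: orientation_preserving_def parcs_G)
  moreover have "f (rot v u) = rot (f v) (rot (f v) (f u))" "f u \<in> N (f v)" "f v \<in> V"
    using assms u by (auto simp: reversing_def permutes_in_image)
  ultimately show False using rot_neq[of "f v" "rot (f v) (f u)"] rot_N by metis
qed

lemma preserving_comp:
  assumes "preserving f" "preserving g" shows "preserving (f \<circ> g)"
  using assms unfolding preserving_def
  by (auto simp: permutes_compose permutes_in_image)

lemma preserving_reversing:
  assumes "preserving f" "reversing g" shows "reversing (f \<circ> g)"
  using assms unfolding preserving_def reversing_def
  by (auto simp: permutes_compose permutes_in_image rot_N)

lemma reversing_preserving: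
  assumes "reversing f" "preserving g" shows "reversing (f \<circ> g)"
  using assms unfolding preserving_def reversing_def
  by (auto simp: permutes_compose permutes_in_image rot_N)

lemma reversing_comp:
  assumes "reversing f" "reversing g" shows "preserving (f \<circ> g)"
  using assms unfolding preserving_def reversing_def
  by (auto simp: permutes_compose permutes_in_image rot_N rot3)

lemma Aut_comp: "f \<in> Aut \<Longrightarrow> g \<in> Aut \<Longrightarrow> f \<circ> g \<in> Aut"
proof -
  assume fg: "f \<in> Aut" "g \<in> Aut"
  have "(`) (f \<circ> g) ` cells G rot = (`) f ` (`) g ` cells G rot"
    unfolding image_image by (simp add: image_comp)
  with fg show "f \<circ> g \<in> Aut"
    by (simp add: Aut_iff permutes_compose)
qed

lemma Aut_cell: "f \<in> Aut \<Longrightarrow> c \<in> cells G rot \<Longrightarrow> f ` c \<in> cells G rot"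
  by (metis Aut_iff imageI)

lemma Aut_inv:
  assumes "f \<in> Aut" shows "inv_into UNIV f \<in> Aut"
proof -
  let ?g = "inv_into UNIV f"
  have f: "f permutes V" "(`) f ` cells G rot = cells G rot"
    using assms by (simp_all add: Aut_iff)
  have "?g ` f ` c = c" for c
    using permutes_inj[OF f(1)] by (simp add: image_image)
  then have "(`) ?g ` (`) f ` cells G rot = cells G rot"
    by (simp add: image_image)
  then show ?thesis using f by (simp add: Aut_iff permutes_inv)
qed

text \<open>The action of an orientation-reversing map on traversal states: left and right turns are
  exchanged, hence the negated flag.\<close>

definition zmap :: "('v \<Rightarrow> 'v) \<Rightarrow> ('v \<times> 'v) \<times> bool \<Rightarrow> ('v \<times> 'v) \<times> bool" where
  "zmap f = (\<lambda>((u, v), b). ((f u, f v), \<not> b))"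

lemma zigzag_step_arc: "fst s \<in> parcs G \<Longrightarrow> fst (zigzag_step rot s) \<in> parcs G"
proof -
  assume s: "fst s \<in> parcs G"
  obtain u v b where s': "s = ((u, v), b)" by (metis surj_pair)
  with s have "(v, u) \<in> parcs G" by (auto intro: arc_sym)
  then have "v \<in> V" "u \<in> N v" by (auto simp: arc_iff)
  then show ?thesis by (simp add: s' zigzag_step_def arc_iff inv_rot rot_N)
qed

lemma reversing_zigzag_step:
  assumes f: "reversing f" and s: "fst s \<in> parcs G"
  shows "zigzag_step rot (zmap f s) = zmap f (zigzag_step rot s)"
proof -
  obtain u v b where s': "s = ((u, v), b)" by (metis surj_pair)
  with s have "(v, u) \<in> parcs G" by (auto intro: arc_sym)
  then have v: "v \<in> V" "u \<in> N v" by (auto simp: arc_iff)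
  then have "f v \<in> V" "rot v u \<in> N v"
    using f rot_N by (auto simp: reversing_def permutes_in_image)
  moreover have *: "f (rot v w) = rot (f v) (rot (f v) (f w))" if "w \<in> N v" for w
    using f v that unfolding reversing_def by blast
  ultimately show ?thesis
    using v by (auto simp: s' zigzag_step_def zmap_def inv_rot * rot3)
qed

end

text \<open>The facts about faces from which rigidity follows: no face contains a vertex together
  with all its neighbours, and the vertex sets of faces are too large to be confused with
  edges.\<close>

locale facial_cubic = cubic_rotation +
  assumes conn: "u \<in> V \<Longrightarrow> v \<in> V \<Longrightarrow> (u, v) \<in> (parcs G)\<^sup>*"
    and no_claw: "d \<in> parcs G \<Longrightarrow> w \<in> fverts d \<Longrightarrow> \<not> N w \<subseteq> fverts d"
    and card_fverts: "d \<in> parcs G \<Longrightarrow> 3 \<le> card (fverts d)"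
begin

lemma Aut_permutes: "f \<in> Aut \<Longrightarrow> f permutes V"
  by (simp add: Aut_iff)

lemma Aut_card: "f \<in> Aut \<Longrightarrow> card (f ` c) = card c"
  by (meson Aut_permutes card_image inj_on_subset permutes_inj subset_UNIV)

text \<open>Images keep their cardinality, and among the cells exactly the edges have two
  elements.\<close>

lemma Aut_edge:
  assumes f: "f \<in> Aut" and v: "v \<in> V" "u \<in> N v"
  shows "f u \<in> N (f v)"
proof -
  have "{v, u} \<in> cells G rot" using v by (auto simp: cells_G edges_G)
  then have "f ` {v, u} \<in> cells G rot" by (rule Aut_cell[OF f])
  moreover have "card (f ` {v, u}) = 2"
    using Aut_card[OF f, of "{v, u}"] v N_irrefl[of v] by (auto simp: card_2_iff)
  moreover have "card (fverts d) \<noteq> 2" if "d \<in> parcs G" for d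
    using card_fverts[OF that] by simp
  ultimately have "f ` {v, u} \<in> edges G"
    unfolding cells_G by (metis (no_types, lifting) Un_iff imageE is_singletonI is_singleton_altdef numeral_eq_one_iff semiring_norm(85))
  then show ?thesis by (simp add: edge_iff)
qed

lemma Aut_face:
  assumes f: "f \<in> Aut" and d: "d \<in> parcs G"
  shows "\<exists>d'\<in>parcs G. f ` fverts d = fverts d'"
proof -
  have "fverts d \<in> cells G rot" using d by (auto simp: cells_G)
  then have "f ` fverts d \<in> cells G rot" by (rule Aut_cell[OF f])
  moreover have "3 \<le> card (f ` fverts d)"
    using Aut_card[OF f] card_fverts[OF d] by simp
  ultimately show ?thesis using card_edge by (fastforce simp: cells_G)
qed

text \<open>A face through three of the four vertices of a zigzag-shaped path turns away from the fourth.\<close>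

lemma no_zigzag_in_face:
  assumes d: "d \<in> parcs G" and v: "v \<in> V" "u \<in> N v"
    and sub: "{u, v, rot v u, rot (rot v u) (rot (rot v u) v)} \<subseteq> fverts d"
  shows False
proof -
  define w where "w = rot v u"
  have w: "w \<in> N v" using rot_N[OF v] by (simp add: w_def)
  note w = w N_V[OF v(1) w] N_sym[OF v(1) w]
  from sub d obtain p where p: "p \<in> N v" "fverts d = fverts (p, v)"
    by (auto elim: fverts_corner)
  note c = corner_fverts[OF v(1) p(1), folded p(2)]
  have Nv: "N v = {u, w, rot v w}" using N_rot[OF v] by (simp add: w_def)
  \<comment> \<open>The face enters \<open>v\<close> from one of the three neighbours. From
    \<open>u\<close> it goes on to \<open>w\<close> and \<open>rot w v\<close>, which completes the
    neighbourhood of \<open>w\<close>; from either other one it passes the third neighbour of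
    \<open>v\<close>, which completes that of \<open>v\<close>.\<close>
  then consider "p = u" | "p = w" | "p = rot v w" using p by auto
  then show False
  proof cases
    case 1
    then have "N w \<subseteq> fverts d"
      using N_rot[OF w(2,3)] c sub by (auto simp: w_def)
    then show False using no_claw[OF d, of w] sub by (simp add: w_def)
  next
    case 2
    then have "N v \<subseteq> fverts d" using Nv c sub by (auto simp: w_def)
    then show False using no_claw[OF d, of v] sub by simp
  next
    case 3
    then have "N v \<subseteq> fverts d" using Nv c sub by (auto simp: w_def)
    then show False using no_claw[OF d, of v] sub by simp
  qed
qed

text \<open>The path \<open>u, v, w, y\<close> turns twice to the same side and so lies on a face.
  If \<open>k\<close> exchanged the remaining neighbours \<open>y\<close> and \<open>z\<close> of
  \<open>w\<close>, the image face would contain \<open>u, v, w, z\<close>, a path with turns to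
  different sides, contrary to \<open>no_zigzag_in_face\<close>.\<close>

lemma Aut_fix_step:
  assumes k: "k \<in> Aut" and v: "v \<in> V" "k v = v" "\<And>u. u \<in> N v \<Longrightarrow> k u = u"
    and w: "w \<in> N v" and x: "x \<in> N w"
  shows "k x = x"
proof -
  define u where "u = rot v (rot v w)"
  have u: "u \<in> N v" "rot v u = w" using v(1) w by (simp_all add: u_def rot_N rot3)
  have wV: "w \<in> V" "v \<in> N w" using N_V[OF v(1) w] N_sym[OF v(1) w] by simp_all
  define y z where "y = rot w v" and "z = rot w (rot w v)"
  have Nw: "N w = {v, y, z}" using N_rot[OF wV] by (simp add: y_def z_def)
  have arc: "(u, v) \<in> parcs G" using arcI v u by simp
  have sub: "{u, v, w, y} \<subseteq> fverts (u, v)"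
    using corner_fverts[OF v(1) u(1)] u(2) by (simp add: y_def)
  obtain d' where d': "d' \<in> parcs G" "k ` fverts (u, v) = fverts d'"
    using Aut_face[OF k arc] by auto
  have kw: "k w = w" and ku: "k u = u" using v w u by auto
  have "{k u, k v, k w, k y} \<subseteq> fverts d'" using sub d'(2) by blast
  then have sub': "{u, v, w, k y} \<subseteq> fverts d'" using v kw ku by simp
  have inj: "inj k" using permutes_inj Aut_permutes k by blast
  have dis: "y \<noteq> v" "z \<noteq> v" "y \<noteq> z"
    using rot_neq[OF wV] rot2_neq[OF wV] rot_neq[of w y] rot_N[OF wV] wV
    by (auto simp: y_def z_def)
  have "k y \<in> N w" "k z \<in> N w"
    using Aut_edge[OF k wV(1)] Nw kw by force+
  moreover have "k y \<noteq> v" "k z \<noteq> v" "k y \<noteq> k z"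
    using dis v(2) inj by (metis injD)+
  moreover have "k y \<noteq> z"
  proof
    assume "k y = z"
    then have "{u, v, rot v u, rot (rot v u) (rot (rot v u) v)} \<subseteq> fverts d'"
      using sub' u(2) by (simp add: z_def)
    then show False using no_zigzag_in_face d'(1) v(1) u(1) by blast
  qed
  ultimately have "k y = y" "k z = z" using Nw by auto
  then show ?thesis using x Nw v by auto
qed

text \<open>The property of being fixed together with all neighbours spreads along edges, and the
  graph is connected.\<close>

lemma Aut_rigid:
  assumes k: "k \<in> Aut" and v: "v \<in> V" "k v = v" "\<And>u. u \<in> N v \<Longrightarrow> k u = u"
  shows "k = id"
proof -
  have "k x = x \<and> (\<forall>u\<in>N x. k u = u)" if "x \<in> V" for x
    using conn[OF v(1) that]
  proof (induction rule: rtrancl_induct)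
    case base
    then show ?case using v by simp
  next
    case (step y z)
    then show ?case using Aut_fix_step[OF k, of y z] by (auto simp: arc_iff)
  qed
  then show ?thesis using Aut_permutes[OF k] by (auto simp: permutes_def fun_eq_iff)
qed

lemma Aut_eqI:
  assumes f: "f \<in> Aut" and g: "g \<in> Aut"
    and v: "v \<in> V" "f v = g v" "\<And>u. u \<in> N v \<Longrightarrow> f u = g u"
  shows "f = g"
proof -
  have inj: "inv_into UNIV g (g x) = x" for x
    using Aut_permutes[OF g] by (simp add: permutes_inverses)
  have "inv_into UNIV g \<circ> f = id"
    using v by (intro Aut_rigid[of _ v] Aut_comp Aut_inv f g) (auto simp: inj)
  then have "g (inv_into UNIV g (f x)) = g x" for x by (metis comp_apply id_apply)
  then show ?thesis
    using Aut_permutes[OF g] by (simp add: permutes_inverses fun_eq_iff)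
qed

end

section \<open>The tube\<close>

text \<open>
  Layer \<open>j\<close> of the tube is a circle with twelve sites, and \<open>P j i\<close> is the vertex at the site
  \<open>i mod 12\<close>.  The outermost layers have only the eight vertices at the sites satisfying \<open>valid\<close>.
\<close>

definition P :: "int \<Rightarrow> int \<Rightarrow> nat" where
  "P j i = nat (12 * j + i mod 12)"

definition lay :: "nat \<Rightarrow> int" where "lay v = int v div 12"
definition pos :: "nat \<Rightarrow> int" where "pos v = int v mod 12"

lemma lay_P [simp]: "0 \<le> j \<Longrightarrow> lay (P j i) = j"
  and pos_P [simp]: "0 \<le> j \<Longrightarrow> pos (P j i) = i mod 12"
  by (simp_all add: P_def lay_def pos_def)

lemma P_cong: "i mod 12 = i' mod 12 \<Longrightarrow> P j i = P j i'"
  by (simp add: P_def)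

lemma P_mod [simp]: "P j (i mod 12) = P j i"
  by (simp add: P_def)

lemma P_mod_add [simp]: "P j (i mod 12 + k) = P j (i + k)" "P j (i mod 12 - k) = P j (i - k)"
  by (rule P_cong, simp add: mod_simps)+

lemma P_eq_iff: "0 \<le> j \<Longrightarrow> 0 \<le> j' \<Longrightarrow> P j i = P j' i' \<longleftrightarrow> j = j' \<and> 12 dvd (i - i')"
  by (metis P_cong lay_P pos_P mod_eq_dvd_iff)

text \<open>At least three layers, so that no face touches both end layers. Divisibility by 3 gives
  \<open>6 dvd 2 * n\<close>: a shift by \<open>n\<close> and a shift by \<open>- n\<close> have the
  same effect on conditions modulo 6.\<close>

locale tube =
  fixes n :: int
  assumes n3: "3 \<le> n" and dvd_n: "3 dvd n"
begin

text \<open>The bottom layer lacks the sites 2, 4, 8, 10, and the top layer lacks these sites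
  shifted by \<open>n\<close>. The ends of the chords are the sites 0, 6 at the bottom and
  \<open>n\<close>, \<open>n + 6\<close> at the top.\<close>

definition valid :: "int \<Rightarrow> int \<Rightarrow> bool" where
  "valid j i \<longleftrightarrow> 0 \<le> j \<and> j < n \<and> (j = 0 \<longrightarrow> odd i \<or> 6 dvd i) \<and>
     (j = n - 1 \<longrightarrow> odd (i + n) \<or> 6 dvd (i - n))"

definition VV :: "nat set" where "VV = {P j i |j i. valid j i}"

definition up :: "nat \<Rightarrow> bool" where "up v \<longleftrightarrow> odd (pos v + lay v)"

text \<open>
  Right and left neighbour on the circle, and vertical neighbour.  In the outermost layers the
  neighbour may skip a missing site, and the vertices that have no layer beyond them are joined to
  their antipodes: these two chords close the tube.
\<close>

definition nR :: "nat \<Rightarrow> nat" where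
  "nR v = (if valid (lay v) (pos v + 1) then P (lay v) (pos v + 1) else P (lay v) (pos v + 2))"
definition nL :: "nat \<Rightarrow> nat" where
  "nL v = (if valid (lay v) (pos v - 1) then P (lay v) (pos v - 1) else P (lay v) (pos v - 2))"
definition nV :: "nat \<Rightarrow> nat" where
  "nV v = (if up v then if lay v = n - 1 then P (lay v) (pos v + 6) else P (lay v + 1) (pos v)
           else if lay v = 0 then P (lay v) (pos v + 6) else P (lay v - 1) (pos v))"

text \<open>Drawn with higher layers above, the counterclockwise order is right, up, left at an
  upward vertex and left, down, right at a downward one; \<open>nV\<close> is always the middle
  entry.\<close>

definition na :: "nat \<Rightarrow> nat" where "na v = (if up v then nR v else nL v)"
definition nc :: "nat \<Rightarrow> nat" where "nc v = (if up v then nL v else nR v)"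

lemma valid_cong: "i mod 12 = i' mod 12 \<Longrightarrow> valid j i = valid j i'"
proof -
  assume "i mod 12 = i' mod 12"
  then obtain k where "i = i' + 12 * k" by (metis mod_eqE add.commute mult.commute)
  then show ?thesis unfolding valid_def by presburger
qed

lemma valid_mod [simp]: "valid j (i mod 12 + k) = valid j (i + k)"
    "valid j (i mod 12 - k) = valid j (i - k)" "valid j (i mod 12) = valid j i"
  by (rule valid_cong, simp add: mod_simps)+

lemma nR_P: "0 \<le> j \<Longrightarrow> nR (P j i) = (if valid j (i + 1) then P j (i + 1) else P j (i + 2))"
  and nL_P: "0 \<le> j \<Longrightarrow> nL (P j i) = (if valid j (i - 1) then P j (i - 1) else P j (i - 2))"
  and up_P: "0 \<le> j \<Longrightarrow> up (P j i) = odd (i + j)"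
  and nV_P: "0 \<le> j \<Longrightarrow> nV (P j i) =
      (if odd (i + j) then if j = n - 1 then P j (i + 6) else P (j + 1) i
       else if j = 0 then P j (i + 6) else P (j - 1) i)"
proof -
  assume j: "0 \<le> j"
  show "nR (P j i) = (if valid j (i + 1) then P j (i + 1) else P j (i + 2))"
    and "nL (P j i) = (if valid j (i - 1) then P j (i - 1) else P j (i - 2))"
    using j by (simp_all add: nR_def nL_def)
  have "odd (i mod 12 + j) = odd (i + j)" by presburger
  with j show u: "up (P j i) = odd (i + j)" by (simp add: up_def)
  show "nV (P j i) =
      (if odd (i + j) then if j = n - 1 then P j (i + 6) else P (j + 1) i
       else if j = 0 then P j (i + 6) else P (j - 1) i)"
    using j by (simp add: nV_def u)
qed

lemma VV_cases:
  assumes "v \<in> VV" obtains j i where "v = P j i" "valid j i" "0 \<le> j" "j < n"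
  using assms by (auto simp: VV_def valid_def)

lemma P_VV: "0 \<le> j \<Longrightarrow> P j i \<in> VV \<longleftrightarrow> valid j i"
proof
  assume "0 \<le> j" "P j i \<in> VV"
  then obtain j' i' where "P j i = P j' i'" "valid j' i'" "0 \<le> j'" by (auto elim: VV_cases)
  then show "valid j i" using \<open>0 \<le> j\<close> valid_cong[of i i' j] by (auto simp: P_eq_iff mod_eq_dvd_iff)
qed (auto simp: VV_def)

text \<open>Missing sites are isolated, so skipping one site always reaches a vertex.\<close>

lemma valid_R: "valid j i \<Longrightarrow> \<not> valid j (i + 1) \<Longrightarrow> valid j (i + 2)"
  using n3 unfolding valid_def by presburger

lemma valid_L: "valid j i \<Longrightarrow> \<not> valid j (i - 1) \<Longrightarrow> valid j (i - 2)"
  using n3 unfolding valid_def by presburger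

lemma valid_up: "valid j i \<Longrightarrow> odd (i + j) \<Longrightarrow> j \<noteq> n - 1 \<Longrightarrow> valid (j + 1) i"
  using n3 unfolding valid_def by presburger

lemma valid_down: "valid j i \<Longrightarrow> even (i + j) \<Longrightarrow> j \<noteq> 0 \<Longrightarrow> valid (j - 1) i"
  using n3 unfolding valid_def by presburger

lemma valid_6: "valid j (i + 6) = valid j i"
  using n3 unfolding valid_def by presburger

lemma nR_VV: "v \<in> VV \<Longrightarrow> nR v \<in> VV" and nL_VV: "v \<in> VV \<Longrightarrow> nL v \<in> VV"
  by (auto elim!: VV_cases simp: nR_P nL_P P_VV valid_R valid_L)

lemma nV_VV: "v \<in> VV \<Longrightarrow> nV v \<in> VV"
proof (elim VV_cases)
  fix j i assume v: "v = P j i" "valid j i" "0 \<le> j"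
  show "nV v \<in> VV"
    using n3 v valid_up[OF v(2)] valid_down[OF v(2)] by (cases "j = 0") (auto simp: nV_P P_VV valid_6)
qed

lemma nL_nR: "v \<in> VV \<Longrightarrow> nL (nR v) = v"
proof (elim VV_cases)
  fix j i assume v: "v = P j i" "valid j i" "0 \<le> j"
  show "nL (nR v) = v"
  proof (cases "valid j (i + 1)")
    case False
    then have "\<not> valid j (i + 2 - 1)" by (simp add: algebra_simps)
    then show ?thesis using v False by (simp add: nR_P nL_P)
  qed (use v in \<open>simp add: nR_P nL_P\<close>)
qed

lemma nR_nL: "v \<in> VV \<Longrightarrow> nR (nL v) = v"
proof (elim VV_cases)
  fix j i assume v: "v = P j i" "valid j i" "0 \<le> j"
  show "nR (nL v) = v"
  proof (cases "valid j (i - 1)")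
    case False
    then have "\<not> valid j (i - 2 + 1)" by (simp add: algebra_simps)
    then show ?thesis using v False by (simp add: nR_P nL_P)
  qed (use v in \<open>simp add: nR_P nL_P\<close>)
qed

lemma P_12: "P j (i + 12) = P j i"
  by (rule P_cong) simp

lemma nV_nV: "v \<in> VV \<Longrightarrow> nV (nV v) = v"
  by (auto elim!: VV_cases simp: nV_P P_12 algebra_simps)

lemma distinct_nbrs: "v \<in> VV \<Longrightarrow> distinct [v, nR v, nL v, nV v]"
proof (elim VV_cases)
  fix j i assume v: "v = P j i" "valid j i" "0 \<le> j" "j < n"
  show "distinct [v, nR v, nL v, nV v]"
    using v n3 by (auto simp: nR_P nL_P nV_P P_eq_iff)
qed

lemma finite_VV: "finite VV"
proof (rule finite_subset)
  have "P j i < nat (12 * n)" if "valid j i" for j i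
    using that pos_mod_bound[of 12 i] unfolding valid_def P_def by linarith
  then show "VV \<subseteq> {..<nat (12 * n)}" by (auto simp: VV_def)
qed simp

sublocale cubic_rotation VV na nV nc
proof
  show "finite VV" by (rule finite_VV)
  fix v assume v: "v \<in> VV"
  show "na v \<in> VV \<and> nV v \<in> VV \<and> nc v \<in> VV"
    using nR_VV nL_VV nV_VV v by (simp add: na_def nc_def)
  show "distinct [v, na v, nV v, nc v]"
    using distinct_nbrs[OF v] by (auto simp: na_def nc_def)
  fix u assume u: "u \<in> {na v, nV v, nc v}"
  then consider "u = nR v" | "u = nL v" | "u = nV v" by (auto simp: na_def nc_def split: if_splits)
  then show "v \<in> {na u, nV u, nc u}"
    by cases (use v nL_nR nR_nL nV_nV in \<open>auto simp: na_def nc_def\<close>)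
qed

lemma N_eq: "N v = {nR v, nL v, nV v}"
  by (auto simp: N_def na_def nc_def)

lemma rot_nR: "v \<in> VV \<Longrightarrow> rot v (nR v) = (if up v then nV v else nL v)"
  and rot_nV: "v \<in> VV \<Longrightarrow> rot v (nV v) = (if up v then nL v else nR v)"
  and rot_nL: "v \<in> VV \<Longrightarrow> rot v (nL v) = (if up v then nR v else nV v)"
  using rot_na[of v] rot_nb[of v] rot_nc[of v] by (auto simp: na_def nc_def)

definition dR :: "nat \<Rightarrow> nat \<times> nat" where "dR v = (v, nR v)"
definition dL :: "nat \<Rightarrow> nat \<times> nat" where "dL v = (v, nL v)"
definition dV :: "nat \<Rightarrow> nat \<times> nat" where "dV v = (v, nV v)"

lemma fst_dart [simp]: "fst (dR v) = v" "fst (dL v) = v" "fst (dV v) = v"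
  by (simp_all add: dR_def dL_def dV_def)

lemma fs_dR: "v \<in> VV \<Longrightarrow> fs (dR v) = (if up (nR v) then dR (nR v) else dV (nR v))"
  and fs_dL: "v \<in> VV \<Longrightarrow> fs (dL v) = (if up (nL v) then dV (nL v) else dL (nL v))"
  and fs_dV: "v \<in> VV \<Longrightarrow> fs (dV v) = (if up (nV v) then dL (nV v) else dR (nV v))"
proof -
  assume v: "v \<in> VV"
  show "fs (dR v) = (if up (nR v) then dR (nR v) else dV (nR v))"
    using rot_nL[OF nR_VV[OF v]] v by (simp add: nL_nR fs_eq dR_def dV_def)
  show "fs (dL v) = (if up (nL v) then dV (nL v) else dL (nL v))"
    using rot_nR[OF nL_VV[OF v]] v by (simp add: nR_nL fs_eq dL_def dV_def)
  show "fs (dV v) = (if up (nV v) then dL (nV v) else dR (nV v))"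
    using rot_nV[OF nV_VV[OF v]] v by (simp add: nV_nV fs_eq dL_def dR_def dV_def)
qed

lemma arcs_cases:
  assumes "d \<in> parcs G"
  obtains v where "v \<in> VV" "d = dR v" | v where "v \<in> VV" "d = dL v"
    | v where "v \<in> VV" "d = dV v"
  using assms by (cases d) (auto simp: arc_iff N_eq dR_def dL_def dV_def)

lemma darts_in: "v \<in> VV \<Longrightarrow> dR v \<in> parcs G" "v \<in> VV \<Longrightarrow> dL v \<in> parcs G"
  "v \<in> VV \<Longrightarrow> dV v \<in> parcs G"
  by (simp_all add: arc_iff N_eq dR_def dL_def dV_def)

end

section \<open>Faces of the tube\<close>

text \<open>Reduces the computation of a face to checking the successor of each entry of an explicit
  cyclic list.\<close>

lemma orbit_list:
  assumes "\<And>k. k < length xs \<Longrightarrow> f (xs ! k) = xs ! (Suc k mod length xs)" "xs \<noteq> []"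
  shows "orbit f (xs ! 0) = set xs"
proof (rule orbit_eqI_cycle)
  show "xs ! 0 \<in> set xs" using assms(2) by simp
  show "f z \<in> set xs" if "z \<in> set xs" for z
  proof -
    from that obtain k where k: "k < length xs" "z = xs ! k" by (auto simp: in_set_conv_nth)
    have "f z = xs ! (Suc k mod length xs)" unfolding k(2) by (rule assms(1)[OF k(1)])
    then show ?thesis using assms(2) by (metis length_greater_0_conv mod_less_divisor nth_mem)
  qed
  have step: "f (xs ! k) = xs ! Suc k" if "Suc k < length xs" for k
    using assms(1)[OF Suc_lessD[OF that]] unfolding mod_less[OF that] .
  have last: "f (xs ! (length xs - 1)) = xs ! 0"
    using assms(1)[of "length xs - 1"] assms(2) by simp
  have *: "xs ! Suc k \<in> orbit f (xs ! 0)" if "Suc k < length xs" for k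
    using that
  proof (induct k)
    case 0
    then show ?case using step[of 0] by (metis orbit.base)
  next
    case (Suc k)
    then show ?case using step[of "Suc k"] by (metis Suc_lessD orbit.step)
  qed
  have "xs ! 0 \<in> orbit f (xs ! 0)"
  proof (cases "length xs - 1")
    case 0
    then show ?thesis using last by (metis orbit.base)
  next
    case (Suc k)
    then have "xs ! Suc k \<in> orbit f (xs ! 0)" using * by simp
    then show ?thesis using Suc last by (metis orbit.step)
  qed
  with * show "z \<in> orbit f (xs ! 0)" if "z \<in> set xs" for z
    using that by (metis in_set_conv_nth not0_implies_Suc)
qed

context tube
begin

text \<open>
  The face between the layers \<open>j\<close> and \<open>j + 1\<close> centred at the site \<open>c\<close>.  It is a pentagon if one of
  the sites \<open>(j, c)\<close> and \<open>(j + 1, c)\<close> is missing.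
\<close>

definition hex :: "int \<Rightarrow> int \<Rightarrow> bool" where
  "hex j c \<longleftrightarrow> 0 \<le> j \<and> j < n - 1 \<and> even (j + c)"

definition ringverts :: "int \<Rightarrow> int \<Rightarrow> nat list" where
  "ringverts j c = [P j (c + 1)] @ (if valid j c then [P j c] else []) @ [P j (c - 1)]
     @ [P (j + 1) (c - 1)] @ (if valid (j + 1) c then [P (j + 1) c] else []) @ [P (j + 1) (c + 1)]"

definition ring :: "int \<Rightarrow> int \<Rightarrow> (nat \<times> nat) list" where
  "ring j c = dL (P j (c + 1)) # (if valid j c then [dL (P j c)] else [])
     @ [dV (P j (c - 1)), dR (P (j + 1) (c - 1))]
     @ (if valid (j + 1) c then [dR (P (j + 1) c)] else [])
     @ [dV (P (j + 1) (c + 1))]"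

text \<open>Half of the bottom circle, closed by the chord; the missing sites \<open>e + 2\<close>
  and \<open>e + 4\<close> make it a pentagon. The list for the top runs to the left because there
  the face lies above the layer.\<close>

definition bottomcap :: "int \<Rightarrow> (nat \<times> nat) list" where
  "bottomcap e = map dR [P 0 e, P 0 (e + 1), P 0 (e + 3), P 0 (e + 5)]
     @ [dV (P 0 (e + 6))]"

definition topcap :: "int \<Rightarrow> (nat \<times> nat) list" where
  "topcap e = map dL [P (n - 1) e, P (n - 1) (e - 1), P (n - 1) (e - 3), P (n - 1) (e - 5)]
     @ [dV (P (n - 1) (e - 6))]"

lemma valid_0: "valid 0 i \<longleftrightarrow> odd i \<or> 6 dvd i"
  and valid_top: "valid (n - 1) i \<longleftrightarrow> odd (i + n) \<or> 6 dvd (i - n)"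
  and valid_mid: "0 < j \<Longrightarrow> j < n - 1 \<Longrightarrow> valid j i"
  using n3 by (auto simp: valid_def)

text \<open>The sites \<open>c + 1\<close> and \<open>c - 1\<close> have the parity that is complete
  even in the end layers. Two consecutive layers are not both end layers, so at most one of the two
  central sites is missing and the face has five or six sides.\<close>

lemma hex_valid:
  assumes "hex j c"
  shows "valid j (c + 1)" "valid j (c - 1)" "valid (j + 1) (c + 1)" "valid (j + 1) (c - 1)"
    "valid j c \<or> valid (j + 1) c"
proof -
  have j: "0 \<le> j" "j < n - 1" and e: "even (j + c)" using assms by (auto simp: hex_def)
  have o: "odd (c + 1)" "odd (c - 1)" if "j = 0" using e that by auto
  have o': "odd (c + 1 + n)" "odd (c - 1 + n)" if "j + 1 = n - 1"
  proof -
    have "n = j + 2" using that by simp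
    with e show "odd (c + 1 + n)" "odd (c - 1 + n)" by auto
  qed
  show "valid j (c + 1)" "valid j (c - 1)" "valid (j + 1) (c + 1)" "valid (j + 1) (c - 1)"
    unfolding valid_def using j o o' by simp_all
  show "valid j c \<or> valid (j + 1) c"
    unfolding valid_def using j n3 by (cases "j = 0") auto
qed

lemma ring_orbit:
  assumes "hex j c"
  shows "orbit fs (dL (P j (c + 1))) = set (ring j c)"
proof -
  note hv = hex_valid[OF assms]
  have j: "0 \<le> j" "j < n - 1" "even (j + c)" using assms by (auto simp: hex_def)
  have par: "odd (c + 1 + j)" "odd (c - 1 + j)" "even (c + j)" "even (c + 1 + (j + 1))"
    "even (c - 1 + (j + 1))" "odd (c + (j + 1))"
    using j(3) by presburger+
  let ?s0 = "dL (P j (c + 1))" and ?s1 = "dL (P j c)"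
    and ?s2 = "dV (P j (c - 1))" and ?s3 = "dR (P (j + 1) (c - 1))"
    and ?s4 = "dR (P (j + 1) c)" and ?s5 = "dV (P (j + 1) (c + 1))"
  have 0: "fs ?s0 = (if valid j c then ?s1 else ?s2)"
    using hv j par by (simp add: fs_dL P_VV nL_P up_P)
  have 1: "valid j c \<Longrightarrow> fs ?s1 = ?s2"
    using hv j par by (simp add: fs_dL P_VV nL_P up_P)
  have 2: "fs ?s2 = ?s3"
    using hv j par by (simp add: fs_dV P_VV nV_P up_P)
  have 3: "fs ?s3 = (if valid (j + 1) c then ?s4 else ?s5)"
    using hv j par by (simp add: fs_dR P_VV nR_P up_P add.commute[of 1])
  have 4: "valid (j + 1) c \<Longrightarrow> fs ?s4 = ?s5"
    using hv j par by (simp add: fs_dR P_VV nR_P up_P add.commute[of 1])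
  have 5: "fs ?s5 = ?s0"
    using hv j par by (simp add: fs_dV P_VV nV_P up_P)
  have "orbit fs (ring j c ! 0) = set (ring j c)"
  proof (rule orbit_list)
    fix k assume k: "k < length (ring j c)"
    show "fs (ring j c ! k) = ring j c ! (Suc k mod length (ring j c))"
    proof (cases "valid j c")
      case True
      note a = this 0 1 2 3 4 5
      show ?thesis
      proof (cases "valid (j + 1) c")
        case True
        then have "k \<in> {0, 1, 2, 3, 4, 5}" using k a(1) by (auto simp: ring_def)
        then show ?thesis using a True by (auto simp: ring_def)
      next
        case False
        then have "k \<in> {0, 1, 2, 3, 4}" using k a(1) by (auto simp: ring_def)
        then show ?thesis using a False by (auto simp: ring_def)
      qed
    next
      case False
      then have v: "valid (j + 1) c" using hv by blast
      then have "k \<in> {0, 1, 2, 3, 4}" using k False by (auto simp: ring_def)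
      then show ?thesis using v False 0 1 2 3 4 5 by (auto simp: ring_def)
    qed
  qed (simp add: ring_def)
  then show ?thesis by (simp add: ring_def)
qed

lemma bottom_orbit:
  assumes "6 dvd e"
  shows "orbit fs (dR (P 0 e)) = set (bottomcap e)"
proof -
  have v: "valid 0 e" "valid 0 (e + 1)" "\<not> valid 0 (e + 2)" "valid 0 (e + 3)" "\<not> valid 0 (e + 4)"
    "valid 0 (e + 5)" "valid 0 (e + 6)" "even e"
    using assms unfolding valid_0 by presburger+
  note simps = v fs_dR fs_dV P_VV nR_P nV_P up_P P_12 add.commute[of "numeral w" e for w] add.commute[of 1 e]
  have "fs (dR (P 0 e)) = dR (P 0 (e + 1))"
    "fs (dR (P 0 (e + 1))) = dR (P 0 (e + 3))"
    "fs (dR (P 0 (e + 3))) = dR (P 0 (e + 5))"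
    "fs (dR (P 0 (e + 5))) = dV (P 0 (e + 6))"
    "fs (dV (P 0 (e + 6))) = dR (P 0 e)"
    by (simp_all add: simps)
  note steps = this
  have "orbit fs (bottomcap e ! 0) = set (bottomcap e)"
  proof (rule orbit_list)
    fix k assume "k < length (bottomcap e)"
    then have "k \<in> {0, 1, 2, 3, 4}" by (auto simp: bottomcap_def)
    then show "fs (bottomcap e ! k) = bottomcap e ! (Suc k mod length (bottomcap e))"
      using steps by (auto simp: bottomcap_def)
  qed (simp add: bottomcap_def)
  then show ?thesis by (simp add: bottomcap_def)
qed

lemma top_orbit:
  assumes "6 dvd (e - n)"
  shows "orbit fs (dL (P (n - 1) e)) = set (topcap e)"
proof -
  have v: "valid (n - 1) e" "valid (n - 1) (e - 1)" "\<not> valid (n - 1) (e - 2)" "valid (n - 1) (e - 3)"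
    "\<not> valid (n - 1) (e - 4)" "valid (n - 1) (e - 5)" "valid (n - 1) (e - 6)" "even (e + n)"
    using assms unfolding valid_top by presburger+
  have j: "0 \<le> n - 1" using n3 by simp
  have par: "odd (e + (n - 1))" "even (e - 1 + (n - 1))" "even (e - 3 + (n - 1))"
    "even (e - 5 + (n - 1))" "odd (e - 6 + (n - 1))" using v(8) by presburger+
  note simps = v fs_dL fs_dV P_VV nL_P nV_P up_P P_12
  have "fs (dL (P (n - 1) e)) = dL (P (n - 1) (e - 1))"
    "fs (dL (P (n - 1) (e - 1))) = dL (P (n - 1) (e - 3))"
    "fs (dL (P (n - 1) (e - 3))) = dL (P (n - 1) (e - 5))"
    "fs (dL (P (n - 1) (e - 5))) = dV (P (n - 1) (e - 6))"
    "fs (dV (P (n - 1) (e - 6))) = dL (P (n - 1) e)"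
    using j n3 par v(8) by (simp_all add: simps)
  note steps = this
  have "orbit fs (topcap e ! 0) = set (topcap e)"
  proof (rule orbit_list)
    fix k assume "k < length (topcap e)"
    then have "k \<in> {0, 1, 2, 3, 4}" by (auto simp: topcap_def)
    then show "fs (topcap e ! k) = topcap e ! (Suc k mod length (topcap e))"
      using steps by (auto simp: topcap_def)
  qed (simp add: topcap_def)
  then show ?thesis by (simp add: topcap_def)
qed

definition flists :: "(nat \<times> nat) list set" where
  "flists = {ring j c |j c. hex j c} \<union> {bottomcap e |e. 6 dvd e} \<union> {topcap e |e. 6 dvd (e - n)}"

lemma flist_orbit:
  assumes "xs \<in> flists" shows "\<exists>d\<in>parcs G. orbit fs d = set xs"
proof -
  have "\<exists>d\<in>parcs G. orbit fs d = set (ring j c)" if "hex j c" for j c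
  proof
    show "dL (P j (c + 1)) \<in> parcs G"
      using hex_valid[OF that] that by (simp add: darts_in P_VV hex_def)
  qed (rule ring_orbit[OF that])
  moreover have "\<exists>d\<in>parcs G. orbit fs d = set (bottomcap e)" if "6 dvd e" for e
  proof
    show "dR (P 0 e) \<in> parcs G"
      using that by (simp add: darts_in P_VV valid_0)
  qed (rule bottom_orbit[OF that])
  moreover have "\<exists>d\<in>parcs G. orbit fs d = set (topcap e)" if "6 dvd (e - n)" for e
  proof
    show "dL (P (n - 1) e) \<in> parcs G"
      using that n3 by (simp add: darts_in P_VV valid_top)
  qed (rule top_orbit[OF that])
  ultimately show ?thesis using assms unfolding flists_def by blast
qed

lemma cap_flist: "hex j c \<Longrightarrow> ring j c \<in> flists" "6 dvd e \<Longrightarrow> bottomcap e \<in> flists"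
    "6 dvd e - n \<Longrightarrow> topcap e \<in> flists"
  by (auto simp: flists_def)

text \<open>An arc to the right bounds the face below it and an arc to the left the face above it. A
  vertical arc at site \<open>i\<close> bounds the face centred at \<open>i + 1\<close> if it goes
  up and at \<open>i - 1\<close> if it goes down. Beyond an end layer, and along the chords, a cap
  takes the place of this face.\<close>

lemma arc_flist:
  assumes "d \<in> parcs G" shows "\<exists>xs\<in>flists. d \<in> set xs"
  using assms
proof (cases rule: arcs_cases)
  case (1 v)
  then obtain j i where v: "v = P j i" "valid j i" "0 \<le> j" "j < n" by (auto elim: VV_cases)
  show ?thesis
  proof (cases "j = 0")
    case True
    then have "odd i \<or> 6 dvd i" using v(2) by (simp add: valid_0)
    \<comment> \<open>The offsets 0, 1, 3, 5 are those of the four rightward arcs of a bottom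
      cap.\<close>
    then have "6 dvd i \<or> 6 dvd i - 1 \<or> 6 dvd i - 3 \<or> 6 dvd i - 5" by presburger
    then consider "6 dvd i" | "6 dvd i - 1" | "6 dvd i - 3" | "6 dvd i - 5" by blast
    then have "\<exists>e. 6 dvd e \<and> d \<in> set (bottomcap e)"
      by cases (use 1 True v(1) in \<open>force simp: bottomcap_def\<close>)+
    then show ?thesis using cap_flist by blast
  next
    case False
    show ?thesis
    proof (cases "odd (i + j)")
      case True
      then have "hex (j - 1) i" using False v by (auto simp: hex_def)
      moreover have "d \<in> set (ring (j - 1) i)" using 1 v by (simp add: ring_def)
      ultimately show ?thesis using cap_flist by blast
    next
      case even: False
      then have "hex (j - 1) (i + 1)" using False v by (auto simp: hex_def)
      moreover have "d \<in> set (ring (j - 1) (i + 1))" using 1 v by (simp add: ring_def)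
      ultimately show ?thesis using cap_flist by blast
    qed
  qed
next
  case (2 v)
  then obtain j i where v: "v = P j i" "valid j i" "0 \<le> j" "j < n" by (auto elim: VV_cases)
  show ?thesis
  proof (cases "j = n - 1")
    case True
    then have "odd (i + n) \<or> 6 dvd (i - n)" using v(2) by (simp add: valid_top)
    then have "6 dvd i - n \<or> 6 dvd i + 1 - n \<or> 6 dvd i + 3 - n \<or> 6 dvd i + 5 - n" by presburger
    then consider "6 dvd i - n" | "6 dvd i + 1 - n" | "6 dvd i + 3 - n" | "6 dvd i + 5 - n" by blast
    then have "\<exists>e. 6 dvd (e - n) \<and> d \<in> set (topcap e)"
    proof cases
      case 1 then show ?thesis using 2 True v(1) by (intro exI[of _ i]) (simp add: topcap_def)
    next
      case 2 then show ?thesis using \<open>d = _\<close> True v(1) by (intro exI[of _ "i + 1"]) (simp add: topcap_def)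
    next
      case 3 then show ?thesis using \<open>d = _\<close> True v(1) by (intro exI[of _ "i + 3"]) (simp add: topcap_def)
    next
      case 4 then show ?thesis using \<open>d = _\<close> True v(1) by (intro exI[of _ "i + 5"]) (simp add: topcap_def)
    qed
    then show ?thesis using cap_flist by blast
  next
    case False
    show ?thesis
    proof (cases "odd (i + j)")
      case True
      then have "hex j (i - 1)" using False v by (auto simp: hex_def)
      moreover have "d \<in> set (ring j (i - 1))" using 2 v by (simp add: ring_def)
      ultimately show ?thesis using cap_flist by blast
    next
      case even: False
      then have "hex j i" using False v by (auto simp: hex_def)
      moreover have "d \<in> set (ring j i)" using 2 v by (simp add: ring_def)
      ultimately show ?thesis using cap_flist by blast
    qed
  qed
next
  case (3 v)
  then obtain j i where v: "v = P j i" "valid j i" "0 \<le> j" "j < n" by (auto elim: VV_cases)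
  show ?thesis
  proof (cases "odd (i + j)")
    case True
    show ?thesis
    proof (cases "j = n - 1")
      case top: True
      then have "6 dvd i - n" using v(2) True by (auto simp: valid_top)
      then have "6 dvd i + 6 - n" by presburger
      moreover have "d \<in> set (topcap (i + 6))" using 3 v top by (simp add: topcap_def)
      ultimately show ?thesis using cap_flist by blast
    next
      case False
      then have "hex j (i + 1)" using True v by (auto simp: hex_def)
      moreover have "d \<in> set (ring j (i + 1))" using 3 v by (simp add: ring_def)
      ultimately show ?thesis using cap_flist by blast
    qed
  next
    case even: False
    show ?thesis
    proof (cases "j = 0")
      case True
      then have "6 dvd i" using v(2) even by (auto simp: valid_0)
      then have "6 dvd i - 6" by presburger
      moreover have "d \<in> set (bottomcap (i - 6))" using 3 v True by (simp add: bottomcap_def)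
      ultimately show ?thesis using cap_flist by blast
    next
      case False
      then have "hex (j - 1) (i - 1)" using even v by (auto simp: hex_def)
      moreover have "d \<in> set (ring (j - 1) (i - 1))" using 3 v by (simp add: ring_def)
      ultimately show ?thesis using cap_flist by blast
    qed
  qed
qed

lemma arc_orbit_flist:
  assumes "d \<in> parcs G" shows "\<exists>xs\<in>flists. orbit fs d = set xs"
proof -
  obtain xs where "xs \<in> flists" "d \<in> set xs" using arc_flist[OF assms] by blast
  moreover obtain e where "e \<in> parcs G" "orbit fs e = set xs" using flist_orbit[OF \<open>xs \<in> flists\<close>] by blast
  ultimately show ?thesis using face_eq by metis
qed

lemma faces_flists: "faces G rot = set ` flists"
proof
  show "faces G rot \<subseteq> set ` flists" unfolding faces_def using arc_orbit_flist by fastforce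
  show "set ` flists \<subseteq> faces G rot" unfolding faces_def using flist_orbit by fastforce
qed

lemma ring_fst: "map fst (ring j c) = ringverts j c"
  by (simp add: ring_def ringverts_def)

lemma distinct_ringverts: "0 \<le> j \<Longrightarrow> distinct (ringverts j c)"
  by (auto simp: ringverts_def P_eq_iff)

lemma distinct_flist: "xs \<in> flists \<Longrightarrow> distinct (map fst xs)"
  using n3 by (auto simp: flists_def ring_fst hex_def distinct_ringverts bottomcap_def topcap_def P_eq_iff)

lemma length_flist: "xs \<in> flists \<Longrightarrow> length xs \<in> {5, 6}"
proof -
  have "length (ring j c) \<in> {5, 6}" if "hex j c" for j c
    using hex_valid(5)[OF that] by (auto simp: ring_def)
  then show "xs \<in> flists \<Longrightarrow> length xs \<in> {5, 6}"
    by (auto simp: flists_def bottomcap_def topcap_def)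
qed

lemma card_face:
  assumes "F \<in> faces G rot" shows "card F \<in> {5, 6}"
proof -
  obtain xs where xs: "xs \<in> flists" "F = set xs" using assms faces_flists by blast
  then have "card F = length xs" using distinct_flist by (simp add: distinct_card distinct_map)
  then show ?thesis using length_flist xs(1) by simp
qed

lemma fverts_flist:
  assumes "d \<in> parcs G"
  obtains xs where "xs \<in> flists" "orbit fs d = set xs" "fverts d = fst ` set xs"
    "card (fverts d) = length xs"
proof -
  obtain xs where xs: "xs \<in> flists" "orbit fs d = set xs" using arc_orbit_flist[OF assms] by blast
  then have "fverts d = set (map fst xs)" by (simp add: fverts_def)
  moreover have "card (set (map fst xs)) = length xs"
    using distinct_flist[OF xs(1)] by (metis distinct_card length_map)
  ultimately show ?thesis using xs by (intro that) auto
qed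

text \<open>At a vertex of a ring, and at an inner vertex of a half circle, one of the three edges
  leads off the face. At an end of a chord this is the horizontal edge into the other half
  circle.\<close>

lemma no_claw_flist:
  assumes xs: "xs \<in> flists" and w: "w \<in> fst ` set xs"
  shows "\<not> N w \<subseteq> fst ` set xs"
proof -
  consider j c where "hex j c" "xs = ring j c" | e where "6 dvd e" "xs = bottomcap e"
    | e where "6 dvd e - n" "xs = topcap e"
    using xs by (auto simp: flists_def)
  then show ?thesis
  proof cases
    case 1
    have j: "0 \<le> j" "j < n - 1" "even (j + c)" using 1(1) by (auto simp: hex_def)
    have v: "fst ` set xs = set (ringverts j c)" using ring_fst[of j c] by (metis 1(2) list.set_map)
    have "nR w \<notin> set (ringverts j c) \<or> nL w \<notin> set (ringverts j c) \<or> nV w \<notin> set (ringverts j c)"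
    proof -
      consider "w = P j (c + 1)" | "w = P j c" | "w = P j (c - 1)"
        | "w = P (j + 1) (c + 1)" | "w = P (j + 1) c" | "w = P (j + 1) (c - 1)"
        using w unfolding v by (auto simp: ringverts_def split: if_splits)
      then show ?thesis
        by cases (use j in \<open>auto simp: ringverts_def nR_P nL_P nV_P P_eq_iff\<close>)
    qed
    then show ?thesis by (auto simp: v N_eq)
  next
    case 2
    have v: "fst ` set xs = {P 0 e, P 0 (e + 1), P 0 (e + 3), P 0 (e + 5), P 0 (e + 6)}"
      by (simp add: 2(2) bottomcap_def)
    have e: "even e" "valid 0 (e - 1)" "valid 0 (7 + e)"
      using 2(1) by (auto simp: valid_0)
    from w consider "w = P 0 e" | "w = P 0 (e + 1)" | "w = P 0 (e + 3)" | "w = P 0 (e + 5)" | "w = P 0 (e + 6)"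
      unfolding v by blast
    then have "nR w \<notin> fst ` set xs \<or> nL w \<notin> fst ` set xs \<or> nV w \<notin> fst ` set xs"
    proof cases
      case 1
      then have "nL w = P 0 (e - 1)" using e by (simp add: nL_P)
      then show ?thesis unfolding v by (simp add: P_eq_iff)
    next
      case 5
      then have "nR w = P 0 (7 + e)" using e by (simp add: nR_P)
      then show ?thesis unfolding v by (simp add: P_eq_iff)
    qed (use e n3 in \<open>simp_all add: v nV_P P_eq_iff\<close>)
    then show ?thesis by (auto simp: N_eq)
  next
    case 3
    have v: "fst ` set xs = {P (n - 1) e, P (n - 1) (e - 1), P (n - 1) (e - 3), P (n - 1) (e - 5), P (n - 1) (e - 6)}"
      by (simp add: 3(2) topcap_def)
    have e: "even e = even n" "valid (n - 1) (e + 1)" "valid (n - 1) (e - 7)"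
      using 3(1) unfolding valid_top by presburger+
    from w consider "w = P (n - 1) e" | "w = P (n - 1) (e - 1)" | "w = P (n - 1) (e - 3)"
      | "w = P (n - 1) (e - 5)" | "w = P (n - 1) (e - 6)"
      unfolding v by blast
    then have "nR w \<notin> fst ` set xs \<or> nL w \<notin> fst ` set xs \<or> nV w \<notin> fst ` set xs"
    proof cases
      case 1
      then have "nR w = P (n - 1) (e + 1)" using e n3 by (simp add: nR_P)
      then show ?thesis unfolding v using n3 by (simp add: P_eq_iff)
    next
      case 5
      then have "nL w = P (n - 1) (e - 7)" using e n3 by (simp add: nL_P)
      then show ?thesis unfolding v using n3 by (simp add: P_eq_iff)
    qed (use e n3 in \<open>simp_all add: v nV_P P_eq_iff\<close>)
    then show ?thesis by (auto simp: N_eq)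
  qed
qed

lemma no_claw: "d \<in> parcs G \<Longrightarrow> w \<in> fverts d \<Longrightarrow> \<not> N w \<subseteq> fverts d"
  using no_claw_flist by (metis fverts_flist)

lemma card_fverts_cases: "d \<in> parcs G \<Longrightarrow> card (fverts d) \<in> {5, 6}"
  using length_flist by (metis fverts_flist)

section \<open>Counting vertices and faces\<close>

lemma P_inj: "0 \<le> j \<Longrightarrow> 0 \<le> j' \<Longrightarrow> i \<in> {0..<12} \<Longrightarrow> i' \<in> {0..<12} \<Longrightarrow>
    P j i = P j' i' \<longleftrightarrow> j = j' \<and> i = i'"
  by (auto simp: P_eq_iff mod_eq_dvd_iff[symmetric])

definition "slots = {0..<12::int}"

lemma slots_eq: "slots = {0, 1, 2, 3, 4, 5, 6, 7, 8, 9, 10, 11}"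
  unfolding slots_def by (simp add: set_eq_iff; presburger)

lemma finite_slots: "finite slots" and card_slots: "card slots = 12"
  by (simp_all add: slots_eq)

lemma even_mod_12: "even (c mod 12) = even (c::int)"
  by presburger

text \<open>Twelve vertices in each layer, with four missing in each of the two end layers.\<close>

lemma card_VV: "int (card VV) = 12 * n - 8"
proof -
  define I where "I = (SIGMA j:{0..<n}. {i \<in> slots. valid j i})"
  have "VV = (\<lambda>(j, i). P j i) ` I"
  proof
    show "VV \<subseteq> (\<lambda>(j, i). P j i) ` I"
    proof
      fix v assume "v \<in> VV"
      then obtain j i where "v = P j i" "valid j i" "0 \<le> j" "j < n" by (auto elim: VV_cases)
      then have "v = (\<lambda>(j, i). P j i) (j, i mod 12)" "(j, i mod 12) \<in> I"
        by (auto simp: I_def slots_def)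
      then show "v \<in> (\<lambda>(j, i). P j i) ` I" by blast
    qed
  qed (auto simp: I_def VV_def)
  moreover have "inj_on (\<lambda>(j, i). P j i) I"
    by (auto simp: inj_on_def I_def slots_def P_inj)
  ultimately have "card VV = card I" by (simp add: card_image)
  also have "\<dots> = (\<Sum>j\<in>{0..<n}. card {i \<in> slots. valid j i})"
    unfolding I_def by (rule card_SigmaI) (simp_all add: finite_slots)
  also have "{0..<n} = {0, n - 1} \<union> {1..<n - 1}" using n3 by auto
  also have "(\<Sum>j\<in>{0, n - 1} \<union> {1..<n - 1}. card {i \<in> slots. valid j i})
    = (\<Sum>j\<in>{0, n - 1}. card {i \<in> slots. valid j i}) + (\<Sum>j\<in>{1..<n - 1}. card {i \<in> slots. valid j i})"
    by (rule sum.union_disjoint) auto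
  also have "(\<Sum>j\<in>{1..<n - 1}. card {i \<in> slots. valid j i}) = (\<Sum>j\<in>{1..<n - 1}. 12)"
    by (rule sum.cong) (simp_all add: valid_mid card_slots)
  also have "(\<Sum>j\<in>{0, n - 1}. card {i \<in> slots. valid j i}) = 8 + 8"
  proof -
    have "{i \<in> slots. valid 0 i} = {0, 1, 3, 5, 6, 7, 9, 11}"
      by (auto simp: slots_eq valid_0)
    moreover have "card {i \<in> slots. valid (n - 1) i} = 8"
    proof -
      have "n mod 6 = 0 \<or> n mod 6 = 3" using dvd_n by presburger
      then show ?thesis
      proof
        assume "n mod 6 = 0"
        then have "valid (n - 1) i \<longleftrightarrow> odd i \<or> 6 dvd i" for i unfolding valid_top by presburger
        then have "{i \<in> slots. valid (n - 1) i} = {i \<in> slots. odd i \<or> 6 dvd i}"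
          by simp
        also have "\<dots> = {0, 1, 3, 5, 6, 7, 9, 11}" by (auto simp: slots_eq)
        finally show ?thesis by simp
      next
        assume "n mod 6 = 3"
        then have "valid (n - 1) i \<longleftrightarrow> even i \<or> 6 dvd (i - 3)" for i unfolding valid_top by presburger
        then have "{i \<in> slots. valid (n - 1) i} = {i \<in> slots. even i \<or> 6 dvd (i - 3)}"
          by simp
        also have "\<dots> = {0, 2, 3, 4, 6, 8, 9, 10}" by (auto simp: slots_eq)
        finally show ?thesis by simp
      qed
    qed
    ultimately show ?thesis using n3 by simp
  qed
  finally show ?thesis using n3 by simp
qed

lemma bottomcap_cases: "6 dvd e \<Longrightarrow> bottomcap e = bottomcap 0 \<or> bottomcap e = bottomcap 6"
proof -
  assume "6 dvd e"
  then have "12 dvd e \<or> 12 dvd e - 6" by presburger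
  then show ?thesis
  proof
    assume "12 dvd e"
    then have "P 0 (e + k) = P 0 k" for k by (simp add: P_eq_iff)
    from this[of 0] this show ?thesis by (simp add: bottomcap_def)
  next
    assume "12 dvd e - 6"
    then have "P 0 (e + k) = P 0 (6 + k)" for k by (simp add: P_eq_iff)
    from this[of 0] this show ?thesis by (simp add: bottomcap_def)
  qed
qed

lemma topcap_cases: "6 dvd e - n \<Longrightarrow> topcap e = topcap n \<or> topcap e = topcap (n + 6)"
proof -
  assume "6 dvd e - n"
  then have "12 dvd e - n \<or> 12 dvd e - (n + 6)" by presburger
  then show ?thesis
  proof
    assume "12 dvd e - n"
    then have "P (n - 1) (e - k) = P (n - 1) (n - k)" for k using n3 by (simp add: P_eq_iff)
    from this[of 0] this show ?thesis by (simp add: topcap_def)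
  next
    assume "12 dvd e - (n + 6)"
    then have "P (n - 1) (e - k) = P (n - 1) (n + 6 - k)" for k
      using n3 by (simp add: P_eq_iff algebra_simps)
    from this[of 0] this show ?thesis by (simp add: topcap_def)
  qed
qed

lemma ring_cong: "i mod 12 = i' mod 12 \<Longrightarrow> ring j i = ring j i'"
proof -
  assume a: "i mod 12 = i' mod 12"
  have "valid k i = valid k i'" "P k (i + 1) = P k (i' + 1)" "P k (i - 1) = P k (i' - 1)"
    "P k i = P k i'" for k
    using a by (auto intro!: valid_cong P_cong mod_add_cong mod_diff_cong)
  then show ?thesis by (simp add: ring_def)
qed

lemma dart_neq: "v \<in> VV \<Longrightarrow> dL v \<noteq> dR w" "v \<in> VV \<Longrightarrow> dL v \<noteq> dV w"
    and dL_eq: "dL v = dL w \<longleftrightarrow> v = w"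
  using distinct_nbrs[of v] by (auto simp: dL_def dR_def dV_def)

text \<open>Six faces in each of the \<open>n - 1\<close> gaps between layers and four caps; the
  work lies in showing these to be distinct.\<close>

lemma card_faces: "int (card (faces G rot)) = 6 * n - 2"
proof -
  define I where "I = (SIGMA j:{0..<n - 1}. {c \<in> slots. even (j + c)})"
  define R where "R = (\<lambda>(j, c). set (ring j c)) ` I"
  define C where "C = {set (bottomcap 0), set (bottomcap 6), set (topcap n), set (topcap (n + 6))}"
  have "faces G rot = R \<union> C"
  proof -
    have "{ring j c |j c. hex j c} = (\<lambda>(j, c). ring j c) ` I"
    proof
      show "{ring j c |j c. hex j c} \<subseteq> (\<lambda>(j, c). ring j c) ` I"
      proof safe
        fix j c assume "hex j c"
        then have "(j, c mod 12) \<in> I" by (simp add: hex_def I_def slots_def even_mod_12)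
        moreover have "ring j c = ring j (c mod 12)" by (rule ring_cong) simp
        ultimately show "ring j c \<in> (\<lambda>(j, c). ring j c) ` I" by (metis (no_types, lifting) image_eqI case_prod_conv)
      qed
      show "(\<lambda>(j, c). ring j c) ` I \<subseteq> {ring j c |j c. hex j c}"
      proof
        fix x assume "x \<in> (\<lambda>(j, c). ring j c) ` I"
        then obtain j c where "(j, c) \<in> I" "x = ring j c" by auto
        moreover from this have "hex j c" by (simp add: I_def hex_def)
        ultimately show "x \<in> {ring j c |j c. hex j c}" by blast
      qed
    qed
    moreover have "{bottomcap e |e. 6 dvd e} = {bottomcap 0, bottomcap 6}"
    proof (intro equalityI subsetI)
      fix x assume "x \<in> {bottomcap 0, bottomcap 6}"
      moreover have "6 dvd (0::int)" "6 dvd (6::int)" by auto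
      ultimately show "x \<in> {bottomcap e |e. 6 dvd e}" by blast
    qed (use bottomcap_cases in blast)
    moreover have "{topcap e |e. 6 dvd e - n} = {topcap n, topcap (n + 6)}"
    proof (intro equalityI subsetI)
      fix x assume "x \<in> {topcap n, topcap (n + 6)}"
      moreover have "6 dvd n - n" "6 dvd n + 6 - n" by auto
      ultimately show "x \<in> {topcap e |e. 6 dvd e - n}" by blast
    qed (use topcap_cases in blast)
    ultimately show ?thesis
      unfolding faces_flists flists_def R_def C_def by (auto simp: image_Un image_image case_prod_unfold)
  qed
  moreover have "card R = card I"
  proof -
    have "(j, c) = (j', c')"
      if "(j, c) \<in> I" "(j', c') \<in> I" and eq: "set (ring j c) = set (ring j' c')" for j c j' c'
    proof -
      have I: "0 \<le> j" "0 \<le> j'" "even (j + c)" "even (j' + c')" "c \<in> slots" "c' \<in> slots"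
        using that by (auto simp: I_def)
      \<comment> \<open>A leftward arc in a ring starts at the centre or one site to the right of
        it. Parity excludes the centre, so this arc determines the ring.\<close>
      have dL: "dL (P j (c + 1)) \<in> set (ring j' c')" using eq by (auto simp: ring_def)
      have "j = j' \<and> 12 dvd (c - c')"
      proof -
        have "P j (c + 1) \<in> VV" using hex_valid(1)[of j c] that(1) I(1) by (simp add: P_VV I_def hex_def)
        with dL have "P j (c + 1) = P j' (c' + 1) \<or> P j (c + 1) = P j' c'"
          by (auto simp: ring_def dart_neq dL_eq split: if_splits)
        then have "j = j' \<and> (12 dvd (c - c') \<or> 12 dvd (c + 1 - c'))"
          using I(1,2) by (auto simp: P_eq_iff)
        then show ?thesis using I(3,4) by presburger
      qed
      then show ?thesis using I by (auto simp: slots_eq)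
    qed
    then have "inj_on (\<lambda>(j, c). set (ring j c)) I" by (auto simp: inj_on_def)
    then show ?thesis by (simp add: R_def card_image)
  qed
  moreover have "int (card I) = 6 * (n - 1)"
  proof -
    have "card I = (\<Sum>j\<in>{0..<n - 1}. card {c \<in> slots. even (j + c)})"
      unfolding I_def by (rule card_SigmaI) (simp_all add: finite_slots)
    also have "\<dots> = (\<Sum>j\<in>{0..<n - 1}. 6)"
    proof (rule sum.cong)
      fix j :: int
      have "{c \<in> slots. even (j + c)} = (if even j then {0, 2, 4, 6, 8, 10} else {1, 3, 5, 7, 9, 11})"
        by (auto simp: slots_eq)
      then show "card {c \<in> slots. even (j + c)} = 6" by simp
    qed simp
    finally show ?thesis using n3 by simp
  qed
  moreover have "card C = 4"
  proof -
    have "dR (P 0 0) \<in> set (bottomcap 0)" "dR (P 0 0) \<notin> set (bottomcap 6)"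
      "dR (P 0 0) \<notin> set (topcap n)" "dR (P 0 0) \<notin> set (topcap (n + 6))"
      "dR (P 0 6) \<in> set (bottomcap 6)"
      "dR (P 0 6) \<notin> set (topcap n)" "dR (P 0 6) \<notin> set (topcap (n + 6))"
      "dL (P (n - 1) n) \<in> set (topcap n)" "dL (P (n - 1) n) \<notin> set (topcap (n + 6))"
      using n3 by (auto simp: bottomcap_def topcap_def dR_def dL_def dV_def P_eq_iff nR_P nL_P nV_P valid_0 valid_top)
    then have "distinct [set (bottomcap 0), set (bottomcap 6), set (topcap n), set (topcap (n + 6))]"
      by (metis distinct_length_2_or_more distinct_singleton)
    then show ?thesis unfolding C_def by simp
  qed
  moreover have "R \<inter> C = {}"
  proof -
    have "False" if "(j, c) \<in> I" "set (ring j c) \<in> C" for j c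
    proof -
      have j: "0 \<le> j" "j < n - 1" using that by (auto simp: I_def)
      have "dL (P j (c + 1)) \<in> set (ring j c)" "dV (P (j + 1) (c + 1)) \<in> set (ring j c)"
        by (auto simp: ring_def)
      moreover have "lay (fst d) = lay (fst d')" if "X \<in> C" "d \<in> X" "d' \<in> X" for d d' X
        using that n3 by (auto simp: C_def bottomcap_def topcap_def)
      \<comment> \<open>A cap stays in one layer, whereas a ring meets two.\<close>
      ultimately have "lay (P j (c + 1)) = lay (P (j + 1) (c + 1))"
        using that(2) by (metis fst_dart(2,3))
      then show False using j by simp
    qed
    then show ?thesis by (auto simp: R_def)
  qed
  moreover have "finite R" "finite C" by (simp_all add: R_def C_def I_def finite_slots)
  ultimately show ?thesis by (simp add: card_Un_disjoint)
qed

lemma euler: "card VV + card (faces G rot) = card (edges G) + 2"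
  using card_VV card_faces card_edges by linarith

end

section \<open>Three-connectedness\<close>

text \<open>Pigeonhole: at most two removed vertices cannot hit three disjoint edges, so one of the
  edges survives.\<close>

lemma card_less_3_pairs:
  assumes "card S < 3" "finite S"
    and "{a1, b1} \<inter> {a2, b2} = {}" "{a1, b1} \<inter> {a3, b3} = {}" "{a2, b2} \<inter> {a3, b3} = {}"
  shows "a1 \<notin> S \<and> b1 \<notin> S \<or> a2 \<notin> S \<and> b2 \<notin> S \<or> a3 \<notin> S \<and> b3 \<notin> S"
proof (rule ccontr)
  assume "\<not> ?thesis"
  then obtain x y z where *: "x \<in> S" "x \<in> {a1, b1}" "y \<in> S" "y \<in> {a2, b2}" "z \<in> S" "z \<in> {a3, b3}"
    by blast
  then have "x \<noteq> y" "x \<noteq> z" "y \<noteq> z" using assms(3-5) by blast+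
  then have "card {x, y, z} = 3" by simp
  moreover have "card {x, y, z} \<le> card S" using * assms(2) by (intro card_mono) auto
  ultimately show False using assms(1) by simp
qed

context tube
begin

context
  fixes S :: "nat set"
  assumes S: "S \<subseteq> VV" "card S < 3"
begin

definition "W = VV - S"
definition "R = (parcs G \<inter> W \<times> W)\<^sup>*"

lemma fin_S: "finite S" using S finite_VV finite_subset by blast

lemma R_sym: "(u, v) \<in> R \<Longrightarrow> (v, u) \<in> R"
proof -
  have "sym (parcs G \<inter> W \<times> W)" by (auto simp: sym_def intro: arc_sym)
  then have "sym R" unfolding R_def by (rule sym_rtrancl)
  then show "(u, v) \<in> R \<Longrightarrow> (v, u) \<in> R" by (rule symD)
qed

lemma R_trans: "(u, v) \<in> R \<Longrightarrow> (v, w) \<in> R \<Longrightarrow> (u, w) \<in> R"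
  unfolding R_def by (rule rtrancl_trans)

lemma R_refl: "(u, u) \<in> R"
  unfolding R_def by simp

lemma R_arc: "u \<in> W \<Longrightarrow> v \<in> W \<Longrightarrow> v = nR u \<or> v = nL u \<or> v = nV u \<Longrightarrow> (u, v) \<in> R"
  unfolding R_def by (auto simp: arc_iff N_eq W_def)

definition layer :: "int \<Rightarrow> nat set" where "layer j = {v \<in> VV. lay v = j}"

lemma layer_cases:
  assumes "v \<in> layer j" obtains i where "v = P j i" "valid j i"
  using assms by (auto simp: layer_def elim: VV_cases)

text \<open>Walks once round the circle to the right, starting behind the only vertex that may be
  missing. The left neighbour lies one or two sites back, hence complete induction on the distance
  \<open>t\<close>.\<close>

lemma layer_connected_aux:
  assumes p: "valid j a" "S \<inter> layer j \<subseteq> {P j a}" and j: "0 \<le> j"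
  shows "1 \<le> t \<Longrightarrow> t \<le> 11 \<Longrightarrow> valid j (a + int t) \<Longrightarrow> (nR (P j a), P j (a + int t)) \<in> R"
proof (induction t rule: less_induct)
  case (less t)
  have W: "P j (a + int k) \<in> W" if "valid j (a + int k)" "1 \<le> k" "k \<le> 11" for k
  proof -
    have "P j (a + int k) \<noteq> P j a"
    proof
      assume "P j (a + int k) = P j a"
      then have "12 dvd int k" using j by (simp add: P_eq_iff)
      then show False using that by presburger
    qed
    moreover have "P j (a + int k) \<in> layer j" "P j (a + int k) \<in> VV"
      using that(1) j by (simp_all add: layer_def P_VV)
    ultimately show ?thesis using p(2) by (auto simp: W_def)
  qed
  show ?case
  proof (cases "P j (a + int t) = nR (P j a)")
    case True
    then show ?thesis by (simp add: R_refl)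
  next
    case False
    define t' where "t' = (if valid j (a + int t - 1) then t - 1 else t - 2)"
    have Pa: "P j a \<in> VV" using p j by (simp add: P_VV)
    have tV: "P j (a + int t) \<in> VV" using less j by (simp add: P_VV)
    have t2: "2 \<le> t \<and> (valid j (a + int t - 1) \<or> 3 \<le> t)"
    proof (rule ccontr)
      assume "\<not> ?thesis"
      then have "t = 1 \<or> t = 2 \<and> \<not> valid j (a + int t - 1)" using less.prems(1) by linarith
      then have "nL (P j (a + int t)) = P j a"
        using p(1) j by (auto simp: nL_P)
      then have "P j (a + int t) = nR (P j a)" using nR_nL[OF tV] by simp
      with False show False by simp
    qed
    have nLt: "nL (P j (a + int t)) = P j (a + int t')"
      using t2 j by (auto simp: nL_P t'_def of_nat_diff add_diff_eq)
    have "nL (P j (a + int t)) \<in> VV" using nL_VV[OF tV] .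
    then have vt': "valid j (a + int t')" using j by (simp add: nLt P_VV)
    have t': "1 \<le> t'" "t' < t" using t2 by (auto simp: t'_def)
    have "(nR (P j a), P j (a + int t')) \<in> R"
      using less.IH[OF t'(2)] t' less.prems vt' by simp
    moreover have "(P j (a + int t'), P j (a + int t)) \<in> R"
    proof (rule R_arc)
      show "P j (a + int t') \<in> W" "P j (a + int t) \<in> W"
        using W vt' t' less.prems by auto
      show "P j (a + int t) = nR (P j (a + int t')) \<or> P j (a + int t) = nL (P j (a + int t'))
         \<or> P j (a + int t) = nV (P j (a + int t'))"
        using nR_nL[OF tV] nLt by simp
    qed
    ultimately show ?thesis by (rule R_trans)
  qed
qed

lemma layer_connected:
  assumes c: "card (S \<inter> layer j) \<le> 1" and u: "u \<in> layer j \<inter> W" and v: "v \<in> layer j \<inter> W"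
  shows "(u, v) \<in> R"
proof -
  have j: "0 \<le> j" "j < n" using u by (auto simp: layer_def elim: VV_cases)
  \<comment> \<open>The site \<open>j\<close> is present in every layer \<open>j\<close>, including
    the end layers; it serves as the starting point if no vertex of the layer is removed.\<close>
  have vj: "valid j j" using j by (auto simp: valid_def)
  have "\<exists>p\<in>layer j. S \<inter> layer j \<subseteq> {p}"
  proof (cases "S \<inter> layer j = {}")
    case True
    then show ?thesis using vj j by (intro bexI[of _ "P j j"]) (auto simp: layer_def P_VV)
  next
    case False
    have "card (S \<inter> layer j) \<noteq> 0" using False fin_S by simp
    then have "card (S \<inter> layer j) = 1" using c by simp
    then obtain p where "S \<inter> layer j = {p}" by (rule card_1_singletonE)
    then show ?thesis by blast
  qed
  then obtain p where p: "p \<in> layer j" "S \<inter> layer j \<subseteq> {p}" by blast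
  obtain a where a: "p = P j a" "valid j a" using layer_cases[OF p(1)] .
  have *: "(nR (P j a), x) \<in> R \<or> x = p" if "x \<in> layer j" for x
  proof -
    from that obtain i where i: "x = P j i" "valid j i" by (rule layer_cases)
    define t where "t = nat ((i - a) mod 12)"
    have t: "int t = (i - a) mod 12" by (simp add: t_def)
    have "(a + int t) mod 12 = i mod 12" unfolding t by (simp add: mod_simps)
    then have "x = P j (a + int t)" "valid j (a + int t)"
      using i P_cong valid_cong by metis+
    moreover have "t \<le> 11" using t pos_mod_bound[of 12 "i - a"] by linarith
    ultimately show ?thesis
      using layer_connected_aux[of j a t] a p(2) j(1) by (cases "t = 0") auto
  qed
  show ?thesis
  proof (cases "u = p \<or> v = p")
    case False
    then show ?thesis using * u v R_sym R_trans by blast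
  next
    case True
    have nRp: "nR p \<in> layer j" using p(1) a j by (auto simp: layer_def P_VV nR_P valid_R)
    have "p \<in> W" using True u v by auto
    have "nR p \<noteq> p" using distinct_nbrs[of p] p(1) by (auto simp: layer_def)
    then have "nR p \<in> W" using nRp p by (auto simp: W_def layer_def)
    then have "(nR p, p) \<in> R" using \<open>p \<in> W\<close> R_arc R_sym by blast
    then show ?thesis using * u v R_sym R_trans a(1) by blast
  qed
qed

text \<open>Consecutive layers are joined by six disjoint vertical edges; three of them suffice for
  one to survive.\<close>

lemma link_up:
  assumes "0 \<le> j" "j < n - 1"
  obtains i where "odd (i + j)" "P j i \<in> W" "P (j + 1) i \<in> W" "(P j i, P (j + 1) i) \<in> R"
proof -
  have "P j (j + 1) \<notin> S \<and> P (j + 1) (j + 1) \<notin> S \<or> P j (j + 3) \<notin> S \<and> P (j + 1) (j + 3) \<notin> S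
     \<or> P j (j + 5) \<notin> S \<and> P (j + 1) (j + 5) \<notin> S"
    by (rule card_less_3_pairs[OF S(2) fin_S]) (use assms in \<open>simp_all add: P_eq_iff\<close>)
  moreover have "odd (j + 1 + j)" "odd (j + 3 + j)" "odd (j + 5 + j)" by presburger+
  ultimately obtain i where i: "odd (i + j)" "P j i \<notin> S" "P (j + 1) i \<notin> S" by blast
  have "hex j (i + 1)" using assms i(1) by (auto simp: hex_def)
  then have "P j i \<in> VV" "P (j + 1) i \<in> VV"
    using hex_valid(2,4)[of j "i + 1"] assms by (simp_all add: P_VV)
  then have "P j i \<in> W" "P (j + 1) i \<in> W" using i by (auto simp: W_def)
  moreover have "nV (P j i) = P (j + 1) i" using i assms by (simp add: nV_P)
  ultimately show ?thesis using that i R_arc by metis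
qed

text \<open>Even when both removed vertices lie in layer \<open>k\<close>, one of three disjoint
  horizontal edges of this layer survives. One end of it leads up and the other leads down, so the
  layer can be crossed.\<close>

lemma link_across:
  assumes "0 < k" "k < n - 1" "S \<subseteq> layer k"
  obtains i i' where "P (k + 1) i \<in> W" "P (k - 1) i' \<in> W" "(P (k + 1) i, P (k - 1) i') \<in> R"
proof -
  have "P k (k + 1) \<notin> S \<and> P k (k + 1 + 1) \<notin> S \<or> P k (k + 3) \<notin> S \<and> P k (k + 3 + 1) \<notin> S
     \<or> P k (k + 5) \<notin> S \<and> P k (k + 5 + 1) \<notin> S"
    by (rule card_less_3_pairs[OF S(2) fin_S]) (use assms in \<open>simp_all add: P_eq_iff\<close>)
  moreover have "odd (k + 1 + k)" "odd (k + 3 + k)" "odd (k + 5 + k)" by presburger+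
  ultimately obtain i where i: "odd (i + k)" "P k i \<notin> S" "P k (i + 1) \<notin> S" by blast
  have v: "valid k i" "valid k (i + 1)" using assms by (simp_all add: valid_mid)
  have "valid (k + 1) i" using valid_up[OF v(1)] i assms by simp
  moreover have "valid (k - 1) (i + 1)" using valid_down[OF v(2)] i assms by simp
  ultimately have V: "P k i \<in> VV" "P k (i + 1) \<in> VV" "P (k + 1) i \<in> VV" "P (k - 1) (i + 1) \<in> VV"
    using v assms by (simp_all add: P_VV)
  moreover have "P (k + 1) i \<notin> S" "P (k - 1) (i + 1) \<notin> S" using assms by (auto simp: layer_def)
  ultimately have W: "P k i \<in> W" "P k (i + 1) \<in> W" "P (k + 1) i \<in> W" "P (k - 1) (i + 1) \<in> W"
    using i by (auto simp: W_def)
  have "nV (P k i) = P (k + 1) i" "nR (P k i) = P k (i + 1)" "nV (P k (i + 1)) = P (k - 1) (i + 1)"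
    using i v assms by (simp_all add: nV_P nR_P)
  then have "(P k i, P (k + 1) i) \<in> R" "(P k i, P k (i + 1)) \<in> R" "(P k (i + 1), P (k - 1) (i + 1)) \<in> R"
    using W R_arc by metis+
  then show ?thesis using that W R_sym R_trans by metis
qed

definition clean :: "int \<Rightarrow> bool" where "clean j \<longleftrightarrow> card (S \<inter> layer j) \<le> 1"

lemma unclean:
  assumes "\<not> clean k" shows "S \<subseteq> layer k" "j \<noteq> k \<Longrightarrow> clean j"
proof -
  have "card S \<le> card (S \<inter> layer k)" using assms S(2) by (simp add: clean_def)
  then have "S \<inter> layer k = S" using fin_S by (metis card_seteq inf_le1)
  then show *: "S \<subseteq> layer k" by blast
  show "clean j" if "j \<noteq> k"
  proof -
    have "S \<inter> layer j = {}" using * that by (auto simp: layer_def)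
    then show ?thesis by (simp add: clean_def)
  qed
qed

text \<open>Induction on the highest layer allowed. The new layer is reached from the one below by a
  vertical edge, or, if that one is unclean, from two layers below. An unclean layer contains all
  removed vertices, so there is at most one.\<close>

lemma clean_connected:
  "int k < n \<Longrightarrow> u \<in> W \<Longrightarrow> v \<in> W \<Longrightarrow> lay u \<le> int k \<Longrightarrow> lay v \<le> int k \<Longrightarrow> clean (lay u) \<Longrightarrow> clean (lay v)
    \<Longrightarrow> (u, v) \<in> R"
proof (induction k arbitrary: u v)
  case 0
  then have "lay u = 0" "lay v = 0" by (auto simp: W_def elim: VV_cases)
  then show ?case using 0 layer_connected[of 0 u v] by (auto simp: clean_def layer_def W_def)
next
  case (Suc k)
  have same: "(u, v) \<in> R" if "u \<in> W" "v \<in> W" "lay u = lay v" "clean (lay u)" for u v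
    using layer_connected[of "lay u" u v] that by (auto simp: clean_def layer_def W_def)
  have *: "(u, v) \<in> R" if u: "u \<in> W" "lay u = int k + 1" "clean (int k + 1)"
    and v: "v \<in> W" "lay v \<le> int k" "clean (lay v)" for u v
  proof (cases "clean (int k)")
    case True
    obtain i where i: "P (int k) i \<in> W" "P (int k + 1) i \<in> W" "(P (int k) i, P (int k + 1) i) \<in> R"
      using link_up[of "int k"] Suc.prems(1) by auto
    have "(u, P (int k + 1) i) \<in> R" using same[of u "P (int k + 1) i"] u i by simp
    moreover have "(P (int k) i, v) \<in> R" using Suc.IH[of "P (int k) i" v] i v True Suc.prems(1) by simp
    ultimately show ?thesis using i R_sym R_trans by blast
  next
    case False
    then have "lay v \<noteq> int k" using v by auto
    then have k: "0 < int k" "lay v \<le> int k - 1" using v by (auto simp: W_def elim: VV_cases)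
    obtain i i' where i: "P (int k + 1) i \<in> W" "P (int k - 1) i' \<in> W"
      "(P (int k + 1) i, P (int k - 1) i') \<in> R"
      using link_across[of "int k"] k Suc.prems(1) unclean(1)[OF False] by auto
    have "(u, P (int k + 1) i) \<in> R" using same[of u "P (int k + 1) i"] u i by simp
    moreover have "(P (int k - 1) i', v) \<in> R"
      using Suc.IH[of "P (int k - 1) i'" v] i v unclean(2)[OF False] k Suc.prems(1) by simp
    ultimately show ?thesis using i R_trans by blast
  qed
  show ?case
  proof (cases "lay u = lay v")
    case True
    then show ?thesis using same Suc.prems by blast
  next
    case False
    consider "lay u = int k + 1" "lay v \<le> int k" | "lay v = int k + 1" "lay u \<le> int k"
      | "lay u \<le> int k" "lay v \<le> int k"
      using Suc.prems False by linarith
    then show ?thesis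
    proof cases
      case 1
      then show ?thesis using *[of u v] Suc.prems by simp
    next
      case 2
      then show ?thesis using *[of v u] Suc.prems R_sym by simp
    next
      case 3
      then show ?thesis using Suc.IH[of u v] Suc.prems by simp
    qed
  qed
qed

text \<open>A vertical edge that leaves the layer can be used at once. Otherwise \<open>u\<close> is
  the end of a chord, and the vertical edges at both horizontal neighbours leave the layer. If both
  neighbours are removed, nothing else is, and the way leads through the chord and the right
  neighbour of its other end.\<close>

lemma escape:
  assumes "u \<in> W" "\<not> clean (lay u)"
  obtains v where "v \<in> W" "clean (lay v)" "(u, v) \<in> R"
proof -
  let ?k = "lay u"
  have vert: "\<exists>v\<in>W. clean (lay v) \<and> (x, v) \<in> R" if "x \<in> W" "lay x = ?k" "lay (nV x) \<noteq> ?k" for x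
  proof -
    have "nV x \<in> W" using that unclean(1)[OF assms(2)] nV_VV by (auto simp: W_def layer_def)
    then show ?thesis using that R_arc[of x "nV x"] unclean(2)[OF assms(2)] by blast
  qed
  have horiz: "lay (nV (nR x)) \<noteq> ?k \<and> lay (nV (nL x)) \<noteq> ?k \<and> lay (nR x) = ?k \<and> lay (nL x) = ?k \<and> lay (nV x) = ?k
     \<and> lay (nV (nV x)) = ?k \<and> nV x \<in> VV \<and> nR (nV x) \<noteq> nR x \<and> nR (nV x) \<noteq> nL x"
    if "x \<in> VV" "lay x = ?k" "lay (nV x) = ?k" for x
  proof -
    from that(1) obtain j i where x: "x = P j i" "valid j i" "0 \<le> j" "j < n" by (rule VV_cases)
    \<comment> \<open>A vertical neighbour in the same layer means that the edge is a chord.\<close>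
    have e: "if odd (i + j) then j = n - 1 else j = 0" using that x by (auto simp: nV_P split: if_splits)
    have v: "valid j (i + 1)" "valid j (i - 1)" "valid j (i + 6 + 1)"
      using x(2) e n3 unfolding valid_def by (auto split: if_splits)
    show ?thesis
      using that x e v n3 by (auto simp: nV_P nR_P nL_P P_VV P_eq_iff valid_6 split: if_splits)
  qed
  have "\<exists>v\<in>W. clean (lay v) \<and> (u, v) \<in> R"
  proof (cases "lay (nV u) = ?k")
    case False
    then show ?thesis by (rule vert[OF assms(1) refl])
  next
    case True
    have uV: "u \<in> VV" using assms by (simp add: W_def)
    note h = horiz[OF uV refl True]
    have h': "lay (nV (nR (nV u))) \<noteq> ?k" "lay (nR (nV u)) = ?k" using horiz[of "nV u"] h by auto
    consider "nR u \<notin> S" | "nL u \<notin> S" | "nR u \<in> S" "nL u \<in> S" by blast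
    then show ?thesis
    proof cases
      case 1
      then have "nR u \<in> W" using nR_VV[OF uV] by (simp add: W_def)
      then show ?thesis using vert[of "nR u"] h R_arc[of u "nR u"] assms(1) R_trans by blast
    next
      case 2
      then have "nL u \<in> W" using nL_VV[OF uV] by (simp add: W_def)
      then show ?thesis using vert[of "nL u"] h R_arc[of u "nL u"] assms(1) R_trans by blast
    next
      case 3
      have d: "nR u \<noteq> nL u" "nV u \<noteq> nR u" "nV u \<noteq> nL u" using distinct_nbrs[OF uV] by auto
      have "x = nR u \<or> x = nL u" if "x \<in> S" for x
      proof (rule ccontr)
        assume "\<not> ?thesis"
        then have "card {x, nR u, nL u} = 3" using d by simp
        moreover have "card {x, nR u, nL u} \<le> card S" using that 3 fin_S by (intro card_mono) auto
        ultimately show False using S(2) by simp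
      qed
      then have "nV u \<notin> S" "nR (nV u) \<notin> S" using d h by auto
      then have W: "nV u \<in> W" "nR (nV u) \<in> W" using h nR_VV by (auto simp: W_def)
      then have "(u, nV u) \<in> R" "(nV u, nR (nV u)) \<in> R" using R_arc assms(1) by auto
      then show ?thesis using vert[of "nR (nV u)"] h' W R_trans by blast
    qed
  qed
  then show ?thesis using that by blast
qed

lemma W_connected: "u \<in> W \<Longrightarrow> v \<in> W \<Longrightarrow> (u, v) \<in> (parcs G \<inter> W \<times> W)\<^sup>*"
proof -
  assume uv: "u \<in> W" "v \<in> W"
  have ex: "\<exists>v\<in>W. clean (lay v) \<and> (u, v) \<in> R" if "u \<in> W" for u
    using that escape R_refl by (cases "clean (lay u)") blast+
  obtain u' v' where *: "u' \<in> W" "clean (lay u')" "(u, u') \<in> R" "v' \<in> W" "clean (lay v')" "(v, v') \<in> R"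
    using ex uv by meson
  then have "lay u' < n" "lay v' < n" by (auto simp: W_def elim: VV_cases)
  then have "(u', v') \<in> R" using clean_connected[of "nat (n - 1)" u' v'] * n3 by simp
  then show ?thesis using * R_sym R_trans unfolding R_def by blast
qed

end

lemma three_connected_G: "three_connected G"
  unfolding three_connected_def
proof (intro conjI allI impI)
  show c: "3 < card (pverts G)" using card_VV n3 by simp
  fix S assume S: "S \<subseteq> pverts G" "card S < 3"
  show "Digraph_Component.connected (with_proj G \<restriction> (pverts G - S))"
  proof (rule connected_induceI)
    show "pverts G - S \<noteq> {}"
    proof
      assume "pverts G - S = {}"
      then have "S = VV" using S by auto
      then show False using c S by simp
    qed
  next
    fix u v assume "u \<in> pverts G - S" "v \<in> pverts G - S"
    then show "(u, v) \<in> (parcs G \<inter> (pverts G - S) \<times> (pverts G - S))\<^sup>*"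
      using W_connected[of S u v] S by (simp add: W_def)
  qed
qed

lemma connected_G: "u \<in> VV \<Longrightarrow> v \<in> VV \<Longrightarrow> (u, v) \<in> (parcs G)\<^sup>*"
proof -
  assume "u \<in> VV" "v \<in> VV"
  then have "(u, v) \<in> (parcs G \<inter> VV \<times> VV)\<^sup>*" using W_connected[of "{}" u v] by (simp add: W_def)
  then show ?thesis by (rule rtrancl_mono[THEN subsetD, rotated]) simp
qed

sublocale facial_cubic VV na nV nc
proof unfold_locales
  show "(u, v) \<in> (parcs G)\<^sup>*" if "u \<in> VV" "v \<in> VV" for u v
    using connected_G that .
  show "\<not> N w \<subseteq> fverts d" if "d \<in> parcs G" "w \<in> fverts d" for d w
    using no_claw that .
  show "3 \<le> card (fverts d)" if "d \<in> parcs G" for d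
    using card_fverts_cases[OF that] by auto
qed

lemma fullerene_G: "fullerene G rot"
  unfolding fullerene_def plane_graph_def
proof (intro conjI ballI)
  have "with_proj G \<restriction> VV = with_proj G"
    using N_V by (auto simp: induce_subgraph_def with_proj_def parcs_G)
  moreover have "Digraph_Component.connected (with_proj G \<restriction> VV)"
    using three_connected_G by (auto simp: three_connected_def dest: spec[of _ "{}"])
  ultimately show "Digraph_Component.connected (with_proj G)" by simp
qed (use pair_graph_G rot_permutes rot_cyclic nbrs_G euler three_connected_G card_N card_face in auto)

end

section \<open>Symmetries and zigzags of the tube\<close>

context cubic_rotation
begin

lemma preservingI:
  assumes "f permutes V"
    and "\<And>v. v \<in> V \<Longrightarrow> (f (na v), f (nb v), f (nc v)) \<in>
      {(na (f v), nb (f v), nc (f v)), (nb (f v), nc (f v), na (f v)), (nc (f v), na (f v), nb (f v))}"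
  shows "preserving f"
  unfolding preserving_def
proof (intro conjI ballI)
  fix v u assume v: "v \<in> V" "u \<in> N v"
  then have "f v \<in> V" using assms(1) by (simp add: permutes_in_image)
  then show "f u \<in> N (f v)" "f (rot v u) = rot (f v) (f u)"
    using v assms(2)[OF v(1)] by (auto simp: N_def rot_na rot_nb rot_nc)
qed (rule assms(1))

lemma reversingI:
  assumes "f permutes V"
    and "\<And>v. v \<in> V \<Longrightarrow> f (na v) = nc (f v) \<and> f (nb v) = nb (f v) \<and> f (nc v) = na (f v)"
  shows "reversing f"
  unfolding reversing_def
proof (intro conjI ballI)
  fix v u assume v: "v \<in> V" "u \<in> N v"
  then have "f v \<in> V" using assms(1) by (simp add: permutes_in_image)
  then show "f u \<in> N (f v)" "f (rot v u) = rot (f v) (rot (f v) (f u))"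
    using v assms(2)[OF v(1)] by (auto simp: N_def rot_na rot_nb rot_nc)
qed (rule assms(1))

end

context tube
begin

section \<open>Symmetries of the tube\<close>

definition flip :: "bool \<Rightarrow> int \<Rightarrow> int" where
  "flip t j = (if t then n - 1 - j else j)"

text \<open>
  The rotation (\<open>e = 1\<close>) or reflection (\<open>e = -1\<close>) of all layers by \<open>c\<close> sites, followed by a reversal
  of the order of the layers if \<open>t\<close>.  Admissible parameters preserve the missing sites.
\<close>

definition amap :: "bool \<Rightarrow> int \<Rightarrow> int \<Rightarrow> nat \<Rightarrow> nat" where
  "amap t e c v = (if v \<in> VV then P (flip t (lay v)) (e * pos v + c) else v)"

definition admissible :: "bool \<Rightarrow> int \<Rightarrow> int \<Rightarrow> bool" where
  "admissible t e c \<longleftrightarrow> (e = 1 \<or> e = -1) \<and> 6 dvd (if t then c - n else c)"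

lemma amap_P: "valid j i \<Longrightarrow> amap t e c (P j i) = P (flip t j) (e * i + c)"
proof -
  assume v: "valid j i"
  then have "0 \<le> j" by (simp add: valid_def)
  moreover have "(e * (i mod 12) + c) mod 12 = (e * i + c) mod 12"
    by (metis mod_add_left_eq mod_mult_right_eq)
  ultimately show ?thesis using v P_cong[of "e * (i mod 12) + c" "e * i + c"] by (simp add: amap_def P_VV)
qed

lemma flip_range: "0 \<le> flip t j \<longleftrightarrow> (if t then j < n else 0 \<le> j)" "flip t j < n \<longleftrightarrow> (if t then 0 \<le> j else j < n)"
  by (auto simp: flip_def)

text \<open>A shift by a multiple of 6 keeps parities and divisibility by 6. A reversal of the
  layers exchanges the two end conditions, which differ by a shift by \<open>n\<close>; the
  direction of this shift is irrelevant as \<open>6 dvd 2 * n\<close>.\<close>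

lemma valid_amap:
  assumes a: "admissible t e c"
  shows "valid (flip t j) (e * i + c) \<longleftrightarrow> valid j i"
proof -
  have "6 dvd 2 * n" using dvd_n by presburger
  then have n2: "6 dvd x + n \<longleftrightarrow> 6 dvd x - n" for x by presburger
  have e: "e = 1 \<or> e = -1" using a by (simp add: admissible_def)
  show ?thesis
  proof (cases t)
    case False
    then have c: "6 dvd c" using a by (simp add: admissible_def)
    have "odd (e * i + c) = odd i" using e c by (elim disjE; clarsimp; presburger)
    moreover have "odd (e * i + c + n) = odd (i + n)" using e c by (elim disjE; clarsimp; presburger)
    moreover have "6 dvd (e * i + c) \<longleftrightarrow> 6 dvd i" using e c by (elim disjE; clarsimp; presburger)
    moreover have "6 dvd (e * i + c - n) \<longleftrightarrow> 6 dvd (i - n)" using e c n2[of i] by (elim disjE; clarsimp; presburger)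
    ultimately show ?thesis using False unfolding valid_def flip_def by simp
  next
    case True
    then have c: "6 dvd c - n" using a by (simp add: admissible_def)
    have "odd (e * i + c) = odd (i + n)" using e c by (elim disjE; clarsimp; presburger)
    moreover have "odd (e * i + c + n) = odd i" using e c by (elim disjE; clarsimp; presburger)
    moreover have "6 dvd (e * i + c - n) \<longleftrightarrow> 6 dvd i" using e c by (elim disjE; clarsimp; presburger)
    moreover have "6 dvd (e * i + c) \<longleftrightarrow> 6 dvd (i - n)" using e c n2[of i] n2[of "c - n"] by (elim disjE; clarsimp; presburger)
    moreover have "n - 1 - j = 0 \<longleftrightarrow> j = n - 1" "n - 1 - j = n - 1 \<longleftrightarrow> j = 0"
      "0 \<le> n - 1 - j \<longleftrightarrow> j < n" "n - 1 - j < n \<longleftrightarrow> 0 \<le> j" by auto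
    ultimately show ?thesis using True unfolding valid_def flip_def by (simp only: if_True) blast
  qed
qed

lemma amap_VV: "admissible t e c \<Longrightarrow> v \<in> VV \<Longrightarrow> amap t e c v \<in> VV"
proof (elim VV_cases)
  fix j i assume a: "admissible t e c" and v: "v = P j i" "valid j i" "0 \<le> j" "j < n"
  then show "amap t e c v \<in> VV"
    using valid_amap[OF a, of j i] by (simp add: amap_P P_VV flip_range)
qed

lemma dvd_sign: "e = 1 \<or> e = -1 \<Longrightarrow> k dvd e * x \<longleftrightarrow> k dvd (x::int)"
  by auto

lemma amap_permutes:
  assumes a: "admissible t e c" shows "amap t e c permutes VV"
proof -
  have e: "e = 1 \<or> e = -1" using a by (simp add: admissible_def)
  have "inj_on (amap t e c) VV"
  proof (rule inj_onI)
    fix v w assume "v \<in> VV" "w \<in> VV" and eq: "amap t e c v = amap t e c w"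
    then obtain j i j' i' where v: "v = P j i" "valid j i" "0 \<le> j" "j < n"
      and w: "w = P j' i'" "valid j' i'" "0 \<le> j'" "j' < n" by (metis VV_cases)
    have "P (flip t j) (e * i + c) = P (flip t j') (e * i' + c)" using eq v w by (simp add: amap_P)
    moreover have "0 \<le> flip t j" "0 \<le> flip t j'" using v w by (simp_all add: flip_range)
    ultimately have "flip t j = flip t j'" "12 dvd e * (i - i')"
      by (simp_all add: P_eq_iff algebra_simps)
    then have "j = j'" "12 dvd i - i'" by (auto simp: flip_def dvd_sign[OF e] split: if_splits)
    then show "v = w" using v w by (simp add: P_eq_iff)
  qed
  moreover have "amap t e c ` VV \<subseteq> VV" using amap_VV[OF a] by blast
  ultimately have "bij_betw (amap t e c) VV VV"
    using finite_VV by (simp add: bij_betw_def endo_inj_surj)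
  then show ?thesis by (rule bij_imp_permutes) (simp add: amap_def)
qed

lemma amap_up:
  assumes a: "admissible t e c" and v: "v \<in> VV"
  shows "up (amap t e c v) \<longleftrightarrow> up v \<noteq> t"
proof -
  obtain j i where p: "v = P j i" "valid j i" "0 \<le> j" "j < n" using v by (rule VV_cases)
  have "odd (e * i + c + flip t j) \<longleftrightarrow> odd (i + j) \<noteq> t"
  proof -
    have e: "e = 1 \<or> e = -1" and c: "6 dvd (if t then c - n else c)"
      using a by (simp_all add: admissible_def)
    show ?thesis using e c by (cases t; elim disjE; clarsimp simp: flip_def; presburger)
  qed
  moreover have "0 \<le> flip t j" using p by (simp add: flip_range)
  ultimately show ?thesis using p by (simp add: amap_P up_P)
qed

lemma amap_nbrs:
  assumes a: "admissible t e c" and v: "v \<in> VV"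
  shows "amap t e c (nV v) = nV (amap t e c v)"
    "amap t e c (nR v) = (if e = 1 then nR (amap t e c v) else nL (amap t e c v))"
    "amap t e c (nL v) = (if e = 1 then nL (amap t e c v) else nR (amap t e c v))"
proof -
  have e: "e = 1 \<or> e = -1" using a by (simp add: admissible_def)
  obtain j i where p: "v = P j i" "valid j i" "0 \<le> j" "j < n" using v by (rule VV_cases)
  have f: "0 \<le> flip t j" using p by (simp add: flip_range)
  note va = valid_amap[OF a]
  define x where "x = e * i + c"
  have v': "amap t e c v = P (flip t j) x" using p by (simp add: amap_P x_def)
  have R: "amap t e c (nR v) = P (flip t j) (if valid j (i + 1) then x + e else x + 2 * e)"
    using p valid_R[OF p(2)] by (simp add: nR_P amap_P x_def algebra_simps)
  have L: "amap t e c (nL v) = P (flip t j) (if valid j (i - 1) then x - e else x - 2 * e)"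
    using p valid_L[OF p(2)] by (simp add: nL_P amap_P x_def algebra_simps)
  have v1: "valid (flip t j) (x + e) = valid j (i + 1)" "valid (flip t j) (x - e) = valid j (i - 1)"
    using va[of j "i + 1"] va[of j "i - 1"] by (simp_all add: x_def algebra_simps)
  show "amap t e c (nR v) = (if e = 1 then nR (amap t e c v) else nL (amap t e c v))"
    unfolding v' R using v1 f e by (auto simp: nR_P nL_P)
  show "amap t e c (nL v) = (if e = 1 then nL (amap t e c v) else nR (amap t e c v))"
    unfolding v' L using v1 f e by (auto simp: nR_P nL_P)
  have par: "odd (e * i + c + flip t j) \<longleftrightarrow> odd (i + j) \<noteq> t"
  proof -
    have e: "e = 1 \<or> e = -1" and c: "6 dvd (if t then c - n else c)"
      using a by (simp_all add: admissible_def)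
    show ?thesis using e c by (cases t; elim disjE; clarsimp simp: flip_def; presburger)
  qed
  \<comment> \<open>Opposite sites stay opposite under reflection, as 6 and -6 agree modulo
    12.\<close>
  have six: "P k (e * (i + 6) + c) = P k (x + 6)" for k
    using e by (intro P_cong) (auto simp: mod_eq_dvd_iff x_def algebra_simps)
  have six': "amap t e c (P j (i + 6)) = P (flip t j) (x + 6)"
    using p six by (simp add: amap_P valid_6)
  define A B where "A \<longleftrightarrow> j = n - 1" and "B \<longleftrightarrow> j = 0"
  have nVv: "nV v = (if odd (i + j) then if A then P j (i + 6) else P (j + 1) i
       else if B then P j (i + 6) else P (j - 1) i)"
    using p by (simp add: nV_P A_def B_def)
  have nVx: "nV (P (flip t j) x) = (if odd (i + j) \<noteq> t then if flip t j = n - 1 then P (flip t j) (x + 6) else P (flip t j + 1) x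
       else if flip t j = 0 then P (flip t j) (x + 6) else P (flip t j - 1) x)"
    using f par by (simp add: nV_P x_def)
  have U: "amap t e c (P (j + 1) i) = P (flip t (j + 1)) x" if "odd (i + j)" "\<not> A"
    using amap_P[OF valid_up[OF p(2)]] that by (simp add: x_def A_def)
  have D: "amap t e c (P (j - 1) i) = P (flip t (j - 1)) x" if "even (i + j)" "\<not> B"
    using amap_P[OF valid_down[OF p(2)]] that by (simp add: x_def B_def)
  have fl: "flip t (j + 1) = (if t then flip t j - 1 else flip t j + 1)"
    "flip t (j - 1) = (if t then flip t j + 1 else flip t j - 1)"
    "flip t j = n - 1 \<longleftrightarrow> (if t then B else A)" "flip t j = 0 \<longleftrightarrow> (if t then A else B)"
    by (auto simp: flip_def A_def B_def)
  show "amap t e c (nV v) = nV (amap t e c v)"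
    unfolding v' nVv nVx using six' U D fl by (cases "odd (i + j)"; cases t) simp_all
qed

text \<open>The reflection of the circle and the reversal of the layers each reverse the
  orientation, so exactly one of them alone does.\<close>

lemma amap_preserving:
  assumes a: "admissible t e c" and "(e = 1) \<noteq> t"
  shows "preserving (amap t e c)"
  using amap_permutes[OF a]
proof (intro preservingI)
  fix v assume v: "v \<in> VV"
  let ?f = "amap t e c"
  have "?f (na v) = na (?f v)" "?f (nV v) = nV (?f v)" "?f (nc v) = nc (?f v)"
    using amap_nbrs[OF a v] amap_up[OF a v] assms(2) by (auto simp: na_def nc_def split: if_splits)
  then show "(?f (na v), ?f (nV v), ?f (nc v)) \<in> {(na (?f v), nV (?f v), nc (?f v)),
      (nV (?f v), nc (?f v), na (?f v)), (nc (?f v), na (?f v), nV (?f v))}" by simp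
qed

lemma amap_reversing:
  assumes a: "admissible t e c" and "(e = 1) = t"
  shows "reversing (amap t e c)"
  using amap_permutes[OF a]
proof (intro reversingI)
  fix v assume v: "v \<in> VV"
  let ?f = "amap t e c"
  show "?f (na v) = nc (?f v) \<and> ?f (nV v) = nV (?f v) \<and> ?f (nc v) = na (?f v)"
    using amap_nbrs[OF a v] amap_up[OF a v] assms(2) by (auto simp: na_def nc_def split: if_splits)
qed

lemma amap_Aut: "admissible t e c \<Longrightarrow> amap t e c \<in> Aut"
  using amap_preserving[of t e c] amap_reversing[of t e c] preserving_Aut reversing_Aut by blast

section \<open>The zigzag and its mirror image\<close>

lemma zigzag_True: "zigzag_step rot (d, True) = (fs d, False)"
  by (cases d) (simp add: zigzag_step_def fs_eq)

lemma zigzag_False: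
  assumes v: "v \<in> VV"
  shows "zigzag_step rot (dR v, False) = (if up (nR v) then dV (nR v) else dR (nR v), True)"
    "zigzag_step rot (dL v, False) = (if up (nL v) then dL (nL v) else dV (nL v), True)"
proof -
  have R: "nR v \<in> VV" "nL (nR v) = v" and L: "nL v \<in> VV" "nR (nL v) = v"
    using v nR_VV nL_VV nL_nR nR_nL by auto
  show "zigzag_step rot (dR v, False) = (if up (nR v) then dV (nR v) else dR (nR v), True)"
    using rot_nL[OF R(1)] rot_nR[OF R(1)] rot_nV[OF R(1)] R
    by (simp add: zigzag_step_def dR_def dV_def inv_rot)
  show "zigzag_step rot (dL v, False) = (if up (nL v) then dL (nL v) else dV (nL v), True)"
    using rot_nL[OF L(1)] rot_nR[OF L(1)] rot_nV[OF L(1)] L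
    by (simp add: zigzag_step_def dL_def dV_def inv_rot)
qed

text \<open>
  The zigzag climbs the tube in a helix, passes the chord of the top layer, descends on the opposite
  side and returns through the chord of the bottom layer.
\<close>

definition "zX j = (dR (P j j), False)"
definition "zU j = (dV (P j (j + 1)), True)"
definition "zY j = (dL (P j (j + 7)), False)"
definition "zW j = (dV (P j (j + 6)), True)"

lemma zvalid:
  assumes "0 \<le> j" "j < n"
  shows "valid j j" "valid j (j + 1)" "valid j (j + 6)" "valid j (j + 7)"
  using assms unfolding valid_def by auto

text \<open>On the way up each layer costs one edge to the right and one vertical edge, so layer
  \<open>j\<close> is entered at site \<open>j\<close>. The top chord ends at \<open>n + 6\<close>;
  on the way down the horizontal edges lead to the left, so layer \<open>j\<close> is entered at
  \<open>j + 7\<close> and left at \<open>j + 6\<close>, opposite to the ascent.\<close>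

lemma z_steps:
  assumes j: "0 \<le> j" "j < n"
  shows "zigzag_step rot (zX j) = zU j" "zigzag_step rot (zY j) = zW j"
    "j < n - 1 \<Longrightarrow> zigzag_step rot (zU j) = zX (j + 1)"
    "zigzag_step rot (zU (n - 1)) = zY (n - 1)"
    "0 < j \<Longrightarrow> zigzag_step rot (zW j) = zY (j - 1)"
    "zigzag_step rot (zW 0) = zX 0"
proof -
  note v = zvalid[OF j]
  note cj = add.commute[of "numeral w" j for w] add.commute[of 1 j]
  show "zigzag_step rot (zX j) = zU j"
    using v j by (simp add: zX_def zU_def zigzag_False P_VV nR_P up_P cj)
  show "zigzag_step rot (zY j) = zW j"
    using v j by (simp add: zY_def zW_def zigzag_False P_VV nL_P up_P cj)
  show "zigzag_step rot (zU j) = zX (j + 1)" if "j < n - 1"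
    using v j that by (simp add: zU_def zX_def zigzag_True fs_dV P_VV nV_P up_P cj)
  show "zigzag_step rot (zW j) = zY (j - 1)" if "0 < j"
    using v j that by (simp add: zW_def zY_def zigzag_True fs_dV P_VV nV_P up_P cj)
  have "valid (n - 1) n" "valid 0 6" using n3 by (simp_all add: valid_top valid_0)
  then show "zigzag_step rot (zU (n - 1)) = zY (n - 1)" "zigzag_step rot (zW 0) = zX 0"
    using n3 P_12[of 0 0] by (simp_all add: add.commute[of "numeral w" n for w] zU_def zW_def zX_def zY_def zigzag_True fs_dV P_VV nV_P up_P cj)
qed

definition zcycle :: "((nat \<times> nat) \<times> bool) set" where
  "zcycle = zX ` {0..<n} \<union> zU ` {0..<n} \<union> zY ` {0..<n} \<union> zW ` {0..<n}"

lemma z_orbit: "orbit (zigzag_step rot) (zX 0) = zcycle"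
proof (rule orbit_eqI_cycle)
  let ?f = "zigzag_step rot" and ?O = "orbit (zigzag_step rot) (zX 0)"
  show "zX 0 \<in> zcycle" using n3 by (auto simp: zcycle_def)
  show "?f z \<in> zcycle" if "z \<in> zcycle" for z
  proof -
    from that obtain j where j: "0 \<le> j" "j < n" and "z = zX j \<or> z = zU j \<or> z = zY j \<or> z = zW j"
      by (auto simp: zcycle_def)
    moreover have "j < n - 1 \<or> j = n - 1" "0 < j \<or> j = 0" using j by auto
    ultimately consider "z = zX j" | "z = zY j" | "z = zU j" "j < n - 1" | "z = zU j" "j = n - 1"
      | "z = zW j" "0 < j" | "z = zW j" "j = 0" by blast
    then show ?thesis using j n3 z_steps[OF j] by cases (auto simp: zcycle_def)
  qed
  have X: "zU (int k) \<in> ?O \<and> (zX (int k) \<in> ?O \<or> k = 0)" if "int k < n" for k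
    using that
  proof (induct k)
    case 0
    then show ?case using z_steps(1)[of 0] by (simp, metis orbit.base)
  next
    case (Suc k)
    then have "zU (int k) \<in> ?O" by simp
    moreover have "?f (zU (int k)) = zX (int k + 1)" using z_steps(3)[of "int k"] Suc.prems by simp
    moreover have "int (Suc k) = int k + 1" by simp
    ultimately have X: "zX (int (Suc k)) \<in> ?O" using orbit.step[of "zU (int k)" ?f "zX 0"] by (simp only:)
    then have "?f (zX (int (Suc k))) \<in> ?O" by (rule orbit.step)
    moreover have "?f (zX (int (Suc k))) = zU (int (Suc k))"
      using z_steps(1)[of "int (Suc k)"] Suc.prems by simp
    ultimately show ?case using X by metis
  qed
  have Y: "zY (n - 1 - int k) \<in> ?O \<and> zW (n - 1 - int k) \<in> ?O" if "int k < n" for k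
    using that
  proof (induct k)
    case 0
    have "zU (n - 1) \<in> ?O" using X[of "nat (n - 1)"] n3 by simp
    then have Y: "zY (n - 1) \<in> ?O"
      using z_steps(4)[of 0] orbit.step[of "zU (n - 1)" ?f "zX 0"] n3 by simp
    then have "?f (zY (n - 1)) \<in> ?O" by (rule orbit.step)
    then show ?case using Y z_steps(2)[of "n - 1"] n3 by simp
  next
    case (Suc k)
    then have "zW (n - 1 - int k) \<in> ?O" by simp
    then have "?f (zW (n - 1 - int k)) \<in> ?O" by (rule orbit.step)
    moreover have "?f (zW (n - 1 - int k)) = zY (n - 1 - int (Suc k))"
      using z_steps(5)[of "n - 1 - int k"] Suc.prems by (simp add: algebra_simps)
    ultimately have Y: "zY (n - 1 - int (Suc k)) \<in> ?O" by simp
    then have "?f (zY (n - 1 - int (Suc k))) \<in> ?O" by (rule orbit.step)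
    then show ?case using Y z_steps(2)[of "n - 1 - int (Suc k)"] Suc.prems by simp
  qed
  have "zW 0 \<in> ?O" using Y[of "nat (n - 1)"] n3 by simp
  then have "?f (zW 0) \<in> ?O" by (rule orbit.step)
  then have X0: "zX 0 \<in> ?O" using z_steps(6)[of 0] n3 by simp
  have X': "zX j \<in> ?O" "zU j \<in> ?O" if "0 \<le> j" "j < n" for j
    using X[of "nat j"] that X0 by auto
  have Y': "zY j \<in> ?O" "zW j \<in> ?O" if "0 \<le> j" "j < n" for j
    using Y[of "nat (n - 1 - j)"] that by auto
  show "z \<in> ?O" if "z \<in> zcycle" for z
    using that X' Y' by (auto simp: zcycle_def)
qed

definition vedge :: "int \<Rightarrow> int \<Rightarrow> nat set" where "vedge j i = {P j i, P (j + 1) i}"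
definition hedge :: "int \<Rightarrow> int \<Rightarrow> nat set" where "hedge j i = {P j i, P j (i + 1)}"
definition chord :: "int \<Rightarrow> int \<Rightarrow> nat set" where "chord j i = {P j i, P j (i + 6)}"

text \<open>Chords have period 6 rather than 12, since shifting by 6 exchanges their ends.\<close>

lemma edge_eqs:
  assumes "0 \<le> j" "0 \<le> j'"
  shows "vedge j i = vedge j' i' \<longleftrightarrow> j = j' \<and> 12 dvd i - i'"
    "hedge j i = hedge j' i' \<longleftrightarrow> j = j' \<and> 12 dvd i - i'"
    "chord j i = chord j' i' \<longleftrightarrow> j = j' \<and> 6 dvd i - i'"
    "vedge j i \<noteq> hedge j' i'" "vedge j i \<noteq> chord j' i'" "hedge j i \<noteq> chord j' i'"
    "hedge j' i' \<noteq> vedge j i" "chord j' i' \<noteq> vedge j i" "chord j' i' \<noteq> hedge j i"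
  using assms by (auto simp: vedge_def hedge_def chord_def doubleton_eq_iff P_eq_iff; presburger)+

lemma state_edges:
  assumes j: "0 \<le> j" "j < n"
  shows "state_edge (zX j) = hedge j j" "state_edge (zY j) = hedge j (j + 6)"
    "state_edge (zU j) = (if j = n - 1 then chord j (j + 1) else vedge j (j + 1))"
    "state_edge (zW j) = (if j = 0 then chord 0 0 else vedge (j - 1) (j + 6))"
  using zvalid[OF j] j n3 P_12[of 0 0]
  by (auto simp: state_edge_def zX_def zY_def zU_def zW_def dR_def dL_def dV_def nR_P nL_P nV_P
    hedge_def vedge_def chord_def add.commute[of "numeral w" j for w] add.commute[of 1 j] insert_commute)

end

lemma state_edge_reverse: "state_edge (reverse_state s) = state_edge s"
  by (auto simp: state_edge_def reverse_state_def split: prod.splits)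

lemma (in cubic_rotation) state_edge_zmap: "state_edge (zmap f s) = f ` state_edge s"
  by (auto simp: state_edge_def zmap_def split: prod.splits)

lemma zigzag_edges_pair: "zigzag_edges {C, reverse_state ` C} = state_edge ` C"
  by (auto simp: zigzag_edges_def image_image state_edge_reverse)

lemma simple_zigzag_pair: "inj_on state_edge C \<Longrightarrow> simple_zigzag {C, reverse_state ` C}"
  by (auto simp: simple_zigzag_def inj_on_def state_edge_reverse)

context tube
begin

definition zedges :: "nat set set" where
  "zedges = {hedge j (j + 6 * k) |j k. 0 \<le> j \<and> j < n} \<union> {vedge j (j + 1 + 6 * k) |j k. 0 \<le> j \<and> j < n - 1}
     \<union> {chord 0 0, chord (n - 1) n}"

lemma zcycle_edges: "state_edge ` zcycle = zedges"
proof
  show "state_edge ` zcycle \<subseteq> zedges"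
  proof
    fix x assume "x \<in> state_edge ` zcycle"
    then obtain j where j: "0 \<le> j" "j < n" and
      "x = state_edge (zX j) \<or> x = state_edge (zU j) \<or> x = state_edge (zY j) \<or> x = state_edge (zW j)"
      by (auto simp: zcycle_def)
    moreover have "hedge j (j + 6 * 0) \<in> zedges" "hedge j (j + 6 * 1) \<in> zedges"
      using j unfolding zedges_def by blast+
    moreover have "vedge j (j + 1 + 6 * 0) \<in> zedges" if "j \<noteq> n - 1"
    proof -
      have "0 \<le> j \<and> j < n - 1" using j that by auto
      then show ?thesis unfolding zedges_def by blast
    qed
    moreover have "vedge (j - 1) ((j - 1) + 1 + 6 * 1) \<in> zedges" if "j \<noteq> 0"
    proof -
      have "0 \<le> j - 1 \<and> j - 1 < n - 1" using j that by auto
      then show ?thesis unfolding zedges_def by blast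
    qed
    moreover have "chord 0 0 \<in> zedges" "chord (n - 1) n \<in> zedges" by (auto simp: zedges_def)
    ultimately show "x \<in> zedges" using state_edges[OF j] by (auto split: if_splits)
  qed
  show "zedges \<subseteq> state_edge ` zcycle"
  proof
    have Z: "state_edge (zX j) \<in> state_edge ` zcycle" "state_edge (zY j) \<in> state_edge ` zcycle"
      "state_edge (zU j) \<in> state_edge ` zcycle" "state_edge (zW j) \<in> state_edge ` zcycle" if "0 \<le> j" "j < n" for j
      using that by (auto simp: zcycle_def)
    have h: "hedge j (j + 6 * k) \<in> state_edge ` zcycle" if "0 \<le> j" "j < n" for j k
    proof -
      have "12 dvd 6 * k \<or> 12 dvd 6 * k - 6" by presburger
      then have "hedge j (j + 6 * k) = hedge j j \<or> hedge j (j + 6 * k) = hedge j (j + 6)"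
        using edge_eqs(2)[OF that(1) that(1)] by (auto simp: algebra_simps)
      then show ?thesis using Z[OF that] state_edges[OF that] by auto
    qed
    have v: "vedge j (j + 1 + 6 * k) \<in> state_edge ` zcycle" if "0 \<le> j" "j < n - 1" for j k
    proof -
      have "12 dvd 6 * k \<or> 12 dvd 6 * k - 6" by presburger
      then have "vedge j (j + 1 + 6 * k) = vedge j (j + 1) \<or> vedge j (j + 1 + 6 * k) = vedge j (j + 7)"
        using edge_eqs(1)[OF that(1) that(1)] by (auto simp: algebra_simps)
      moreover have "state_edge (zU j) = vedge j (j + 1)" "state_edge (zW (j + 1)) = vedge j (j + 7)"
        using state_edges(3)[of j] state_edges(4)[of "j + 1"] that by (simp_all add: add.commute[of 7 j])
      ultimately show ?thesis using Z(3)[of j] Z(4)[of "j + 1"] that by auto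
    qed
    have c: "chord 0 0 \<in> state_edge ` zcycle" "chord (n - 1) n \<in> state_edge ` zcycle"
      using Z(4)[of 0] Z(3)[of "n - 1"] state_edges(4)[of 0] state_edges(3)[of "n - 1"] n3 by auto
    show "x \<in> state_edge ` zcycle" if "x \<in> zedges" for x
      using that h v c unfolding zedges_def by blast
  qed
qed

text \<open>The three kinds of edges under a numerical tag, so that a single equivalence decides
  every comparison between them.\<close>

definition kedge :: "nat \<Rightarrow> int \<Rightarrow> int \<Rightarrow> nat set" where
  "kedge k j i = (if k = 0 then hedge j i else if k = 1 then vedge j i else chord j i)"

lemma kedge_eq:
  "0 \<le> j \<Longrightarrow> 0 \<le> j' \<Longrightarrow> k \<le> 2 \<Longrightarrow> k' \<le> 2 \<Longrightarrow> kedge k j i = kedge k' j' i' \<longleftrightarrow>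
     k = k' \<and> j = j' \<and> (if k = 2 then 6 else 12) dvd i - i'"
proof -
  assume j: "0 \<le> j" "0 \<le> j'" and "k \<le> 2" "k' \<le> 2"
  then have "k \<in> {0, 1, 2}" "k' \<in> {0, 1, 2}" by auto
  then show ?thesis
    by (elim insertE emptyE; simp add: kedge_def edge_eqs(1-3)[OF j] edge_eqs(4-9)[OF j] edge_eqs(4-9)[OF j(2,1)])
qed

text \<open>Ascent and descent use opposite edges in every layer and in every gap between layers.
  The only exceptions to the vertical pattern are \<open>zU (n - 1)\<close> and \<open>zW 0\<close>,
  which run through the chords of different layers.\<close>

lemma zcycle_inj: "inj_on state_edge zcycle"
proof (rule inj_onI)
  define U :: "int \<Rightarrow> nat" where "U = (\<lambda>j. if j = n - 1 then 2 else 1)"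
  define W :: "int \<Rightarrow> nat" where "W = (\<lambda>j. if j = 0 then 2 else 1)"
  define w where "w = (\<lambda>j::int. if j = 0 then 0 else j - 1)"
  define u where "u = (\<lambda>j::int. if j = 0 then 0 else j + 6)"
  have k: "state_edge (zX j) = kedge 0 j j" "state_edge (zY j) = kedge 0 j (j + 6)"
    "state_edge (zU j) = kedge (U j) j (j + 1)" "state_edge (zW j) = kedge (W j) (w j) (u j)"
    "0 \<le> w j" "U j \<le> 2" "W j \<le> 2" "0 < U j" "0 < W j" if "0 \<le> j" "j < n" for j
    using state_edges[OF that] that by (auto simp: kedge_def U_def W_def w_def u_def)
  fix s t assume "s \<in> zcycle" "t \<in> zcycle" and eq: "state_edge s = state_edge t"
  then obtain j j' where j: "0 \<le> j" "j < n" "0 \<le> j'" "j' < n"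
    and s: "s = zX j \<or> s = zU j \<or> s = zY j \<or> s = zW j"
    and t: "t = zX j' \<or> t = zU j' \<or> t = zY j' \<or> t = zW j'"
    unfolding zcycle_def by auto
  have UW: "kedge (U a) a (a + 1) \<noteq> kedge (W b) (w b) (u b)" if "0 \<le> a" "a < n" "0 \<le> b" for a b
    using that n3 by (cases "a = n - 1"; cases "b = 0") (auto simp: kedge_eq U_def W_def w_def u_def)
  have UU: "a = b" if "kedge (U a) a (a + 1) = kedge (U b) b (b + 1)" "0 \<le> a" "0 \<le> b" for a b
    using that by (auto simp: kedge_eq U_def)
  have WW: "a = b" if "kedge (W a) (w a) (u a) = kedge (W b) (w b) (u b)" "0 \<le> a" "0 \<le> b" for a b
    using that by (cases "a = 0"; cases "b = 0") (auto simp: kedge_eq W_def w_def)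
  have XY: "kedge 0 a a \<noteq> kedge 0 b (b + 6)" "kedge 0 a a \<noteq> kedge (U b) b (b + 1)"
    "kedge 0 a a \<noteq> kedge (W b) (w b) (u b)" "kedge 0 a (a + 6) \<noteq> kedge (U b) b (b + 1)"
    "kedge 0 a (a + 6) \<noteq> kedge (W b) (w b) (u b)" if "0 \<le> a" "0 \<le> b" for a b
    using that by (auto simp: kedge_eq U_def W_def w_def)
  have XX: "a = b" if "kedge 0 a i = kedge 0 b i'" "0 \<le> a" "0 \<le> b" for a b i i'
    using that by (simp add: kedge_eq)
  note k = k(1-4)[OF j(1,2)] k(1-4)[OF j(3,4)]
  note XY = XY[OF j(1,3)] XY[OF j(3,1)] UW[OF j(1,2,3)] UW[OF j(3,4,1)]
  have "j = j' \<and> (s = zX j \<and> t = zX j' \<or> s = zU j \<and> t = zU j' \<or> s = zY j \<and> t = zY j' \<or> s = zW j \<and> t = zW j')"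
    using s
  proof (elim disjE)
    assume s: "s = zX j"
    show ?thesis using t eq XY XX j unfolding s by (elim disjE) (simp_all only: k, metis+)
  next
    assume s: "s = zU j"
    show ?thesis using t eq XY UU j unfolding s by (elim disjE) (simp_all only: k, metis+)
  next
    assume s: "s = zY j"
    show ?thesis using t eq XY XX j unfolding s by (elim disjE) (simp_all only: k, metis+)
  next
    assume s: "s = zW j"
    show ?thesis using t eq XY WW j unfolding s by (elim disjE) (simp_all only: k, metis+)
  qed
  then show "s = t" by auto
qed

lemma amap_edges:
  assumes "admissible False e c"
  shows "valid j i \<Longrightarrow> valid (j + 1) i \<Longrightarrow> amap False e c ` vedge j i = vedge j (e * i + c)"
    "valid j i \<Longrightarrow> valid j (i + 1) \<Longrightarrow> e = -1 \<Longrightarrow> amap False e c ` hedge j i = hedge j (c - i - 1)"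
    "valid j i \<Longrightarrow> e = -1 \<Longrightarrow> amap False e c ` chord j i = chord j (c - i - 6)"
  by (auto simp: vedge_def hedge_def chord_def amap_P flip_def valid_6 algebra_simps)

abbreviation "mir \<equiv> amap False (-1) 0"

lemma mir: "admissible False (-1) 0" "reversing mir"
  by (auto simp: admissible_def intro!: amap_reversing)

lemma valid_6k: "valid j (i + 6 * k) = valid j i"
  unfolding valid_def by presburger

lemma mir_zedges: "(`) mir ` zedges =
    {hedge j (- j - 1 - 6 * k) |j k. 0 \<le> j \<and> j < n} \<union> {vedge j (- j - 1 - 6 * k) |j k. 0 \<le> j \<and> j < n - 1}
     \<union> {chord 0 0, chord (n - 1) n}"
proof -
  have h: "mir ` hedge j (j + 6 * k) = hedge j (- j - 1 - 6 * k)" if "0 \<le> j \<and> j < n" for j k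
  proof -
    have "valid j (j + 6 * k)" "valid j (j + 6 * k + 1)"
      using zvalid[of j] that valid_6k[of j "j + 1" k] valid_6k[of j j k] by (simp_all add: algebra_simps)
    then have "mir ` hedge j (j + 6 * k) = hedge j (0 - (j + 6 * k) - 1)"
      by (rule amap_edges(2)[OF mir(1) _ _ refl])
    also have "0 - (j + 6 * k) - 1 = - j - 1 - 6 * k" by simp
    finally show ?thesis .
  qed
  have v: "mir ` vedge j (j + 1 + 6 * k) = vedge j (- j - 1 - 6 * k)" if "0 \<le> j \<and> j < n - 1" for j k
  proof -
    have "valid j (j + 1 + 6 * k)" "valid (j + 1) (j + 1 + 6 * k)"
      using zvalid[of j] zvalid[of "j + 1"] that by (simp_all add: valid_6k)
    then have "mir ` vedge j (j + 1 + 6 * k) = vedge j (- 1 * (j + 1 + 6 * k) + 0)"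
      by (rule amap_edges(1)[OF mir(1)])
    also have "- 1 * (j + 1 + 6 * k) + 0 = - j - 1 - 6 * k" by simp
    finally show ?thesis .
  qed
  have "mir ` chord 0 0 = chord 0 (- 6)"
    using amap_edges(3)[OF mir(1), of 0 0] by (simp add: valid_0)
  then have c: "mir ` chord 0 0 = chord 0 0" by (simp add: edge_eqs)
  have "mir ` chord (n - 1) n = chord (n - 1) (- n - 6)"
    using amap_edges(3)[OF mir(1), of "n - 1" n] by (simp add: valid_top)
  moreover have "6 dvd - n - 6 - n" using dvd_n by presburger
  ultimately have c': "mir ` chord (n - 1) n = chord (n - 1) n" using n3 by (simp add: edge_eqs)
  have "(`) mir ` {hedge j (j + 6 * k) |j k. 0 \<le> j \<and> j < n} = {mir ` hedge j (j + 6 * k) |j k. 0 \<le> j \<and> j < n}"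
    by blast
  also have "\<dots> = {hedge j (- j - 1 - 6 * k) |j k. 0 \<le> j \<and> j < n}"
    by (rule Collect_cong) (metis h)
  finally have H: "(`) mir ` {hedge j (j + 6 * k) |j k. 0 \<le> j \<and> j < n} = {hedge j (- j - 1 - 6 * k) |j k. 0 \<le> j \<and> j < n}" .
  have "(`) mir ` {vedge j (j + 1 + 6 * k) |j k. 0 \<le> j \<and> j < n - 1} = {mir ` vedge j (j + 1 + 6 * k) |j k. 0 \<le> j \<and> j < n - 1}"
    by blast
  also have "\<dots> = {vedge j (- j - 1 - 6 * k) |j k. 0 \<le> j \<and> j < n - 1}"
    by (rule Collect_cong) (metis v)
  finally show ?thesis using H by (simp add: zedges_def image_Un c c')
qed

text \<open>The mirror image sends site \<open>i\<close> to \<open>- i\<close>. A common horizontal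
  edge in layer \<open>j\<close> would make \<open>2 * j + 1\<close> divisible by 6, which parity
  forbids. A common vertical edge above layer \<open>j\<close> makes \<open>2 * (j + 1)\<close>
  divisible by 6, so \<open>j + 1 = 3 * t\<close>, and then both opposite edges of the helix are
  common.\<close>

lemma inter_edges:
  "zedges \<inter> (`) mir ` zedges = {chord 0 0, chord (n - 1) n} \<union>
     (\<lambda>(t, k). vedge (3 * t - 1) (3 * t + 6 * k)) ` ({1..<n div 3} \<times> {0, 1})"
proof (intro equalityI subsetI)
  fix x assume "x \<in> zedges \<inter> (`) mir ` zedges"
  then have x: "x \<in> zedges" "x \<in> (`) mir ` zedges" by auto
  have n0: "0 \<le> n - 1" using n3 by simp
  consider "x \<in> {chord 0 0, chord (n - 1) n}" | j k where "0 \<le> j" "j < n" "x = hedge j (j + 6 * k)"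
    | j k where "0 \<le> j" "j < n - 1" "x = vedge j (j + 1 + 6 * k)"
    using x(1) unfolding zedges_def by blast
  then show "x \<in> {chord 0 0, chord (n - 1) n} \<union>
     (\<lambda>(t, k). vedge (3 * t - 1) (3 * t + 6 * k)) ` ({1..<n div 3} \<times> {0, 1})"
  proof cases
    case 1
    then show ?thesis by blast
  next
    case (2 j k)
    have "x \<noteq> chord 0 0" "x \<noteq> chord (n - 1) n" "\<And>j' i. 0 \<le> j' \<Longrightarrow> x \<noteq> vedge j' i"
      using 2 edge_eqs(6)[OF 2(1) order_refl] edge_eqs(6)[OF 2(1) n0] edge_eqs(7)[OF _ 2(1)] by auto
    then obtain j' k' where j': "0 \<le> j'" "x = hedge j' (- j' - 1 - 6 * k')"
      using x(2) unfolding mir_zedges by blast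
    have "j = j' \<and> 12 dvd (j + 6 * k - (- j' - 1 - 6 * k'))"
      using edge_eqs(2)[OF 2(1) j'(1), THEN iffD1, OF trans[OF 2(3)[symmetric] j'(2)]] .
    then have False by presburger
    then show ?thesis ..
  next
    case (3 j k)
    have "x \<noteq> chord 0 0" "x \<noteq> chord (n - 1) n" "\<And>j' i. 0 \<le> j' \<Longrightarrow> x \<noteq> hedge j' i"
      using 3 edge_eqs(5)[OF 3(1) order_refl] edge_eqs(5)[OF 3(1) n0] edge_eqs(4)[OF 3(1)] by auto
    then obtain j' k' where j': "0 \<le> j'" "x = vedge j' (- j' - 1 - 6 * k')"
      using x(2) unfolding mir_zedges by blast
    have "j = j' \<and> 12 dvd (j + 1 + 6 * k - (- j' - 1 - 6 * k'))"
      using edge_eqs(1)[OF 3(1) j'(1), THEN iffD1, OF trans[OF 3(3)[symmetric] j'(2)]] .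
    then have "3 dvd j + 1" by presburger
    then obtain t where t: "j + 1 = 3 * t" by auto
    have "t \<in> {1..<n div 3}" using t 3 dvd_n by auto
    moreover have "x = vedge (3 * t - 1) (3 * t + 6 * (k mod 2))"
    proof -
      have "12 dvd 6 * k - 6 * (k mod 2)" by presburger
      then have "vedge j (j + 1 + 6 * k) = vedge j (3 * t + 6 * (k mod 2))"
        unfolding t using edge_eqs(1)[OF 3(1) 3(1)] by (simp add: algebra_simps)
      moreover have "j = 3 * t - 1" using t by simp
      ultimately show ?thesis using 3(3) by simp
    qed
    moreover have "k mod 2 \<in> {0, 1}" by auto
    ultimately show ?thesis
      by (intro UnI2 image_eqI[of _ _ "(t, k mod 2)"]) simp_all
  qed
next
  fix x assume "x \<in> {chord 0 0, chord (n - 1) n} \<union>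
     (\<lambda>(t, k). vedge (3 * t - 1) (3 * t + 6 * k)) ` ({1..<n div 3} \<times> {0, 1})"
  then show "x \<in> zedges \<inter> (`) mir ` zedges"
  proof
    assume "x \<in> {chord 0 0, chord (n - 1) n}"
    then show ?thesis unfolding mir_zedges unfolding zedges_def by blast
  next
    assume "x \<in> (\<lambda>(t, k). vedge (3 * t - 1) (3 * t + 6 * k)) ` ({1..<n div 3} \<times> {0, 1})"
    then obtain p where p: "p \<in> {1..<n div 3} \<times> {0, 1::int}" "x = (\<lambda>(t, k). vedge (3 * t - 1) (3 * t + 6 * k)) p"
      by blast
    obtain t k where "p = (t, k)" by (cases p)
    with p have 2: "1 \<le> t" "t < n div 3" "x = vedge (3 * t - 1) (3 * t + 6 * k)" by simp_all
    define j where "j = 3 * t - 1"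
    have j: "0 \<le> j \<and> j < n - 1" using 2 by (auto simp: j_def)
    have x: "x = vedge j (j + 1 + 6 * k)" using 2 by (simp add: j_def)
    \<comment> \<open>With \<open>j + 1 = 3 * t\<close> the two sites differ by
      \<open>12 * (t + k)\<close>.\<close>
    have "vedge j (j + 1 + 6 * k) = vedge j (- j - 1 - 6 * (t + k))"
      using j by (simp add: edge_eqs j_def algebra_simps)
    with x j have "x \<in> {vedge j (- j - 1 - 6 * k) |j k. 0 \<le> j \<and> j < n - 1}" by blast
    moreover have "x \<in> {vedge j (j + 1 + 6 * k) |j k. 0 \<le> j \<and> j < n - 1}" using x j by blast
    ultimately show ?thesis unfolding mir_zedges unfolding zedges_def by blast
  qed
qed

lemma card_inter: "int (card (zedges \<inter> (`) mir ` zedges)) = 2 * (n div 3)"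
proof -
  let ?g = "\<lambda>(t, k). vedge (3 * t - 1) (3 * t + 6 * k)" and ?I = "{1..<n div 3} \<times> {0, 1::int}"
  have n0: "0 \<le> n - 1" using n3 by simp
  have "inj_on ?g ?I"
  proof (rule inj_onI, clarify)
    fix t k t' k' :: int
    assume *: "t \<in> {1..<n div 3}" "t' \<in> {1..<n div 3}" "k \<in> {0, 1}" "k' \<in> {0, 1}"
      and eq: "vedge (3 * t - 1) (3 * t + 6 * k) = vedge (3 * t' - 1) (3 * t' + 6 * k')"
    have "0 \<le> 3 * t - 1" "0 \<le> 3 * t' - 1" using * by auto
    then have "3 * t - 1 = 3 * t' - 1 \<and> 12 dvd (3 * t + 6 * k - (3 * t' + 6 * k'))"
      by (rule edge_eqs(1)[THEN iffD1, OF _ _ eq])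
    then show "t = t' \<and> k = k'" using * by auto
  qed
  then have "card (?g ` ?I) = card ?I" by (rule card_image)
  moreover have "{chord 0 0, chord (n - 1) n} \<inter> ?g ` ?I = {}"
  proof -
    have ne: "chord 0 0 \<noteq> vedge (3 * t - 1) i" "chord (n - 1) n \<noteq> vedge (3 * t - 1) i" if "1 \<le> t" for t i
      using edge_eqs(8)[of "3 * t - 1" 0] edge_eqs(8)[of "3 * t - 1" "n - 1"] n0 that by auto
    show ?thesis by (auto simp: ne)
  qed
  moreover have "chord 0 0 \<noteq> chord (n - 1) n" using edge_eqs(3)[of 0 "n - 1" 0 n] n3 by simp
  moreover have "int (card ?I) = 2 * (n div 3 - 1)" using n3 by (simp add: card_cartesian_product)
  ultimately show ?thesis unfolding inter_edges by (subst card_Un_disjoint) auto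
qed

lemma zigzags_meet:
  "\<exists>Z1\<in>zigzags G rot. \<exists>Z2\<in>zigzags G rot. Z1 \<noteq> Z2 \<and> simple_zigzag Z1 \<and> simple_zigzag Z2 \<and>
     int (card (zigzag_edges Z1 \<inter> zigzag_edges Z2)) = 2 * (n div 3)"
proof (intro bexI conjI)
  let ?f = "zigzag_step rot"
  let ?C = "orbit ?f (zX 0)" and ?D = "orbit ?f (zmap mir (zX 0))"
  let ?Z1 = "{?C, reverse_state ` ?C}" and ?Z2 = "{?D, reverse_state ` ?D}"
  have arc: "fst (zX 0) \<in> parcs G" using zvalid[of 0] n3 by (simp add: zX_def darts_in P_VV)
  have self: "zX 0 \<in> ?C" using n3 by (auto simp: z_orbit zcycle_def)
  have arcs: "fst s \<in> parcs G" if "s \<in> ?C" for s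
    using that by induction (use arc zigzag_step_arc in auto)
  have D: "?D = zmap mir ` ?C"
    by (rule orbit_inverse[OF self, symmetric]) (use reversing_zigzag_step[OF mir(2)] arcs in auto)
  have "fst (zmap mir (zX 0)) \<in> parcs G"
  proof -
    obtain u v b where "zX 0 = ((u, v), b)" by (metis surj_pair)
    moreover from this have "(v, u) \<in> parcs G" using arc by (auto intro: arc_sym)
    then have "v \<in> VV" "u \<in> N v" by (auto simp: arc_iff)
    then have "mir v \<in> VV" "mir u \<in> N (mir v)"
      using mir(2) unfolding reversing_def by (auto simp: permutes_in_image)
    ultimately show ?thesis by (auto simp: zmap_def intro: arcI)
  qed
  then show "?Z2 \<in> zigzags G rot" unfolding zigzags_def by blast
  show "?Z1 \<in> zigzags G rot" using arc unfolding zigzags_def by blast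
  have E1: "zigzag_edges ?Z1 = zedges" by (simp only: zigzag_edges_pair z_orbit zcycle_edges)
  have "state_edge ` ?D = (`) mir ` state_edge ` ?C"
    unfolding D by (simp add: image_image state_edge_zmap)
  then have E2: "zigzag_edges ?Z2 = (`) mir ` zedges"
    by (simp only: zigzag_edges_pair z_orbit zcycle_edges)
  show "simple_zigzag ?Z1" using zcycle_inj by (intro simple_zigzag_pair) (simp add: z_orbit)
  have "inj mir" using mir(1) amap_permutes permutes_inj by blast
  then have "inj_on state_edge ?D"
    using zcycle_inj unfolding D z_orbit by (auto simp: inj_on_def state_edge_zmap inj_image_eq_iff)
  then show "simple_zigzag ?Z2" by (rule simple_zigzag_pair)
  show "int (card (zigzag_edges ?Z1 \<inter> zigzag_edges ?Z2)) = 2 * (n div 3)"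
    unfolding E1 E2 by (rule card_inter)
  \<comment> \<open>Equal zigzags would share all their edges, but no horizontal edge is
    common.\<close>
  show "?Z1 \<noteq> ?Z2"
  proof
    assume "?Z1 = ?Z2"
    then have eq: "zedges = (`) mir ` zedges" using E1 E2 by (simp only:)
    have "0 \<le> (0::int) \<and> 0 < n" using n3 by simp
    then have "hedge 0 (0 + 6 * 0) \<in> zedges" unfolding zedges_def by blast
    then have h: "hedge 0 0 \<in> zedges" by simp
    then have "hedge 0 0 \<in> zedges \<inter> (`) mir ` zedges"
      using eq[THEN equalityD1, THEN subsetD, OF h] by (rule IntI)
    then have "hedge 0 0 \<in> {chord 0 0, chord (n - 1) n} \<union>
       (\<lambda>(t, k). vedge (3 * t - 1) (3 * t + 6 * k)) ` ({1..<n div 3} \<times> {0, 1})"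
      by (simp only: inter_edges)
    moreover have ne: "hedge 0 0 \<noteq> chord 0 0" "hedge 0 0 \<noteq> chord (n - 1) n"
      using edge_eqs(6)[of 0 0 0 0] edge_eqs(6)[of 0 "n - 1" 0 n] n3 by auto
    moreover have ne': "hedge 0 0 \<noteq> vedge (3 * t - 1) i" if "1 \<le> t" for t i
      using edge_eqs(7)[of "3 * t - 1" 0] that by simp
    ultimately show False by (auto simp: ne ne')
  qed
qed

section \<open>Composition and fixed cells of the symmetries\<close>

lemma amap_cong: "12 dvd c - c' \<Longrightarrow> amap t e c = amap t e c'"
  by (rule ext) (auto simp: amap_def mod_eq_dvd_iff intro!: P_cong)

lemma amap_comp:
  assumes "admissible t e c" "admissible t' e' c'"
  shows "amap t e c \<circ> amap t' e' c' = amap (t \<noteq> t') (e * e') (e * c' + c)"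
    "admissible (t \<noteq> t') (e * e') (e * c' + c)"
proof -
  have e: "e = 1 \<or> e = -1" "e' = 1 \<or> e' = -1" using assms by (auto simp: admissible_def)
  have n2: "6 dvd 2 * n" using dvd_n by presburger
  show "admissible (t \<noteq> t') (e * e') (e * c' + c)"
    using assms n2 unfolding admissible_def by (elim conjE disjE; cases t; cases t'; clarsimp; presburger)
  show "amap t e c \<circ> amap t' e' c' = amap (t \<noteq> t') (e * e') (e * c' + c)"
  proof
    fix v
    show "(amap t e c \<circ> amap t' e' c') v = amap (t \<noteq> t') (e * e') (e * c' + c) v"
    proof (cases "v \<in> VV")
      case True
      then obtain j i where v: "v = P j i" "valid j i" "0 \<le> j" "j < n" by (rule VV_cases)
      moreover have "flip t (flip t' j) = flip (t \<noteq> t') j" by (auto simp: flip_def)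
      ultimately show ?thesis
        using valid_amap[OF assms(2), of j i] by (simp add: amap_P algebra_simps)
    qed (simp add: amap_def)
  qed
qed

text \<open>The value at site 0 of the bottom layer determines the layer and \<open>c\<close>, the
  value at site 1 then determines \<open>e\<close>, since 1 and -1 differ modulo 12.\<close>

lemma amap_eqD:
  assumes "admissible t e c" "admissible t' e' c'" "amap t e c = amap t' e' c'"
  shows "t = t' \<and> e = e' \<and> 12 dvd c - c'"
proof -
  have e: "e = 1 \<or> e = -1" "e' = 1 \<or> e' = -1" using assms by (auto simp: admissible_def)
  have v: "valid 0 0" "valid 0 1" by (simp_all add: valid_0)
  have f: "0 \<le> flip t 0" "0 \<le> flip t' 0" using n3 by (simp_all add: flip_range)
  have E: "flip t 0 = flip t' 0 \<and> 12 dvd e * i + c - (e' * i + c')" if "valid 0 i" for i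
    using amap_P[OF that, of t e c] amap_P[OF that, of t' e' c'] assms(3) P_eq_iff[OF f] by metis
  have fl: "flip t 0 = flip t' 0" and c: "12 dvd c - c'" using E[OF v(1)] by simp_all
  have ee: "12 dvd e - e'"
    using dvd_diff[OF conjunct2[OF E[OF v(2)]] c] by (simp add: algebra_simps)
  have "t = t'" using fl n3 by (auto simp: flip_def split: if_splits)
  moreover have "e = e'" using e ee by auto
  ultimately show ?thesis using c by simp
qed

lemma amap_id: "amap False 1 0 = id"
proof
  fix v show "amap False 1 0 v = id v"
    by (cases "v \<in> VV") (auto elim!: VV_cases simp: amap_P flip_def amap_def)
qed

text \<open>A face between layers spans three consecutive sites. Only the caps are wider, and they
  stay in an end layer; this is the exceptional alternative.\<close>

lemma face_window:
  assumes d: "d \<in> parcs G" and v: "P j i \<in> fverts d" "P j' i' \<in> fverts d" "0 \<le> j" "0 \<le> j'"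
  shows "j = j' \<and> (j = 0 \<or> j = n - 1) \<or> (\<exists>k\<in>{-2..2}. 12 dvd i - i' - k)"
proof -
  obtain xs where xs: "xs \<in> flists" "fverts d = fst ` set xs" using d by (rule fverts_flist)
  then consider r c where "hex r c" "xs = ring r c" | e where "xs = bottomcap e" | e where "xs = topcap e"
    by (auto simp: flists_def)
  then show ?thesis
  proof cases
    case (1 r c)
    have r: "0 \<le> r" using 1(1) by (simp add: hex_def)
    have fv: "fverts d = set (ringverts r c)" using xs(2) 1(2) ring_fst[of r c] by (metis list.set_map)
    have *: "\<exists>k\<in>{-1, 0, 1}. 12 dvd a - (c + k)" if "P b a \<in> fverts d" "0 \<le> b" for a b
      using that r unfolding fv by (auto simp: ringverts_def P_eq_iff algebra_simps split: if_splits)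
    obtain k where k: "k \<in> {-1, 0, 1}" "12 dvd i - (c + k)" using *[OF v(1,3)] by blast
    obtain k' where k': "k' \<in> {-1, 0, 1}" "12 dvd i' - (c + k')" using *[OF v(2,4)] by blast
    have "12 dvd (i - (c + k)) - (i' - (c + k'))" using k(2) k'(2) by (rule dvd_diff)
    then have "12 dvd i - i' - (k - k')" by (simp add: algebra_simps)
    moreover have "k - k' \<in> {-2..2}" using k(1) k'(1) by auto
    ultimately show ?thesis by blast
  next
    case (2 e)
    have "lay x = 0" if "x \<in> fverts d" for x
      using that unfolding xs(2) 2 by (auto simp: bottomcap_def)
    from this[OF v(1)] this[OF v(2)] show ?thesis using v(3,4) by simp
  next
    case (3 e)
    have "lay x = n - 1" if "x \<in> fverts d" for x
      using that n3 unfolding xs(2) 3 by (auto simp: topcap_def)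
    from this[OF v(1)] this[OF v(2)] show ?thesis using v(3,4) by simp
  qed
qed

lemma cell_in_face:
  assumes "c \<in> cells G rot" obtains d where "d \<in> parcs G" "c \<subseteq> fverts d" "c \<noteq> {}"
proof -
  have *: "\<exists>d\<in>parcs G. {v, u} \<subseteq> fverts d" if "v \<in> VV" "u \<in> N v" for v u
    using arcI[OF that] corner_fverts[OF that] by blast
  consider v where "v \<in> VV" "c = {v}" | v u where "v \<in> VV" "u \<in> N v" "c = {v, u}"
    | d where "d \<in> parcs G" "c = fverts d"
    using assms unfolding cells_G edges_G by blast
  then show ?thesis
  proof cases
    case 1
    then show ?thesis using *[of v "nV v"] that by (auto simp: N_eq)
  next
    case 2
    then show ?thesis using *[of v u] that by auto
  next
    case 3
    then show ?thesis using that[of d] card_fverts[of d] by fastforce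
  qed
qed

definition fixes_cell :: "(nat \<Rightarrow> nat) \<Rightarrow> bool" where
  "fixes_cell f \<longleftrightarrow> (\<exists>c\<in>cells G rot. f ` c = c)"

text \<open>A vertex of a fixed cell and its image lie on a common face. End layers are exchanged,
  so the exception of \<open>face_window\<close> does not arise and \<open>c\<close> is within two
  of a multiple of 12. As 3 divides \<open>c\<close>, it is itself such a multiple.\<close>

lemma no_fixed_cell:
  assumes a: "admissible True 1 c" and c: "\<not> 12 dvd c"
  shows "\<not> fixes_cell (amap True 1 c)"
proof
  assume "fixes_cell (amap True 1 c)"
  then obtain x where x: "x \<in> cells G rot" "amap True 1 c ` x = x" by (auto simp: fixes_cell_def)
  obtain d where d: "d \<in> parcs G" "x \<subseteq> fverts d" "x \<noteq> {}" using x(1) by (rule cell_in_face)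
  then obtain v where v: "v \<in> x" "v \<in> VV" using fverts_V by blast
  obtain j i where p: "v = P j i" "valid j i" "0 \<le> j" "j < n" using v(2) by (rule VV_cases)
  have vd: "v \<in> fverts d" using d(2) v(1) by blast
  have "amap True 1 c v \<in> x" using imageI[OF v(1), of "amap True 1 c"] unfolding x(2) .
  then have "P (n - 1 - j) (i + c) \<in> fverts d"
    using d(2) amap_P[OF p(2), of True 1 c] unfolding p(1) by (auto simp: flip_def)
  then have "n - 1 - j = j \<and> (n - 1 - j = 0 \<or> n - 1 - j = n - 1) \<or> (\<exists>k\<in>{-2..2}. 12 dvd i + c - i - k)"
    using face_window[OF d(1), of "n - 1 - j" "i + c" j i] vd p by simp
  then obtain k where "k \<in> {-2..2}" "12 dvd c - k" using n3 by auto
  moreover have "3 dvd c" using a dvd_n unfolding admissible_def by presburger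
  ultimately have "12 dvd c" by (simp; presburger)
  with c show False ..
qed

lemma vertex_cell: "valid j i \<Longrightarrow> {P j i} \<in> cells G rot"
  unfolding cells_G by (auto simp: P_VV valid_def)

lemma edge_cell: "v \<in> VV \<Longrightarrow> u \<in> {nR v, nL v, nV v} \<Longrightarrow> {v, u} \<in> cells G rot"
  unfolding cells_G edges_G N_eq by blast

text \<open>A rotation preserves the bottom chord. A reflection with \<open>c = 6 * k\<close> fixes
  the site \<open>3 * k\<close>, which is present at the bottom: it is odd or a multiple of
  6.\<close>

lemma fixed_cell_False:
  assumes a: "admissible False e c"
  shows "fixes_cell (amap False e c)"
proof -
  have c: "6 dvd c" and e: "e = 1 \<or> e = -1" using a by (auto simp: admissible_def)
  show ?thesis
  proof (cases "e = 1")
    case True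
    have v: "P 0 0 \<in> VV" "valid 0 0" "valid 0 6" by (simp_all add: P_VV valid_0)
    have nV0: "nV (P 0 0) = P 0 6" by (simp add: nV_P)
    have "{P 0 0, P 0 6} \<in> cells G rot" using edge_cell[OF v(1), of "P 0 6"] nV0 by simp
    moreover have "amap False e c ` {P 0 0, P 0 6} = {P 0 0, P 0 6}"
    proof -
      have "amap False e c (P 0 0) = P 0 c" "amap False e c (P 0 6) = P 0 (6 + c)"
        using v True by (simp_all add: amap_P flip_def)
      moreover have "12 dvd c \<or> 12 dvd c - 6" using c by presburger
      then have "P 0 c = P 0 0 \<and> P 0 (6 + c) = P 0 6 \<or> P 0 c = P 0 6 \<and> P 0 (6 + c) = P 0 0"
      proof
        assume "12 dvd c - 6"
        moreover from this have "12 dvd 6 + c" by presburger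
        ultimately show ?thesis by (simp add: P_eq_iff)
      qed (simp add: P_eq_iff)
      ultimately show ?thesis by auto
    qed
    ultimately show ?thesis unfolding fixes_cell_def by blast
  next
    case False
    obtain k where k: "c = 6 * k" using c by blast
    have v: "valid 0 (3 * k)" unfolding valid_0 by presburger
    then have "amap False e c (P 0 (3 * k)) = P 0 (3 * k)"
      using False e k by (simp add: amap_P flip_def)
    then have "amap False e c ` {P 0 (3 * k)} = {P 0 (3 * k)}" by simp
    then show ?thesis unfolding fixes_cell_def using vertex_cell[OF v] by blast
  qed
qed

lemma ring_cell: "hex j c \<Longrightarrow> set (ringverts j c) \<in> cells G rot"
proof -
  assume h: "hex j c"
  have "dL (P j (c + 1)) \<in> parcs G" using hex_valid(1)[OF h] h by (simp add: darts_in P_VV hex_def)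
  moreover have "fverts (dL (P j (c + 1))) = set (ringverts j c)"
    using ring_orbit[OF h] ring_fst[of j c] by (metis fverts_def list.set_map)
  ultimately show ?thesis unfolding cells_G by blast
qed

text \<open>The site \<open>p\<close> is fixed by the action on the circle. In the middle gap,
  between layers \<open>k - 1\<close> and \<open>k\<close>, there is either a vertical edge at
  \<open>p\<close> or a face centred at \<open>p\<close>, and the symmetry preserves it.\<close>

lemma fixed_cell_even:
  assumes n: "n = 2 * k" and c: "12 dvd e * p + c - p" and a: "admissible True e c"
  shows "fixes_cell (amap True e c)"
proof -
  let ?f = "amap True e c"
  have k: "2 \<le> k" using n n3 by simp
  have kn: "0 < k - 1" "k - 1 < n - 1" "0 < k" "k < n - 1" "k - 1 \<noteq> n - 1" using n k by simp_all
  have fl: "flip True (k - 1) = k" "flip True k = k - 1" unfolding flip_def using n by simp_all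
  have v: "valid (k - 1) i" "valid k i" for i using kn by (auto intro: valid_mid)
  have f: "?f (P (k - 1) i) = P k (e * i + c)" "?f (P k i) = P (k - 1) (e * i + c)" for i
    using v by (simp_all add: amap_P fl)
  have Pc: "P j (e * p + c) = P j p" for j using c by (intro P_cong) (simp add: mod_eq_dvd_iff)
  show ?thesis
  proof (cases "odd (p + (k - 1))")
    case True
    have "nV (P (k - 1) p) = P k p" using True kn by (simp add: nV_P)
    then have "{P (k - 1) p, P k p} \<in> cells G rot"
      using edge_cell[of "P (k - 1) p" "P k p"] v k by (simp add: P_VV)
    moreover have "?f ` {P (k - 1) p, P k p} = {P (k - 1) p, P k p}" by (auto simp: f Pc)
    ultimately show ?thesis unfolding fixes_cell_def by blast
  next
    case False
    then have "even (k - 1 + p)" by presburger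
    then have h: "hex (k - 1) p" using kn by (simp add: hex_def)
    have e: "e = 1 \<or> e = -1" using a by (simp add: admissible_def)
    have "P j (e * (p + 1) + c) = (if e = 1 then P j (p + 1) else P j (p - 1))"
      "P j (e * (p - 1) + c) = (if e = 1 then P j (p - 1) else P j (p + 1))" for j
      using c e by (auto intro!: P_cong simp: mod_eq_dvd_iff algebra_simps)
    then have "?f ` set (ringverts (k - 1) p) = set (ringverts (k - 1) p)"
      using v by (auto simp: ringverts_def f Pc)
    then show ?thesis unfolding fixes_cell_def using ring_cell[OF h] by blast
  qed
qed

text \<open>Now a layer lies in the middle. As \<open>c\<close> is odd, the axis of the half-turn
  passes midway between two sites of this layer and hence through a horizontal edge.\<close>

lemma fixed_cell_odd:
  assumes n: "odd n" and a: "admissible True (-1) c"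
  shows "fixes_cell (amap True (-1) c)"
proof -
  let ?f = "amap True (-1) c"
  obtain k where k: "n = 2 * k + 1" using n by (rule oddE)
  have k1: "1 \<le> k" using k n3 by simp
  have "odd c" using a n unfolding admissible_def by presburger
  then obtain p where p: "c = 2 * p + 1" by (rule oddE)
  have fl: "flip True k = k" and kn: "0 < k" "k < n - 1" unfolding flip_def using k k1 by simp_all
  have v: "valid k i" for i using kn by (rule valid_mid)
  have "nR (P k p) = P k (p + 1)" using k1 v by (simp add: nR_P)
  then have "{P k p, P k (p + 1)} \<in> cells G rot"
    using edge_cell[of "P k p" "P k (p + 1)"] v k1 by (simp add: P_VV)
  moreover have "?f (P k p) = P k (p + 1)" "?f (P k (p + 1)) = P k p"
    using v p by (simp_all add: amap_P fl)
  then have "?f ` {P k p, P k (p + 1)} = {P k p, P k (p + 1)}" by auto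
  ultimately show ?thesis unfolding fixes_cell_def by blast
qed

text \<open>The same criterion decides whether \<open>Mat t e c\<close> fixes a point of the sphere,
  see \<open>fixes_unit_Mat\<close>.\<close>

lemma fixes_cell_amap:
  assumes a: "admissible t e c"
  shows "fixes_cell (amap t e c) \<longleftrightarrow> \<not> t \<or> e = -1 \<or> 12 dvd c"
proof (cases t)
  case False
  then show ?thesis using fixed_cell_False a by simp
next
  case True
  have e: "e = 1 \<or> e = -1" and c: "6 dvd c - n" using a True by (auto simp: admissible_def)
  show ?thesis
  proof (cases "e = 1")
    case e1: True
    show ?thesis
    proof (cases "12 dvd c")
      case 12: True
      then have "even n" using c by presburger
      then obtain k where "n = 2 * k" by blast
      then show ?thesis using fixed_cell_even[of k e 0 c] a e1 True 12 by simp
    next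
      case False
      then show ?thesis using no_fixed_cell[of c] a True e1 by simp
    qed
  next
    case False
    then have e1: "e = -1" using e by simp
    show ?thesis
    proof (cases "even n")
      case even: True
      then obtain k where k: "n = 2 * k" by blast
      have "even c" using c even by presburger
      then obtain p where "c = 2 * p" by blast
      then show ?thesis using fixed_cell_even[OF k, of e p c] a True e1 by simp
    next
      case False
      then show ?thesis using fixed_cell_odd a True e1 by simp
    qed
  qed
qed

end

section \<open>Prismatic point groups\<close>

text \<open>The isometry that corresponds to \<open>amap t e c\<close> when the tube is put along the third axis.\<close>

definition Mat :: "bool \<Rightarrow> int \<Rightarrow> int \<Rightarrow> real^3^3" where
  "Mat t e c = vector [
     vector [of_int e * cos (pi * of_int c / 6), - sin (pi * of_int c / 6), 0],
     vector [of_int e * sin (pi * of_int c / 6), cos (pi * of_int c / 6), 0],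
     vector [0, 0, if t then -1 else 1]]"

text \<open>The composition law of \<open>amap\<close>, now for matrices.\<close>

lemma Mat_mult:
  assumes "e = 1 \<or> e = -1"
  shows "Mat t e c ** Mat t' e' c' = Mat (t \<noteq> t') (e * e') (e * c' + c)"
proof -
  have cs: "cos (pi * of_int (e * c' + c) / 6) = cos (pi * of_int c / 6) * cos (pi * of_int c' / 6)
     - of_int e * sin (pi * of_int c / 6) * sin (pi * of_int c' / 6)"
    "sin (pi * of_int (e * c' + c) / 6) = sin (pi * of_int c / 6) * cos (pi * of_int c' / 6)
     + of_int e * cos (pi * of_int c / 6) * sin (pi * of_int c' / 6)"
    using assms by (auto simp: add_divide_distrib diff_divide_distrib distrib_left right_diff_distrib
      cos_add sin_add cos_diff sin_diff)
  have "of_int e * of_int e = (1::real)" using assms by auto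
  then have ee: "of_int e * (of_int e * x) = x" for x :: real by (metis mult.assoc mult_1)
  show ?thesis
    unfolding Mat_def cs
    by (simp add: vec_eq_iff matrix_matrix_mult_def forall_3 sum_3 algebra_simps ee)
qed

lemma Mat_1: "Mat False 1 0 = mat 1"
  by (simp add: Mat_def vec_eq_iff forall_3 mat_def)

lemma Mat_cong:
  assumes "12 dvd c - c'" shows "Mat t e c = Mat t e c'"
proof -
  obtain k where "c - c' = 12 * k" using assms by blast
  then have "c = c' + 12 * k" by simp
  then have "real_of_int c = of_int c' + 12 * of_int k" by simp
  then have "pi * of_int c / 6 = pi * of_int c' / 6 + 2 * pi * of_int k"
    by (simp add: field_simps)
  then have "sin (pi * of_int c / 6) = sin (pi * of_int c' / 6) \<and> cos (pi * of_int c / 6) = cos (pi * of_int c' / 6)"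
    unfolding sin_cos_eq_iff by blast
  then show ?thesis by (simp add: Mat_def)
qed

lemma Mat_eqD:
  assumes "Mat t e c = Mat t' e' c'" "e = 1 \<or> e = -1" "e' = 1 \<or> e' = -1"
  shows "t = t' \<and> e = e' \<and> 12 dvd c - c'"
proof -
  let ?x = "pi * of_int c / 6" and ?y = "pi * of_int c' / 6"
  have "Mat t e c $ i $ j = Mat t' e' c' $ i $ j" for i j using assms(1) by simp
  from this[of 3 3] this[of 2 2] this[of 1 2] this[of 1 1] this[of 2 1]
  have eq: "(if t then -1 else 1 :: real) = (if t' then -1 else 1)" "cos ?x = cos ?y" "sin ?x = sin ?y"
    "of_int e * cos ?x = of_int e' * cos ?y" "of_int e * sin ?x = of_int e' * sin ?y"
    by (simp_all add: Mat_def)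
  have "t = t'" using eq(1) by (auto split: if_splits)
  moreover have "cos ?y \<noteq> 0 \<or> sin ?y \<noteq> 0" by (metis sin_zero_norm_cos_one norm_zero zero_neq_one)
  then have "real_of_int e = of_int e'" using eq(2-5) by auto
  moreover obtain k :: int where "?x = ?y + 2 * pi * of_int k" using eq(2,3) sin_cos_eq_iff by metis
  then have "pi * (of_int c / 6) = pi * (of_int c' / 6 + 2 * of_int k)"
    by (simp add: distrib_left mult.left_commute)
  then have "real_of_int c / 6 = of_int c' / 6 + 2 * of_int k"
    using mult_left_cancel[OF pi_neq_zero] by blast
  then have "real_of_int c = of_int (c' + 12 * k)" by simp
  then have "c = c' + 12 * k" by (simp only: of_int_eq_iff)
  ultimately show ?thesis by simp
qed

lemma orthogonal_Mat: "e = 1 \<or> e = -1 \<Longrightarrow> orthogonal_matrix (Mat t e c)"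
proof -
  assume e: "e = 1 \<or> e = -1"
  let ?x = "pi * of_int c / 6"
  have sc: "cos ?x * cos ?x + sin ?x * sin ?x = 1" using sin_cos_squared_add[of ?x] by (simp add: power2_eq_square)
  show ?thesis
    using e sc unfolding orthogonal_matrix
    by (auto simp: Mat_def vec_eq_iff forall_3 matrix_matrix_mult_def transpose_def mat_def sum_3)
qed

lemma det_Mat: "det (Mat t e c) = of_int e * (if t then -1 else 1)"
proof -
  let ?x = "pi * of_int c / 6"
  have "cos ?x * cos ?x + sin ?x * sin ?x = 1" using sin_cos_squared_add[of ?x] by (simp add: power2_eq_square)
  then have "of_int e * (cos ?x * cos ?x) + of_int e * (sin ?x * sin ?x) = of_int e"
    by (metis distrib_left mult.right_neutral)
  then show ?thesis by (simp add: Mat_def det_3 algebra_simps)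
qed

section \<open>Fixed points, and generation of the groups\<close>

lemma fixes_unit_iff: "(\<exists>x. norm x = 1 \<and> A *v x = x) \<longleftrightarrow> (\<exists>x. x \<noteq> 0 \<and> A *v x = x)" for A :: "real^3^3"
proof
  assume "\<exists>x. x \<noteq> 0 \<and> A *v x = x"
  then obtain x where "x \<noteq> 0" "A *v x = x" by blast
  then have "norm (inverse (norm x) *\<^sub>R x) = 1 \<and> A *v (inverse (norm x) *\<^sub>R x) = inverse (norm x) *\<^sub>R x"
    by (simp add: matrix_vector_mult_scaleR)
  then show "\<exists>x. norm x = 1 \<and> A *v x = x" by blast
next
  assume "\<exists>x. norm x = 1 \<and> A *v x = x"
  then show "\<exists>x. x \<noteq> 0 \<and> A *v x = x" by (metis norm_zero zero_neq_one)
qed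

text \<open>Without reversal the third axis is fixed, and for \<open>e = -1\<close> with reversal
  the matrix is a half-turn about a horizontal axis. The rest are rotary reflections; they have a
  fixed vector only if the rotation is trivial.\<close>

lemma fixes_unit_Mat:
  assumes e: "e = 1 \<or> e = -1"
  shows "(\<exists>x. norm x = 1 \<and> Mat t e c *v x = x) \<longleftrightarrow> \<not> t \<or> e = -1 \<or> 12 dvd c"
proof -
  let ?x = "pi * of_int c / 6"
  have mv: "Mat t e c *v x = vector [of_int e * cos ?x * x$1 - sin ?x * x$2, of_int e * sin ?x * x$1 + cos ?x * x$2,
     (if t then - x$3 else x$3)]" for x
    by (simp add: Mat_def vec_eq_iff forall_3 matrix_vector_mult_def sum_3)
  have cos1: "cos ?x = 1 \<longleftrightarrow> 12 dvd c"
  proof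
    assume "cos ?x = 1"
    then obtain k :: int where "?x = of_int k * 2 * pi" using cos_one_2pi_int by blast
    then have "pi * (of_int c / 6) = pi * (2 * of_int k)" by (simp add: mult.commute mult.left_commute)
    then have "real_of_int c / 6 = 2 * of_int k" using mult_left_cancel[OF pi_neq_zero] by blast
    then have "real_of_int c = of_int (12 * k)" by simp
    then show "12 dvd c" by (simp only: of_int_eq_iff) simp
  next
    assume "12 dvd c"
    then obtain k where "c = 12 * k" by blast
    then have "?x = of_int k * 2 * pi" by simp
    then show "cos ?x = 1" using cos_one_2pi_int by blast
  qed
  consider "\<not> t" | "t" "e = -1" | "t" "e = 1" using e by blast
  then show ?thesis
  proof cases
    case 1
    have "Mat t e c *v vector [0, 0, 1] = vector [0, 0, 1]" "(vector [0, 0, 1] :: real^3) \<noteq> 0"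
      unfolding mv using 1 by (simp_all add: vec_eq_iff forall_3)
    then show ?thesis using 1 unfolding fixes_unit_iff by blast
  next
    case 2
    \<comment> \<open>Site 0 lies on the second axis. The action \<open>i \<mapsto> c - i\<close> on
      the circle fixes the direction of \<open>c / 2\<close>, hence the half angle.\<close>
    let ?v = "vector [- sin (?x / 2), cos (?x / 2), 0] :: real^3"
    have d: "cos (?x / 2) = cos ?x * cos (?x / 2) + sin ?x * sin (?x / 2)"
      "sin (?x / 2) = sin ?x * cos (?x / 2) - cos ?x * sin (?x / 2)"
      using cos_diff[of ?x "?x / 2"] sin_diff[of ?x "?x / 2"] by (simp_all add: field_simps)
    have "Mat t e c *v ?v = ?v"
      unfolding mv using 2 d by (simp add: vec_eq_iff forall_3)
    moreover have "?v \<noteq> 0"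
    proof
      assume "?v = 0"
      then have "sin (?x / 2) = 0" "cos (?x / 2) = 0" by (simp_all add: vec_eq_iff forall_3)
      then show False by (metis sin_zero_norm_cos_one norm_zero zero_neq_one)
    qed
    ultimately show ?thesis using 2 unfolding fixes_unit_iff by blast
  next
    case 3
    show ?thesis
    proof (cases "12 dvd c")
      case True
      then have "cos ?x = 1" using cos1 by simp
      moreover from this have "sin ?x = 0" using sin_cos_squared_add[of ?x] by simp
      ultimately have "Mat t e c *v vector [1, 0, 0] = vector [1, 0, 0]" "(vector [1, 0, 0] :: real^3) \<noteq> 0"
        unfolding mv using 3 by (simp_all add: vec_eq_iff forall_3)
      then show ?thesis using True unfolding fixes_unit_iff by blast
    next
      case False
      have "x = 0" if "Mat t e c *v x = x" for x :: "real^3"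
      proof -
        from that have x: "cos ?x * x$1 - sin ?x * x$2 = x$1" "sin ?x * x$1 + cos ?x * x$2 = x$2" "- x$3 = x$3"
          unfolding mv using 3 by (simp_all add: vec_eq_iff forall_3)
        \<comment> \<open>Multiplying the two equations by \<open>x$1\<close> and \<open>x$2\<close>
          and adding them eliminates the sine.\<close>
        have "(cos ?x - 1) * (x$1 * x$1 + x$2 * x$2) = 0"
        proof -
          have "(cos ?x - 1) * (x$1 * x$1 + x$2 * x$2) =
            x$1 * (cos ?x * x$1 - sin ?x * x$2 - x$1) + x$2 * (sin ?x * x$1 + cos ?x * x$2 - x$2)"
            by (simp add: algebra_simps)
          then show ?thesis using x by simp
        qed
        then have "x$1 * x$1 + x$2 * x$2 = 0" using cos1 False by simp
        then have "x$1 = 0" "x$2 = 0" by (simp_all add: sum_squares_eq_zero_iff)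
        then show ?thesis using x(3) by (simp add: vec_eq_iff forall_3)
      qed
      then have "\<not> (\<exists>x. x \<noteq> 0 \<and> Mat t e c *v x = x)" by blast
      moreover have "\<not> (\<not> t \<or> e = -1 \<or> 12 dvd c)" using 3 False by simp
      ultimately show ?thesis unfolding fixes_unit_iff by blast
    qed
  qed
qed

lemma group_O3: "group O3"
proof (rule groupI)
  fix A B C assume "A \<in> carrier O3"
  then have "orthogonal_matrix (transpose A)" "transpose A ** A = mat 1"
    by (simp_all add: O3_def orthogonal_matrix_def)
  then show "\<exists>y\<in>carrier O3. y \<otimes>\<^bsub>O3\<^esub> A = \<one>\<^bsub>O3\<^esub>"
    by (intro bexI[of _ "transpose A"]) (simp_all add: O3_def)
qed (auto simp: O3_def orthogonal_matrix_mul orthogonal_matrix_id matrix_mul_assoc)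

text \<open>Only \<open>l\<close> modulo 6 matters: the residue 0 gives \<open>D_2h\<close> and the
  residue 3 gives \<open>D_2d\<close>.\<close>

definition prism_group :: "int \<Rightarrow> (real^3^3) set" where
  "prism_group l = {Mat t e c |t e c. (e = 1 \<or> e = -1) \<and> 6 dvd (if t then c - l else c)}"

lemma subgroup_prism_group:
  assumes "6 dvd 2 * l" shows "subgroup (prism_group l) O3"
proof
  show "prism_group l \<subseteq> carrier O3" by (auto simp: prism_group_def O3_def orthogonal_Mat)
  have "Mat False 1 0 \<in> prism_group l" unfolding prism_group_def by force
  then show "\<one>\<^bsub>O3\<^esub> \<in> prism_group l" by (simp add: O3_def Mat_1)
  fix A assume "A \<in> prism_group l"
  then obtain t e c where A: "A = Mat t e c" and e: "e = 1 \<or> e = -1" and c: "6 dvd (if t then c - l else c)"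
    by (auto simp: prism_group_def)
  have "6 dvd (if t then - e * c - l else - e * c)"
    using e c assms by (elim disjE; cases t; clarsimp; presburger)
  then have B: "Mat t e (- e * c) \<in> prism_group l" using e unfolding prism_group_def by blast
  have "Mat t e (- e * c) ** Mat t e c = Mat False 1 0" using Mat_mult[OF e, of t "- e * c" t e c] e by auto
  then have "inv\<^bsub>O3\<^esub> A = Mat t e (- e * c)"
    using e A by (intro group.inv_equality[OF group_O3]) (auto simp: O3_def orthogonal_Mat Mat_1)
  then show "inv\<^bsub>O3\<^esub> A \<in> prism_group l" using B by simp
  fix B assume "B \<in> prism_group l"
  then obtain t' e' c' where B: "B = Mat t' e' c'" and e': "e' = 1 \<or> e' = -1" and c': "6 dvd (if t' then c' - l else c')"
    by (auto simp: prism_group_def)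
  have "6 dvd (if t \<noteq> t' then (e * c' + c) - l else e * c' + c)"
    using e c c' assms by (elim disjE; cases t; cases t'; clarsimp; presburger)
  moreover have "e * e' = 1 \<or> e * e' = -1" using e e' by auto
  ultimately have "Mat (t \<noteq> t') (e * e') (e * c' + c) \<in> prism_group l" unfolding prism_group_def by blast
  then show "A \<otimes>\<^bsub>O3\<^esub> B \<in> prism_group l" by (simp add: O3_def A B Mat_mult[OF e])
qed

text \<open>A shift by one site is a rotation by 30 degrees. The shifts 6 and 9 belong to half-turns
  about horizontal axes that are 45 degrees apart; they are 0 and 3 modulo 6.\<close>

lemma generators:
  "half_turn (vector [0, 0, 1]) = Mat False 1 6"
  "mirror (vector [1, 0, 0]) = Mat False (-1) 0"
  "half_turn (vector [1, 0, 0]) = Mat True (-1) 6"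
  "half_turn (vector [1, 1, 0]) = Mat True (-1) 9"
proof -
  have 9: "cos (3 * pi / 2) = 0" "sin (3 * pi / 2) = -1"
    using cos_3over2_pi sin_3over2_pi by simp_all
  show "half_turn (vector [0, 0, 1]) = Mat False 1 6"
    "mirror (vector [1, 0, 0]) = Mat False (-1) 0"
    "half_turn (vector [1, 0, 0]) = Mat True (-1) 6"
    "half_turn (vector [1, 1, 0]) = Mat True (-1) 9"
    by (simp_all add: half_turn_def mirror_def Mat_def matrix_def vec_eq_iff forall_3 inner_vec_def sum_3 axis_def 9)
qed

lemma generate_prism_group:
  assumes l: "6 dvd 2 * l" and u: "6 dvd u - l"
  shows "generate O3 (insert (Mat True (-1) u) C_2v) = prism_group l"
proof
  interpret group O3 by (rule group_O3)
  let ?D = "generate O3 (insert (Mat True (-1) u) C_2v)"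
  have sub: "subgroup (prism_group l) O3" using l by (rule subgroup_prism_group)
  have in_prism: "Mat t e c \<in> prism_group l" if "e = 1 \<or> e = -1" "6 dvd (if t then c - l else c)" for t e c
    using that unfolding prism_group_def by blast
  have C2v: "C_2v \<subseteq> prism_group l"
    unfolding C_2v_def generators by (rule generate_subgroup_incl[OF _ sub]) (auto intro!: in_prism)
  then show "?D \<subseteq> prism_group l"
    using u by (intro generate_subgroup_incl[OF _ sub]) (auto intro!: in_prism)
  have C: "Mat False 1 6 \<in> C_2v" "Mat False (-1) 0 \<in> C_2v" "Mat False 1 0 \<in> C_2v"
    unfolding C_2v_def generators using generate.one[of O3]
    by (auto intro: generate.incl simp: O3_def Mat_1)
  have mult: "A ** B \<in> ?D" if "A \<in> ?D" "B \<in> ?D" for A B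
    using generate.eng[OF that] by (simp add: O3_def)
  have F: "Mat False e c \<in> ?D" if "e = 1 \<or> e = -1" "6 dvd c" for e c
  proof -
    have "12 dvd c - 0 \<or> 12 dvd c - 6" using that(2) by presburger
    then have "Mat False 1 c = Mat False 1 0 \<or> Mat False 1 c = Mat False 1 6" using Mat_cong by blast
    then have c: "Mat False 1 c \<in> ?D" using C by (auto intro: generate.incl)
    have "Mat False (-1) 0 \<in> ?D" using C by (auto intro: generate.incl)
    from mult[OF c this] have "Mat False (-1) c \<in> ?D" using Mat_mult[of 1 False c False "-1" 0] by simp
    with c that(1) show ?thesis by auto
  qed
  have T: "Mat True e c \<in> ?D" if "e = 1 \<or> e = -1" "6 dvd c - l" for e c
  proof -
    have "6 dvd u - c" using that(2) u by presburger
    \<comment> \<open>Chosen so that the product with the half-turn \<open>Mat True (-1) u\<close>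
      on its left is \<open>Mat True e c\<close>.\<close>
    then have "Mat False (- e) (u - c) \<in> ?D" using that(1) by (intro F) auto
    moreover have "Mat True (-1) u \<in> ?D" by (auto intro: generate.incl)
    ultimately show ?thesis using mult[of "Mat True (-1) u" "Mat False (- e) (u - c)"] Mat_mult[of "-1" True u False "- e" "u - c"]
      by simp
  qed
  show "prism_group l \<subseteq> ?D"
    using F T by (auto simp: prism_group_def split: if_splits)
qed

lemma D_2h_eq: "6 dvd l \<Longrightarrow> D_2h = prism_group l"
  unfolding D_2h_def generators(3) by (rule generate_prism_group) presburger+

lemma D_2d_eq: "6 dvd l - 3 \<Longrightarrow> D_2d = prism_group l"
  unfolding D_2d_def generators(4) by (rule generate_prism_group) presburger+

context tube
begin

text \<open>Maps and matrices obey the same composition law, have equal parameters modulo 12 when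
  they coincide, and agree in orientation and in the criterion for fixed objects. Only the
  completeness of the list of automorphisms has to be supplied.\<close>

lemma prism_symmetry:
  assumes Aut: "\<And>f. f \<in> Aut \<Longrightarrow> \<exists>t e c. admissible t e c \<and> f = amap t e c"
  shows "has_symmetry_group G rot (prism_group n)"
proof -
  \<comment> \<open>The parameters of \<open>f\<close> are unique except for \<open>c\<close>, which
    is determined modulo 12; this does not affect the matrix.\<close>
  define \<phi> where "\<phi> f = (SOME A. \<exists>t e c. admissible t e c \<and> f = amap t e c \<and> A = Mat t e c)" for f
  have \<phi>: "\<phi> (amap t e c) = Mat t e c" if a: "admissible t e c" for t e c
  proof -
    have "\<exists>t' e' c'. admissible t' e' c' \<and> amap t e c = amap t' e' c' \<and> \<phi> (amap t e c) = Mat t' e' c'"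
      unfolding \<phi>_def by (rule someI_ex) (use a in blast)
    then obtain t' e' c' where *: "admissible t' e' c'" "amap t e c = amap t' e' c'" "\<phi> (amap t e c) = Mat t' e' c'"
      by blast
    have "t = t' \<and> e = e' \<and> 12 dvd c - c'" using amap_eqD[OF a *(1,2)] .
    then show ?thesis using *(3) Mat_cong[of c c' t e] by simp
  qed
  have adm_e: "e = 1 \<or> e = -1" if "admissible t e c" for t e c using that by (simp add: admissible_def)
  have "bij_betw \<phi> Aut (prism_group n)"
    unfolding bij_betw_def
  proof
    show "inj_on \<phi> Aut"
    proof (rule inj_onI)
      fix f g assume "f \<in> Aut" "g \<in> Aut" and eq: "\<phi> f = \<phi> g"
      then obtain t e c t' e' c' where f: "admissible t e c" "f = amap t e c" and g: "admissible t' e' c'" "g = amap t' e' c'"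
        using Aut by meson
      then have "Mat t e c = Mat t' e' c'" using eq \<phi> by simp
      then have "t = t' \<and> e = e' \<and> 12 dvd c - c'" using adm_e f(1) g(1) by (intro Mat_eqD)
      then show "f = g" using f g amap_cong[of c c' t e] by simp
    qed
    show "\<phi> ` Aut = prism_group n"
    proof (intro equalityI subsetI)
      fix A assume "A \<in> \<phi> ` Aut"
      then obtain t e c where "admissible t e c" "A = Mat t e c" using Aut \<phi> by blast
      then show "A \<in> prism_group n" unfolding prism_group_def admissible_def by blast
    next
      fix A assume "A \<in> prism_group n"
      then obtain t e c where "admissible t e c" "A = Mat t e c" unfolding prism_group_def admissible_def by blast
      then show "A \<in> \<phi> ` Aut" using \<phi> amap_Aut by (metis imageI)
    qed
  qed
  moreover have "\<phi> \<in> hom (aut_group G rot) (O3\<lparr>carrier := prism_group n\<rparr>)"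
  proof (rule homI)
    fix f g assume fg: "f \<in> Aut" "g \<in> Aut"
    then show "\<phi> f \<in> carrier (O3\<lparr>carrier := prism_group n\<rparr>)" using calculation by (auto simp: bij_betw_def)
    obtain t e c t' e' c' where f: "admissible t e c" "f = amap t e c" and g: "admissible t' e' c'" "g = amap t' e' c'"
      using Aut fg by meson
    have "\<phi> (f \<circ> g) = \<phi> f ** \<phi> g"
      using amap_comp[OF f(1) g(1)] f g by (simp add: \<phi> Mat_mult[OF adm_e[OF f(1)]])
    then show "\<phi> (f \<otimes>\<^bsub>aut_group G rot\<^esub> g) = \<phi> f \<otimes>\<^bsub>O3\<lparr>carrier := prism_group n\<rparr>\<^esub> \<phi> g"
      by (simp add: aut_group_def O3_def)
  qed
  ultimately have "\<phi> \<in> iso (aut_group G rot) (O3\<lparr>carrier := prism_group n\<rparr>)"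
    by (simp add: iso_def)
  moreover have "(rotation_matrix (\<phi> f) \<longleftrightarrow> orientation_preserving G rot f) \<and>
        ((\<exists>x. norm x = 1 \<and> \<phi> f *v x = x) \<longleftrightarrow> (\<exists>c\<in>cells G rot. f ` c = c))" if "f \<in> Aut" for f
  proof -
    from Aut[OF that] obtain t e c where a: "admissible t e c" and f: "f = amap t e c" by blast
    note e = adm_e[OF a]
    have v: "P 0 0 \<in> VV" by (simp add: P_VV valid_0)
    have "rotation_matrix (Mat t e c) \<longleftrightarrow> (e = 1) \<noteq> t"
      using e by (auto simp: rotation_matrix_def orthogonal_Mat det_Mat)
    moreover have "orientation_preserving G rot f \<longleftrightarrow> (e = 1) \<noteq> t"
      using amap_preserving[OF a] amap_reversing[OF a] preserving_orientation reversing_orientation[OF _ v] f by blast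
    moreover have "(\<exists>x. norm x = 1 \<and> Mat t e c *v x = x) \<longleftrightarrow> (\<exists>c\<in>cells G rot. f ` c = c)"
      using fixes_cell_amap[OF a] fixes_unit_Mat[OF e] f by (simp add: fixes_cell_def)
    ultimately show ?thesis using \<phi>[OF a] f by simp
  qed
  ultimately show ?thesis unfolding has_symmetry_group_def by blast
qed

end

section \<open>Automorphisms of the long tubes\<close>

context facial_cubic
begin

lemma Aut_inv_image: "f \<in> Aut \<Longrightarrow> inv_into UNIV f ` f ` X = X" "f \<in> Aut \<Longrightarrow> f ` inv_into UNIV f ` X = X"
proof -
  assume "f \<in> Aut"
  then have p: "f permutes V" by (rule Aut_permutes)
  show "inv_into UNIV f ` f ` X = X" by (simp add: image_image permutes_inverses[OF p])
  show "f ` inv_into UNIV f ` X = X" by (simp add: image_image permutes_inverses[OF p])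
qed

lemma Aut_face_iff:
  assumes f: "f \<in> Aut" shows "f ` X \<in> fverts ` parcs G \<longleftrightarrow> X \<in> fverts ` parcs G"
proof -
  have *: "g ` Y \<in> fverts ` parcs G" if "g \<in> Aut" "Y \<in> fverts ` parcs G" for g Y
    using that Aut_face[OF that(1)] by blast
  show ?thesis using *[OF f, of X] *[OF Aut_inv[OF f], of "f ` X"] Aut_inv_image(1)[OF f] by metis
qed

end

context tube
begin

definition bottomset :: "int \<Rightarrow> nat set" where
  "bottomset e = {P 0 e, P 0 (e + 1), P 0 (e + 3), P 0 (e + 5), P 0 (e + 6)}"
definition topset :: "int \<Rightarrow> nat set" where
  "topset e = {P (n - 1) e, P (n - 1) (e - 1), P (n - 1) (e - 3), P (n - 1) (e - 5), P (n - 1) (e - 6)}"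

lemma face_sets: "fverts ` parcs G = {set (ringverts j c) |j c. hex j c} \<union> {bottomset e |e. 6 dvd e} \<union> {topset e |e. 6 dvd e - n}"
proof -
  have "fverts ` parcs G = (\<lambda>xs. set (map fst xs)) ` flists"
  proof (intro equalityI subsetI)
    fix X assume "X \<in> fverts ` parcs G"
    then show "X \<in> (\<lambda>xs. set (map fst xs)) ` flists" by (auto elim!: fverts_flist)
  next
    fix X assume "X \<in> (\<lambda>xs. set (map fst xs)) ` flists"
    then obtain xs where "xs \<in> flists" "X = fst ` set xs" by auto
    moreover obtain d where "d \<in> parcs G" "orbit fs d = set xs" using flist_orbit[OF \<open>xs \<in> flists\<close>] by blast
    ultimately show "X \<in> fverts ` parcs G" by (auto simp: fverts_def)
  qed
  moreover have "set (map fst (bottomcap e)) = bottomset e" "set (map fst (topcap e)) = topset e" for e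
    by (auto simp: bottomcap_def bottomset_def topcap_def topset_def)
  moreover have "(\<lambda>xs. set (map fst xs)) ` flists = {set (map fst (ring j c)) |j c. hex j c} \<union>
      {set (map fst (bottomcap e)) |e. 6 dvd e} \<union> {set (map fst (topcap e)) |e. 6 dvd e - n}"
    unfolding flists_def by blast
  ultimately show ?thesis by (simp only: ring_fst)
qed

lemma card_ringverts: "0 \<le> j \<Longrightarrow> card (set (ringverts j c)) = (if valid j c \<and> valid (j + 1) c then 6
    else if valid j c \<or> valid (j + 1) c then 5 else 4)"
  using distinct_card[OF distinct_ringverts[of j c]] by (simp add: ringverts_def)

lemma card_capsets: "card (bottomset e) = 5" "card (topset e) = 5"
  using n3 by (simp_all add: bottomset_def topset_def P_eq_iff)

definition pent :: "nat set \<Rightarrow> bool" where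
  "pent X \<longleftrightarrow> X \<in> fverts ` parcs G \<and> card X = 5"

lemma pent_image: "f \<in> Aut \<Longrightarrow> pent (f ` X) \<longleftrightarrow> pent X"
  by (simp add: pent_def Aut_face_iff Aut_card)

lemma pent_bottom: "6 dvd e \<Longrightarrow> pent (bottomset e)"
  and pent_top: "6 dvd e - n \<Longrightarrow> pent (topset e)"
  unfolding pent_def face_sets by (auto simp: card_capsets)

lemma pent_ring: "hex j c \<Longrightarrow> pent (set (ringverts j c)) \<longleftrightarrow> \<not> (valid j c \<and> valid (j + 1) c)"
proof -
  assume h: "hex j c"
  then have "set (ringverts j c) \<in> fverts ` parcs G" unfolding face_sets by blast
  then show ?thesis using hex_valid(5)[OF h] h by (auto simp: pent_def card_ringverts hex_def)
qed

lemma in_ringverts: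
  assumes "0 \<le> r" "0 \<le> j" "P j i \<in> set (ringverts r c)"
  shows "(j = r \<or> j = r + 1) \<and> (12 dvd i - c \<or> 12 dvd i - c - 1 \<or> 12 dvd i - c + 1)"
  using assms by (auto simp: ringverts_def P_eq_iff algebra_simps split: if_splits)

lemma ringverts_cong: "12 dvd i - c \<Longrightarrow> set (ringverts j i) = set (ringverts j c)"
  using ring_cong[of i c j] by (metis mod_eq_dvd_iff ring_fst)

lemma not_in_caps: "0 < j \<Longrightarrow> j < n - 1 \<Longrightarrow> P j i \<notin> bottomset e" "0 < j \<Longrightarrow> j < n - 1 \<Longrightarrow> P j i \<notin> topset e"
  by (auto simp: bottomset_def topset_def P_eq_iff)

text \<open>
  Pentagons, the vertices lying only on pentagons, and (below) the pentagons all of whose vertices lie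
  on a second pentagon are preserved by every automorphism.  They determine the ends of the tube.
\<close>

definition pentmid :: "nat \<Rightarrow> bool" where
  "pentmid v \<longleftrightarrow> v \<in> VV \<and> (\<forall>X. X \<in> fverts ` parcs G \<and> v \<in> X \<longrightarrow> pent X)"

lemma pentmid_image:
  assumes f: "f \<in> Aut" and v: "pentmid v" shows "pentmid (f v)"
  unfolding pentmid_def
proof (intro conjI allI impI)
  show "f v \<in> VV" using v Aut_permutes[OF f] by (simp add: pentmid_def permutes_in_image)
  fix X assume X: "X \<in> fverts ` parcs G \<and> f v \<in> X"
  let ?Y = "inv_into UNIV f ` X"
  have Y: "f ` ?Y = X" using Aut_inv_image(2)[OF f] .
  then have "?Y \<in> fverts ` parcs G" using Aut_face_iff[OF f, of ?Y] X by simp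
  moreover have "inv_into UNIV f (f v) = v" using Aut_permutes[OF f] by (simp add: permutes_inverses)
  then have "v \<in> ?Y" using X by (metis imageI)
  ultimately have "pent ?Y" using v by (auto simp: pentmid_def)
  then show "pent X" using pent_image[OF f, of ?Y] Y by simp
qed

text \<open>The site lies between the two missing sites 2 and 4: its faces are a cap and the two
  rings centred there, all of them pentagons.\<close>

lemma pentmid_P03: "pentmid (P 0 3)"
  unfolding pentmid_def
proof (intro conjI allI impI)
  show "P 0 3 \<in> VV" by (simp add: P_VV valid_0)
  fix X assume X: "X \<in> fverts ` parcs G \<and> P 0 3 \<in> X"
  then consider j c where "hex j c" "X = set (ringverts j c)" | e where "6 dvd e" "X = bottomset e"
    | e where "6 dvd e - n" "X = topset e" unfolding face_sets by blast
  then show "pent X"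
  proof cases
    case (1 j c)
    then have "j = 0" "12 dvd 3 - c \<or> 12 dvd 2 - c \<or> 12 dvd 4 - c" using X in_ringverts[of j 0 3 c] by (auto simp: hex_def)
    moreover from this have "even c" using 1 by (simp add: hex_def)
    ultimately have "\<not> valid 0 c" unfolding valid_0 by presburger
    then show ?thesis using 1 \<open>j = 0\<close> pent_ring by simp
  qed (use pent_bottom pent_top in auto)
qed

text \<open>The rings centred at the ends of the chord are hexagons, and they contain every vertex
  of the cap except the middle one.\<close>

lemma bottomset_pentmid:
  assumes e: "6 dvd e" and v: "pentmid v" "v \<in> bottomset e" shows "v = P 0 (e + 3)"
proof -
  have h: "hex 0 e" "hex 0 (e + 6)" using e n3 unfolding hex_def by presburger+
  have "valid 0 e" "valid 0 (e + 6)" "valid 1 e" "valid 1 (e + 6)"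
    using e n3 by (simp_all add: valid_0 valid_mid)
  then have np: "\<not> pent (set (ringverts 0 e))" "\<not> pent (set (ringverts 0 (e + 6)))"
    using pent_ring h by simp_all
  have "set (ringverts 0 e) \<in> fverts ` parcs G" "set (ringverts 0 (e + 6)) \<in> fverts ` parcs G"
    using h unfolding face_sets by blast+
  then have "v \<notin> set (ringverts 0 e)" "v \<notin> set (ringverts 0 (e + 6))" using v(1) np by (auto simp: pentmid_def)
  moreover have "P 0 e \<in> set (ringverts 0 e)" "P 0 (e + 1) \<in> set (ringverts 0 e)"
    "P 0 (e + 5) \<in> set (ringverts 0 (e + 6))" "P 0 (e + 6) \<in> set (ringverts 0 (e + 6))"
    using e by (simp_all add: ringverts_def valid_0 add.commute[of "numeral w" e for w])
  ultimately show ?thesis using v(2) by (auto simp: bottomset_def)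
qed

lemma topset_pentmid:
  assumes e: "6 dvd e - n" and v: "pentmid v" "v \<in> topset e" shows "v = P (n - 1) (e - 3)"
proof -
  have h: "hex (n - 2) e" "hex (n - 2) (e - 6)" using e n3 unfolding hex_def by presburger+
  have "valid (n - 1) e" "valid (n - 1) (e - 6)" "valid (n - 2) e" "valid (n - 2) (e - 6)"
    using e n3 by (simp_all add: valid_top valid_mid, presburger)
  moreover have n2: "n - 2 + 1 = n - 1" by simp
  ultimately have np: "\<not> pent (set (ringverts (n - 2) e))" "\<not> pent (set (ringverts (n - 2) (e - 6)))"
    using pent_ring h by simp_all
  have "set (ringverts (n - 2) e) \<in> fverts ` parcs G" "set (ringverts (n - 2) (e - 6)) \<in> fverts ` parcs G"
    using h unfolding face_sets by blast+
  then have "v \<notin> set (ringverts (n - 2) e)" "v \<notin> set (ringverts (n - 2) (e - 6))" using v(1) np by (auto simp: pentmid_def)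
  moreover have "P (n - 1) e \<in> set (ringverts (n - 2) e)" "P (n - 1) (e - 1) \<in> set (ringverts (n - 2) e)"
    "P (n - 1) (e - 5) \<in> set (ringverts (n - 2) (e - 6))" "P (n - 1) (e - 6) \<in> set (ringverts (n - 2) (e - 6))"
    using \<open>valid (n - 1) e\<close> \<open>valid (n - 1) (e - 6)\<close> by (simp_all add: ringverts_def n2)
  ultimately show ?thesis using v(2) by (auto simp: topset_def)
qed

text \<open>With the vertical neighbour of \<open>P 0 3\<close> sent to a vertical neighbour, only
  the order of the two horizontal ones is open. One map with \<open>e = 1\<close> and one with
  \<open>e = -1\<close> realise both orders, and rigidity does the rest.\<close>

lemma Aut_amapI:
  assumes f: "f \<in> Aut" and a: "admissible t 1 c" "admissible t (-1) c'"
    and b: "f (P 0 3) = amap t 1 c (P 0 3)" "f (P 0 3) = amap t (-1) c' (P 0 3)"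
    and V: "f (nV (P 0 3)) = nV (f (P 0 3))"
  shows "f = amap t 1 c \<or> f = amap t (-1) c'"
proof -
  have bV: "P 0 3 \<in> VV" by (simp add: P_VV valid_0)
  let ?b = "P 0 3"
  have fb: "f ?b \<in> VV" using Aut_permutes[OF f] bV by (simp add: permutes_in_image)
  have N: "f (nR ?b) \<in> {nR (f ?b), nL (f ?b), nV (f ?b)}" "f (nL ?b) \<in> {nR (f ?b), nL (f ?b), nV (f ?b)}"
    using Aut_edge[OF f bV] by (auto simp: N_eq)
  have inj: "f x = f y \<longleftrightarrow> x = y" for x y using Aut_permutes[OF f] by (simp add: permutes_inj inj_eq)
  have d: "nR ?b \<noteq> nL ?b" "nR ?b \<noteq> nV ?b" "nL ?b \<noteq> nV ?b" using distinct_nbrs[OF bV] by auto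
  have "f (nR ?b) \<noteq> nV (f ?b)" "f (nL ?b) \<noteq> nV (f ?b)" "f (nR ?b) \<noteq> f (nL ?b)"
    using d by (simp_all add: inj flip: V)
  then consider "f (nR ?b) = nR (f ?b)" "f (nL ?b) = nL (f ?b)" | "f (nR ?b) = nL (f ?b)" "f (nL ?b) = nR (f ?b)"
    using N by auto
  then show ?thesis
  proof cases
    case 1
    have "f u = amap t 1 c u" if "u \<in> N ?b" for u
      using that 1 V amap_nbrs[OF a(1) bV] b(1) by (auto simp: N_eq)
    then show ?thesis using Aut_eqI[OF f amap_Aut[OF a(1)] bV b(1)] by blast
  next
    case 2
    have "f u = amap t (-1) c' u" if "u \<in> N ?b" for u
      using that 2 V amap_nbrs[OF a(2) bV] b(2) by (auto simp: N_eq)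
    then show ?thesis using Aut_eqI[OF f amap_Aut[OF a(2)] bV b(2)] by blast
  qed
qed

section \<open>Recognising the caps among the pentagons\<close>

definition capface :: "nat set \<Rightarrow> bool" where
  "capface X \<longleftrightarrow> pent X \<and> (\<forall>v\<in>X. \<exists>Y. pent Y \<and> Y \<noteq> X \<and> v \<in> Y)"

lemma capface_image:
  assumes f: "f \<in> Aut" and X: "capface X" shows "capface (f ` X)"
  unfolding capface_def
proof (intro conjI ballI)
  show "pent (f ` X)" using X pent_image[OF f] by (simp add: capface_def)
  fix w assume "w \<in> f ` X"
  then obtain v where v: "v \<in> X" "w = f v" by blast
  then obtain Y where "pent Y" "Y \<noteq> X" "v \<in> Y" using X by (auto simp: capface_def)
  then have "pent (f ` Y)" "f ` Y \<noteq> f ` X" "w \<in> f ` Y"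
    using v pent_image[OF f] permutes_inj[OF Aut_permutes[OF f]] by (auto simp: inj_image_eq_iff)
  then show "\<exists>Y. pent Y \<and> Y \<noteq> f ` X \<and> w \<in> Y" by blast
qed

lemma capface_bottom: "capface (bottomset 0)"
proof -
  have h: "hex 0 2" "hex 0 4" using n3 by (simp_all add: hex_def)
  then have p: "pent (set (ringverts 0 2))" "pent (set (ringverts 0 4))" "pent (bottomset 6)" "pent (bottomset 0)"
    using pent_ring pent_bottom by (simp_all add: valid_0)
  have P12: "P 0 12 = P 0 0" using P_12[of 0 0] by simp
  have m: "P 0 0 \<in> bottomset 6" "P 0 1 \<in> set (ringverts 0 2)" "P 0 3 \<in> set (ringverts 0 2)"
    "P 0 5 \<in> set (ringverts 0 4)" "P 0 6 \<in> bottomset 6"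
    by (simp_all add: ringverts_def bottomset_def P12)
  have "P 1 1 \<in> set (ringverts 0 2)" "P 1 3 \<in> set (ringverts 0 4)" "P 0 7 \<in> bottomset 6"
    "P 1 1 \<notin> bottomset 0" "P 1 3 \<notin> bottomset 0" "P 0 7 \<notin> bottomset 0"
    by (simp_all add: ringverts_def bottomset_def P_eq_iff)
  then have ne: "set (ringverts 0 2) \<noteq> bottomset 0" "set (ringverts 0 4) \<noteq> bottomset 0" "bottomset 6 \<noteq> bottomset 0"
    by blast+
  show ?thesis
    unfolding capface_def
  proof (intro conjI ballI p)
    fix v assume "v \<in> bottomset 0"
    then have "v \<in> {P 0 0, P 0 1, P 0 3, P 0 5, P 0 6}" by (simp add: bottomset_def)
    then show "\<exists>Y. pent Y \<and> Y \<noteq> bottomset 0 \<and> v \<in> Y" using p m ne by blast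
  qed
qed

text \<open>A pentagon between two layers lacks its central site in an end layer. Its central vertex
  \<open>P k c\<close> in the other layer lies on no second pentagon, because for
  \<open>n \<ge> 6\<close> the faces beyond that layer are hexagons. For \<open>n = 3\<close> the
  middle layer would border on both ends.\<close>

lemma capface_cases:
  assumes n: "6 \<le> n" and X: "capface X"
  shows "(\<exists>e. 6 dvd e \<and> X = bottomset e) \<or> (\<exists>e. 6 dvd e - n \<and> X = topset e)"
proof (rule ccontr)
  assume "\<not> ?thesis"
  moreover have "X \<in> fverts ` parcs G" using X by (simp add: capface_def pent_def)
  ultimately obtain j c where h: "hex j c" and Xr: "X = set (ringverts j c)" unfolding face_sets by blast
  have j: "0 \<le> j" "j < n - 1" "even (j + c)" using h by (auto simp: hex_def)
  have inv: "\<not> valid j c \<or> \<not> valid (j + 1) c" using X pent_ring[OF h] Xr by (auto simp: capface_def)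
  define k where "k = (if valid j c then j else j + 1)"
  have k: "valid k c" "P k c \<in> X" "0 < k" "k < n - 1" "k = 1 \<or> k = n - 2"
    using inv hex_valid(5)[OF h] j n unfolding k_def Xr ringverts_def
    by (auto simp: valid_def split: if_splits)
  have "Y = X" if Y: "pent Y" "P k c \<in> Y" for Y
  proof -
    have "Y \<in> fverts ` parcs G" using Y(1) by (simp add: pent_def)
    then obtain j' c' where h': "hex j' c'" and Yr: "Y = set (ringverts j' c')"
      using not_in_caps[OF k(3,4)] Y(2) unfolding face_sets by blast
    have j': "0 \<le> j'" "j' < n - 1" "even (j' + c')" using h' by (auto simp: hex_def)
    have inv': "\<not> valid j' c' \<or> \<not> valid (j' + 1) c'" using Y pent_ring[OF h'] Yr by auto
    have jj: "k = j' \<or> k = j' + 1" and cc: "12 dvd c - c' \<or> 12 dvd c - c' - 1 \<or> 12 dvd c - c' + 1"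
      using in_ringverts[of j' k c c'] j' k(3) Y(2) Yr by auto
    have "j' = 0 \<or> j' = n - 2" using inv' j' valid_mid[of j' c'] valid_mid[of "j' + 1" c'] by force
    moreover have "j = 0 \<or> j = n - 2" using inv j valid_mid[of j c] valid_mid[of "j + 1" c] by force
    ultimately have "j' = j" using jj k(5) n inv unfolding k_def by (auto simp: valid_def split: if_splits)
    moreover from this have "12 dvd c - c'" using cc j(3) j'(3) by presburger
    ultimately show ?thesis using ringverts_cong[of c c' j] Xr Yr by simp
  qed
  then show False using X k(2) unfolding capface_def by blast
qed

lemma Aut_amap:
  assumes n: "6 \<le> n" and f: "f \<in> Aut"
  shows "\<exists>t e c. admissible t e c \<and> f = amap t e c"
proof -
  let ?b = "P 0 3"
  have v: "valid 0 3" by (simp add: valid_0)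
  have bV: "?b \<in> VV" using v by (simp add: P_VV)
  have X: "capface (f ` bottomset 0)" using capface_image[OF f capface_bottom] .
  have b: "f ?b \<in> f ` bottomset 0" by (simp add: bottomset_def)
  have mid: "pentmid (f ?b)" using pentmid_image[OF f pentmid_P03] .
  have nVb: "nV ?b = P 1 3" using n by (simp add: nV_P)
  have "nV ?b \<notin> bottomset 0" unfolding nVb using not_in_caps(1)[of 1] n by simp
  \<comment> \<open>The vertical neighbour is the only neighbour of \<open>P 0 3\<close> outside the
    cap, a property that passes to the image.\<close>
  then have Vn: "f (nV ?b) \<notin> f ` bottomset 0"
    using permutes_inj[OF Aut_permutes[OF f]] by (simp add: inj_image_mem_iff)
  have VN: "f (nV ?b) \<in> {nR (f ?b), nL (f ?b), nV (f ?b)}"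
    using Aut_edge[OF f bV, of "nV ?b"] by (auto simp: N_eq)
  from capface_cases[OF n X] show ?thesis
  proof
    assume "\<exists>e. 6 dvd e \<and> f ` bottomset 0 = bottomset e"
    then obtain e where e: "6 dvd e" "f ` bottomset 0 = bottomset e" by blast
    have fb: "f ?b = P 0 (e + 3)" using bottomset_pentmid[OF e(1) mid] b e(2) by simp
    have iv: "\<not> valid 0 (e + 3 - 1)" "\<not> valid 0 (e + 3 + 1)" using e(1) unfolding valid_0 by presburger+
    have e5: "e + 3 + 2 = e + 5" "e + 3 - 2 = e + 1" by simp_all
    have "nR (f ?b) = P 0 (e + 5)" "nL (f ?b) = P 0 (e + 1)"
      by (simp_all only: fb nR_P[OF order_refl] nL_P[OF order_refl] iv if_False e5)
    then have "nR (f ?b) \<in> bottomset e" "nL (f ?b) \<in> bottomset e" by (simp_all add: bottomset_def)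
    then have V: "f (nV ?b) = nV (f ?b)" using VN Vn e(2) by auto
    \<comment> \<open>The shifts make the rotation and the reflection send site 3 to
      \<open>e + 3\<close>.\<close>
    have a: "admissible False 1 e" "admissible False (-1) (e + 6)" using e(1) by (auto simp: admissible_def)
    have "f ?b = amap False 1 e ?b" "f ?b = amap False (-1) (e + 6) ?b"
      using v by (simp_all add: amap_P flip_def fb add.commute[of "numeral w" e for w])
    then show ?thesis using Aut_amapI[OF f a _ _ V] a by blast
  next
    assume "\<exists>e. 6 dvd e - n \<and> f ` bottomset 0 = topset e"
    then obtain e where e: "6 dvd e - n" "f ` bottomset 0 = topset e" by blast
    have fb: "f ?b = P (n - 1) (e - 3)" using topset_pentmid[OF e(1) mid] b e(2) by simp
    have iv: "\<not> valid (n - 1) (e - 3 + 1)" "\<not> valid (n - 1) (e - 3 - 1)" using e(1) unfolding valid_top by presburger+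
    have e5: "e - 3 + 2 = e - 1" "e - 3 - 2 = e - 5" by simp_all
    have "0 \<le> n - 1" using n by simp
    then have "nR (f ?b) = P (n - 1) (e - 1)" "nL (f ?b) = P (n - 1) (e - 5)"
      by (simp_all only: fb nR_P nL_P iv if_False e5)
    then have "nR (f ?b) \<in> topset e" "nL (f ?b) \<in> topset e" by (simp_all add: topset_def)
    then have V: "f (nV ?b) = nV (f ?b)" using VN Vn e(2) by auto
    have "6 dvd e - 6 - n" using e(1) by presburger
    \<comment> \<open>Here site 3 has to go to \<open>e - 3\<close>.\<close>
    then have a: "admissible True 1 (e - 6)" "admissible True (-1) e" using e(1) by (simp_all add: admissible_def)
    have "f ?b = amap True 1 (e - 6) ?b" "f ?b = amap True (-1) e ?b"
      using v by (simp_all add: amap_P flip_def fb)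
    then show ?thesis using Aut_amapI[OF f a _ _ V] a by blast
  qed
qed

lemma symmetry_D_2h: "6 \<le> n \<Longrightarrow> even n \<Longrightarrow> has_symmetry_group G rot D_2h"
  and symmetry_D_2d: "6 \<le> n \<Longrightarrow> odd n \<Longrightarrow> has_symmetry_group G rot D_2d"
proof -
  assume n: "6 \<le> n"
  have s: "has_symmetry_group G rot (prism_group n)" using Aut_amap[OF n] by (intro prism_symmetry)
  show "has_symmetry_group G rot D_2h" if "even n"
  proof -
    have "6 dvd n" using dvd_n that by presburger
    then show ?thesis using s D_2h_eq by simp
  qed
  show "has_symmetry_group G rot D_2d" if "odd n"
  proof -
    have "6 dvd n - 3" using dvd_n that by presburger
    then show ?thesis using s D_2d_eq by simp
  qed
qed

end

section \<open>The group of the tetrahedron\<close>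

text \<open>
  In the tube with three layers the numbers 3, 9, 24, 30 are the vertices \<open>P 0 3\<close>, \<open>P 0 9\<close>, \<open>P 2 0\<close>,
  \<open>P 2 6\<close>, where three pentagons meet.  Every automorphism permutes them, and \<open>apex\<close> identifies them
  with the vertices of the tetrahedron.
\<close>

definition apexes :: "nat set" where "apexes = {3, 9, 24, 30}"

definition apex :: "nat \<Rightarrow> real^3" where
  "apex v = (if v = 3 then vector [1, 1, 1] else if v = 9 then vector [1, -1, -1]
     else if v = 24 then vector [-1, 1, -1] else vector [-1, -1, 1])"

lemma apex_simps [simp]: "apex 3 = vector [1, 1, 1]" "apex 9 = vector [1, -1, -1]"
  "apex 24 = vector [-1, 1, -1]" "apex 30 = vector [-1, -1, 1]"
  by (simp_all add: apex_def)

lemma tetrahedron_eq: "tetrahedron = convex hull (apex ` apexes)"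
  by (simp add: tetrahedron_def apexes_def)

lemma sum_apexes: "(\<Sum>b\<in>apexes. f b) = f 3 + f 9 + f 24 + f 30" for f :: "nat \<Rightarrow> 'a::ab_group_add"
  by (simp add: apexes_def algebra_simps)

lemma finite_apexes: "finite apexes"
  by (simp add: apexes_def)

lemma inner_apex: "b \<in> apexes \<Longrightarrow> c \<in> apexes \<Longrightarrow> apex b \<bullet> apex c = (if b = c then 3 else -1)"
  by (auto simp: apexes_def inner_vec_def sum_3)

lemma inj_apex: "inj_on apex apexes"
  by (auto simp: apexes_def inj_on_def vec_eq_iff forall_3)

text \<open>The four vectors form a tight frame: the sum of their outer products is four times the
  identity.\<close>

lemma apex_expansion: "x = (\<Sum>b\<in>apexes. (x \<bullet> apex b / 4) *\<^sub>R apex b)"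
  unfolding sum_apexes by (simp add: vec_eq_iff forall_3 inner_vec_def sum_3) (simp add: field_simps)

lemma apex_inner_eqI: "(\<And>b. b \<in> apexes \<Longrightarrow> x \<bullet> apex b = y \<bullet> apex b) \<Longrightarrow> x = y"
  using apex_expansion[of x] apex_expansion[of y] by (metis (no_types, lifting) sum.cong)

lemma apex_matrix_eqI:
  fixes A A' :: "real^3^3"
  assumes "\<And>b. b \<in> apexes \<Longrightarrow> A *v apex b = A' *v apex b" shows "A = A'"
proof -
  have "A *v x = A' *v x" for x
  proof -
    have "A *v x = (\<Sum>b\<in>apexes. (x \<bullet> apex b / 4) *\<^sub>R (A *v apex b))" for A :: "real^3^3"
      by (subst apex_expansion[of x]) (simp add: matrix_vector_right_distrib sum_apexes matrix_vector_mult_scaleR)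
    then show ?thesis using assms by simp
  qed
  then show ?thesis by (simp add: matrix_eq)
qed

text \<open>The frame expansion with the vectors permuted by \<open>\<sigma>\<close>. As the four
  vectors have sum zero, this is the linear map that permutes them accordingly.\<close>

definition apex_matrix :: "(nat \<Rightarrow> nat) \<Rightarrow> real^3^3" where
  "apex_matrix \<sigma> = (\<chi> i j. (\<Sum>b\<in>apexes. apex b $ j * apex (\<sigma> b) $ i) / 4)"

lemma apex_matrix_mult:
  "apex_matrix \<sigma> *v x = (\<Sum>b\<in>apexes. (x \<bullet> apex b / 4) *\<^sub>R apex (\<sigma> b))"
  unfolding sum_apexes apex_matrix_def
  by (simp add: vec_eq_iff matrix_vector_mult_def inner_vec_def sum_3) (simp add: field_simps)

text \<open>Inner products are 3 and -1. Writing 3/4 as 1 - 1/4 leaves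
  \<open>apex (\<sigma> b)\<close> minus a quarter of the sum of all four vectors, which is
  zero.\<close>

lemma apex_matrix_apex:
  assumes \<sigma>: "bij_betw \<sigma> apexes apexes" and b: "b \<in> apexes"
  shows "apex_matrix \<sigma> *v apex b = apex (\<sigma> b)"
proof -
  have "(\<Sum>c\<in>apexes. apex (\<sigma> c)) = (\<Sum>c\<in>apexes. apex c)"
    using sum.reindex_bij_betw[OF \<sigma>, of apex] .
  also have "\<dots> = 0" unfolding sum_apexes by (simp add: vec_eq_iff forall_3)
  finally have 0: "(\<Sum>c\<in>apexes. apex (\<sigma> c)) = 0" .
  have q: "(3 / 4) *\<^sub>R y = y - (1 / 4) *\<^sub>R y" for y :: "real^3" by (simp add: vec_eq_iff)
  have "apex_matrix \<sigma> *v apex b = (\<Sum>c\<in>apexes. (if c = b then apex (\<sigma> c) else 0) - (1/4) *\<^sub>R apex (\<sigma> c))"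
    unfolding apex_matrix_mult using b by (intro sum.cong) (auto simp: inner_apex q)
  also have "\<dots> = apex (\<sigma> b)"
    using b 0 finite_apexes by (simp add: sum_subtractf sum.delta flip: scaleR_sum_right)
  finally show ?thesis .
qed

lemma apex_matrix_orthogonal:
  assumes \<sigma>: "bij_betw \<sigma> apexes apexes"
  shows "orthogonal_matrix (apex_matrix \<sigma>)"
proof -
  let ?A = "apex_matrix \<sigma>"
  have "transpose ?A ** ?A = mat 1"
  proof (rule apex_matrix_eqI)
    fix b assume b: "b \<in> apexes"
    have "(transpose ?A *v (?A *v apex b)) \<bullet> apex c = apex b \<bullet> apex c" if c: "c \<in> apexes" for c
    proof -
      have "\<sigma> b \<in> apexes" "\<sigma> c \<in> apexes" "\<sigma> b = \<sigma> c \<longleftrightarrow> b = c"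
        using \<sigma> b c by (auto simp: bij_betw_def inj_on_def)
      moreover have "(transpose ?A *v (?A *v apex b)) \<bullet> apex c = (?A *v apex b) \<bullet> (?A *v apex c)"
        by (simp add: dot_lmul_matrix)
      ultimately show ?thesis using b c by (simp add: apex_matrix_apex[OF \<sigma>] inner_apex)
    qed
    then show "transpose ?A ** ?A *v apex b = mat 1 *v apex b"
      by (simp only: apex_inner_eqI matrix_vector_mul_lid flip: matrix_vector_mul_assoc)
  qed
  then show ?thesis by (simp add: orthogonal_matrix)
qed

lemma apex_matrix_comp:
  assumes "bij_betw \<sigma> apexes apexes" "bij_betw \<tau> apexes apexes"
  shows "apex_matrix (\<sigma> \<circ> \<tau>) = apex_matrix \<sigma> ** apex_matrix \<tau>"
proof (rule apex_matrix_eqI)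
  fix b assume "b \<in> apexes"
  moreover from this have "\<tau> b \<in> apexes" using assms(2) by (auto simp: bij_betw_def)
  ultimately show "apex_matrix (\<sigma> \<circ> \<tau>) *v apex b = apex_matrix \<sigma> ** apex_matrix \<tau> *v apex b"
    using apex_matrix_apex[OF bij_betw_trans[OF assms(2,1)]]
    by (simp add: apex_matrix_apex assms flip: matrix_vector_mul_assoc)
qed

lemma apex_matrix_eqD:
  assumes "bij_betw \<sigma> apexes apexes" "bij_betw \<tau> apexes apexes" "apex_matrix \<sigma> = apex_matrix \<tau>" "b \<in> apexes"
  shows "\<sigma> b = \<tau> b"
proof -
  have "apex (\<sigma> b) = apex (\<tau> b)" using apex_matrix_apex assms by metis
  moreover have "\<sigma> b \<in> apexes" "\<tau> b \<in> apexes" using assms by (auto simp: bij_betw_def)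
  ultimately show ?thesis using inj_apex by (simp add: inj_on_eq_iff)
qed

lemma apex_matrix_T_d:
  assumes \<sigma>: "bij_betw \<sigma> apexes apexes" shows "apex_matrix \<sigma> \<in> T_d"
proof -
  have "(*v) (apex_matrix \<sigma>) ` tetrahedron = convex hull ((*v) (apex_matrix \<sigma>) ` apex ` apexes)"
    unfolding tetrahedron_eq by (rule convex_hull_linear_image[OF matrix_vector_mul_linear])
  also have "(*v) (apex_matrix \<sigma>) ` apex ` apexes = apex ` \<sigma> ` apexes"
    unfolding image_image by (intro image_cong refl) (rule apex_matrix_apex[OF \<sigma>])
  also have "\<sigma> ` apexes = apexes" using \<sigma> by (simp add: bij_betw_def)
  finally show ?thesis using apex_matrix_orthogonal[OF \<sigma>] by (simp add: T_d_def tetrahedron_eq)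
qed

text \<open>The vertices are the only points of the tetrahedron on the circumscribed sphere.\<close>

lemma tetrahedron_vertex:
  assumes "x \<in> tetrahedron" "x \<bullet> x = 3" shows "x \<in> apex ` apexes"
proof -
  obtain u where u: "\<And>v. v \<in> apex ` apexes \<Longrightarrow> 0 \<le> u v" "sum u (apex ` apexes) = 1"
    "(\<Sum>v\<in>apex ` apexes. u v *\<^sub>R v) = x"
    using assms(1) finite_apexes unfolding tetrahedron_eq by (auto simp: convex_hull_finite)
  have v3: "v \<bullet> v = 3" if "v \<in> apex ` apexes" for v using that by (auto simp: inner_apex)
  \<comment> \<open>All points in question have squared norm 3, so \<open>3 - v \<bullet> x\<close>
    is non-negative and vanishes only for \<open>v = x\<close>. Its average with the convex weights
    is zero, so a vertex of positive weight equals \<open>x\<close>.\<close>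
  have d: "(v - x) \<bullet> (v - x) = 2 * (3 - v \<bullet> x)" if "v \<in> apex ` apexes" for v
    using v3[OF that] assms(2) by (simp add: inner_diff_left inner_diff_right inner_commute)
  then have nonneg: "0 \<le> u v * (3 - v \<bullet> x)" if "v \<in> apex ` apexes" for v
    using u(1)[OF that] inner_ge_zero[of "v - x"] that by (metis mult_nonneg_nonneg zero_le_mult_iff zero_less_numeral not_le)
  have "(\<Sum>v\<in>apex ` apexes. u v * (3 - v \<bullet> x)) = 3 * sum u (apex ` apexes) - (\<Sum>v\<in>apex ` apexes. u v *\<^sub>R v) \<bullet> x"
    by (simp add: right_diff_distrib sum_subtractf inner_sum_left sum_distrib_left mult.commute)
  then have "(\<Sum>v\<in>apex ` apexes. u v * (3 - v \<bullet> x)) = 0" using u assms(2) by simp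
  then have zero: "u v * (3 - v \<bullet> x) = 0" if "v \<in> apex ` apexes" for v
    using sum_nonneg_eq_0_iff[of "apex ` apexes" "\<lambda>v. u v * (3 - v \<bullet> x)"] nonneg finite_apexes that by auto
  obtain v where v: "v \<in> apex ` apexes" "u v \<noteq> 0" using u(2) by (metis sum.neutral zero_neq_one)
  then have "v \<bullet> x = 3" using zero[OF v(1)] by simp
  then have "v = x" using d[OF v(1)] by simp
  then show ?thesis using v(1) by simp
qed

text \<open>An isometry of the tetrahedron keeps norms and hence permutes the vertices, the only
  points of the tetrahedron of squared norm 3.\<close>

lemma T_d_apex_matrix:
  assumes "A \<in> T_d" obtains \<sigma> where "bij_betw \<sigma> apexes apexes" "A = apex_matrix \<sigma>"
proof -
  have A: "orthogonal_transformation ((*v) A)" "(*v) A ` tetrahedron = tetrahedron"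
    using assms by (auto simp: T_d_def orthogonal_transformation_matrix)
  have "\<exists>c\<in>apexes. A *v apex b = apex c" if b: "b \<in> apexes" for b
  proof -
    have "apex b \<in> tetrahedron" unfolding tetrahedron_eq using b by (simp add: hull_inc)
    then have "A *v apex b \<in> tetrahedron" using A(2) by blast
    moreover have "(A *v apex b) \<bullet> (A *v apex b) = 3"
      using A(1) b by (simp add: orthogonal_transformation_def inner_apex)
    ultimately show ?thesis using tetrahedron_vertex by blast
  qed
  then obtain \<sigma> where \<sigma>: "\<And>b. b \<in> apexes \<Longrightarrow> \<sigma> b \<in> apexes \<and> A *v apex b = apex (\<sigma> b)" by metis
  have "inj_on \<sigma> apexes"
  proof (rule inj_onI)
    fix b c assume "b \<in> apexes" "c \<in> apexes" "\<sigma> b = \<sigma> c"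
    then have "A *v apex b = A *v apex c" using \<sigma> by simp
    then have "apex b = apex c" using orthogonal_transformation_inj[OF A(1)] by (simp add: inj_eq)
    then show "b = c" using inj_apex \<open>b \<in> apexes\<close> \<open>c \<in> apexes\<close> by (simp add: inj_on_eq_iff)
  qed
  moreover have "\<sigma> ` apexes \<subseteq> apexes" using \<sigma> by auto
  ultimately have bij: "bij_betw \<sigma> apexes apexes"
    using finite_apexes by (simp add: bij_betw_def endo_inj_surj)
  then have "A = apex_matrix \<sigma>" using \<sigma> by (intro apex_matrix_eqI) (simp add: apex_matrix_apex)
  with bij show ?thesis by (rule that)
qed

section \<open>The tube with three layers\<close>

context cubic_rotation
begin

lemma fixes_cell_conj:
  assumes h: "h \<in> Aut" and g: "g \<in> Aut" and eq: "h \<circ> f = g \<circ> h"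
    and f: "\<exists>c\<in>cells G rot. f ` c = c"
  shows "\<exists>c\<in>cells G rot. g ` c = c"
proof -
  obtain c where c: "c \<in> cells G rot" "f ` c = c" using f by blast
  have "g ` h ` c = h ` f ` c" using eq by (metis image_comp)
  then show ?thesis using c Aut_cell[OF h c(1)] by metis
qed

end

locale tube3 = tube 3
begin

section \<open>Explicit tables for the tube with 28 vertices\<close>

definition verts3 :: "nat list" where
  "verts3 = [0, 1, 3, 5, 6, 7, 9, 11, 12, 13, 14, 15, 16, 17, 18, 19, 20, 21, 22, 23, 24, 26, 27, 28, 30, 32, 33, 34]"

text \<open>One inclusion is checked entry by entry; the known number of vertices forces
  equality.\<close>

lemma VV_eq: "VV = set verts3"
proof (rule card_subset_eq[symmetric])
  show "finite VV" by (rule finite_VV)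
  have "P (lay v) (pos v) = v" for v by (simp add: P_def lay_def pos_def)
  moreover have "\<forall>v\<in>set verts3. valid (lay v) (pos v)"
    by (simp add: verts3_def lay_def pos_def valid_def)
  ultimately show "set verts3 \<subseteq> VV" unfolding VV_def by (metis (mono_tags, lifting) mem_Collect_eq subsetI)
  show "card (set verts3) = card VV" using card_VV by (simp add: verts3_def)
qed

lemma table_na:
  "na 0 = 11" "na (Suc 0) = 3" "na 3 = 5" "na 5 = 6" "na 6 = 5" "na 7 = 9" "na 9 = 11" "na 11 = 0"
  "na 12 = 13" "na 13 = 12" "na 14 = 15" "na 15 = 14" "na 16 = 17" "na 17 = 16" "na 18 = 19" "na 19 = 18"
  "na 20 = 21" "na 21 = 20" "na 22 = 23" "na 23 = 22" "na 24 = 34" "na 26 = 24" "na 27 = 28" "na 28 = 27"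
  "na 30 = 28" "na 32 = 30" "na 33 = 34" "na 34 = 33"
  by (simp_all add: na_def nR_def nL_def up_def lay_def pos_def valid_def P_def)

lemma table_nV:
  "nV 0 = 6" "nV (Suc 0) = 13" "nV 3 = 15" "nV 5 = 17" "nV 6 = 0" "nV 7 = 19" "nV 9 = 21" "nV 11 = 23"
  "nV 12 = 24" "nV 13 = 1" "nV 14 = 26" "nV 15 = 3" "nV 16 = 28" "nV 17 = 5" "nV 18 = 30" "nV 19 = 7"
  "nV 20 = 32" "nV 21 = 9" "nV 22 = 34" "nV 23 = 11" "nV 24 = 12" "nV 26 = 14" "nV 27 = 33" "nV 28 = 16"
  "nV 30 = 18" "nV 32 = 20" "nV 33 = 27" "nV 34 = 22"
  by (simp_all add: nV_def up_def lay_def pos_def P_def)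

lemma table_nc:
  "nc 0 = 1" "nc (Suc 0) = 0" "nc 3 = 1" "nc 5 = 3" "nc 6 = 7" "nc 7 = 6" "nc 9 = 7" "nc 11 = 9" "nc 12 = 23"
  "nc 13 = 14" "nc 14 = 13" "nc 15 = 16" "nc 16 = 15" "nc 17 = 18" "nc 18 = 17" "nc 19 = 20" "nc 20 = 19"
  "nc 21 = 22" "nc 22 = 21" "nc 23 = 12" "nc 24 = 26" "nc 26 = 27" "nc 27 = 26" "nc 28 = 30" "nc 30 = 32"
  "nc 32 = 33" "nc 33 = 32" "nc 34 = 24"
  by (simp_all add: nc_def nR_def nL_def up_def lay_def pos_def valid_def P_def)

text \<open>
  The rotation of order three about \<open>P 0 3\<close>, found by following the automorphism outwards from the
  neighbours of \<open>P 0 3\<close>.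
\<close>

definition rho :: "nat \<Rightarrow> nat" where
  "rho = id(0 := 17, 1 := 5, 5 := 15, 6 := 16, 7 := 28, 9 := 30, 11 := 18, 12 := 7, 13 := 6,
     14 := 0, 15 := 1, 16 := 13, 17 := 14, 18 := 26, 19 := 27, 20 := 33, 21 := 32, 22 := 20,
     23 := 19, 24 := 9, 26 := 11, 27 := 23, 28 := 12, 30 := 24, 32 := 34, 33 := 22, 34 := 21)"

lemma table_rho:
  "rho 0 = 17" "rho (Suc 0) = 5" "rho 3 = 3" "rho 5 = 15" "rho 6 = 16" "rho 7 = 28" "rho 9 = 30"
  "rho 11 = 18" "rho 12 = 7" "rho 13 = 6" "rho 14 = 0" "rho 15 = 1" "rho 16 = 13" "rho 17 = 14" "rho 18 = 26"
  "rho 19 = 27" "rho 20 = 33" "rho 21 = 32" "rho 22 = 20" "rho 23 = 19" "rho 24 = 9" "rho 26 = 11"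
  "rho 27 = 23" "rho 28 = 12" "rho 30 = 24" "rho 32 = 34" "rho 33 = 22" "rho 34 = 21"
  by (simp_all add: rho_def)

lemma rho_verts3: "\<forall>v\<in>set verts3. rho v \<in> set verts3" "\<forall>v\<in>set verts3. rho (rho (rho v)) = v"
  unfolding verts3_def by (simp_all only: list.set ball_simps One_nat_def table_rho) simp_all

lemma rho_other: "v \<notin> set verts3 \<Longrightarrow> rho v = v"
  by (simp add: verts3_def rho_def)

lemma rho_permutes: "rho permutes VV"
proof (rule bij_imp_permutes)
  have "inj_on rho (set verts3)" using rho_verts3 by (metis inj_onI)
  then show "bij_betw rho VV VV"
    using rho_verts3 unfolding VV_eq by (simp add: bij_betw_def endo_inj_surj image_subsetI)
qed (simp add: VV_eq rho_other)

lemma rho_preserving: "preserving rho"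
proof (rule preservingI[OF rho_permutes])
  have "\<forall>v\<in>set verts3. (rho (na v), rho (nV v), rho (nc v)) \<in>
      {(na (rho v), nV (rho v), nc (rho v)), (nV (rho v), nc (rho v), na (rho v)),
       (nc (rho v), na (rho v), nV (rho v))}"
    unfolding verts3_def by (simp add: table_na table_nV table_nc table_rho)
  then show "v \<in> VV \<Longrightarrow> (rho (na v), rho (nV v), rho (nc v)) \<in>
      {(na (rho v), nV (rho v), nc (rho v)), (nV (rho v), nc (rho v), na (rho v)),
       (nc (rho v), na (rho v), nV (rho v))}" for v
    unfolding VV_eq by blast
qed

lemma rho_Aut: "rho \<in> Aut"
  using rho_preserving by (rule preserving_Aut)

text \<open>The four hexagons, centred at the ends of the two chords, and the four caps cover all
  vertices. A vertex on a hexagon is excluded by definition, and in a cap only the middle vertex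
  remains.\<close>

lemma pentmid_apex:
  assumes v: "pentmid v" shows "v \<in> apexes"
proof -
  have p: "P 0 3 = 3" "P 0 9 = 9" "P 2 0 = 24" "P 2 6 = 30" by (simp_all add: P_def)
  have VV: "v \<in> VV" using v by (simp add: pentmid_def)
  then obtain j i where ji: "v = P j i" "valid j i" "0 \<le> j" "j < 3" by (rule VV_cases)
  show ?thesis
  proof (rule ccontr)
    assume a: "v \<notin> apexes"
    have r: "v \<notin> set (ringverts j c)" if "hex j c" "valid j c" "valid (j + 1) c" for j c
    proof
      assume vr: "v \<in> set (ringverts j c)"
      have "set (ringverts j c) \<in> fverts ` parcs G" using that(1) unfolding face_sets by blast
      then have "pent (set (ringverts j c))" using v vr by (simp add: pentmid_def)
      then show False using pent_ring[OF that(1)] that by simp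
    qed
    have b: "v \<notin> bottomset e" if "6 dvd e" for e
    proof
      assume "v \<in> bottomset e"
      then have "v = P 0 (e + 3)" by (rule bottomset_pentmid[OF that v])
      moreover have "12 dvd e \<or> 12 dvd e - 6" using that by presburger
      then have "P 0 (e + 3) = P 0 3 \<or> P 0 (e + 3) = P 0 9" by (auto simp: P_eq_iff)
      ultimately show False using a p by (auto simp: apexes_def)
    qed
    have t: "v \<notin> topset e" if "6 dvd e - 3" for e
    proof
      assume "v \<in> topset e"
      then have "v = P (3 - 1) (e - 3)" by (rule topset_pentmid[OF that v])
      moreover have "12 dvd (e - 3) \<or> 12 dvd (e - 3) - 6" using that by presburger
      then have "P 2 (e - 3) = P 2 0 \<or> P 2 (e - 3) = P 2 6" by (auto simp: P_eq_iff)
      ultimately show False using a p by (auto simp: apexes_def)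
    qed
    have h: "hex 0 0" "hex 0 6" "hex 1 3" "hex 1 9" by (simp_all add: hex_def)
    have va: "valid 0 0" "valid 1 0" "valid 0 6" "valid 1 6" "valid 1 3" "valid 2 3" "valid 1 9" "valid 2 9"
      by (simp_all add: valid_def)
    have "v \<in> set verts3" using VV VV_eq by simp
    moreover have "\<forall>v\<in>set verts3. v \<in> set (ringverts 0 0) \<or> v \<in> set (ringverts 0 6) \<or> v \<in> set (ringverts 1 3) \<or>
       v \<in> set (ringverts 1 9) \<or> v \<in> bottomset 0 \<or> v \<in> bottomset 6 \<or> v \<in> topset 3 \<or> v \<in> topset 9"
      by (simp add: verts3_def ringverts_def bottomset_def topset_def P_def valid_def)
    ultimately show False using r[OF h(1)] r[OF h(2)] r[OF h(3)] r[OF h(4)] b[of 0] b[of 6] t[of 3] t[of 9] va by auto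
  qed
qed

lemma pentmid_03: "pentmid 3"
proof -
  have "P 0 3 = 3" by (simp add: P_def)
  then show ?thesis using pentmid_P03 by simp
qed

lemma apexes_VV: "b \<in> apexes \<Longrightarrow> b \<in> VV"
  by (auto simp: apexes_def VV_eq verts3_def)

section \<open>The automorphisms as permutations of the four apexes\<close>

lemma amap_verts3: "v \<in> set verts3 \<Longrightarrow> amap t e c v = nat (12 * (if t then 2 - int v div 12 else int v div 12) + (e * (int v mod 12) + c) mod 12)"
  by (simp add: amap_def VV_eq P_def flip_def lay_def pos_def)

text \<open>One automorphism for each possible image of 3: representatives of the cosets of its
  stabiliser.\<close>

definition turns :: "(nat \<Rightarrow> nat) set" where
  "turns = {id, amap False 1 6, amap True 1 3, amap True 1 9}"

definition mir3 :: "nat \<Rightarrow> nat" where "mir3 = amap False (-1) 6"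

text \<open>The stabiliser of 3, generated by the rotation \<open>rho\<close> about this vertex and
  the reflection \<open>mir3\<close> through it.\<close>

definition stab :: "(nat \<Rightarrow> nat) set" where
  "stab = {id, rho, rho \<circ> rho, mir3, rho \<circ> mir3, rho \<circ> rho \<circ> mir3}"

lemma admissibles: "admissible False 1 6" "admissible True 1 3" "admissible True 1 9" "admissible False (-1) 6"
  by (simp_all add: admissible_def)

lemma turns_Aut: "g \<in> turns \<Longrightarrow> g \<in> Aut"
  using amap_Aut[OF admissibles(1)] amap_Aut[OF admissibles(2)] amap_Aut[OF admissibles(3)]
    amap_Aut[of False 1 0] amap_id by (auto simp: turns_def admissible_def)

lemma mir3_Aut: "mir3 \<in> Aut"
  using amap_Aut[OF admissibles(4)] by (simp add: mir3_def)

lemma stab_Aut: "s \<in> stab \<Longrightarrow> s \<in> Aut"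
  using rho_Aut mir3_Aut turns_Aut[of id] by (auto simp: stab_def turns_def intro!: Aut_comp)

lemma mir3_simps: "mir3 3 = 3" "mir3 9 = 9" "mir3 24 = 30" "mir3 30 = 24" "mir3 5 = 1" "mir3 (Suc 0) = 5" "mir3 15 = 15"
  by (simp_all add: mir3_def amap_verts3 verts3_def)

lemma rho_simps: "rho 3 = 3" "rho 9 = 30" "rho 24 = 9" "rho 30 = 24" "rho 5 = 15" "rho (Suc 0) = 5" "rho 15 = 1"
  by (simp_all add: rho_def)

lemma turn_simps:
  "amap False 1 6 3 = 9" "amap False 1 6 9 = 3" "amap False 1 6 24 = 30" "amap False 1 6 30 = 24"
  "amap True 1 3 3 = 30" "amap True 1 3 9 = 24" "amap True 1 3 24 = 3" "amap True 1 3 30 = 9"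
  "amap True 1 9 3 = 24" "amap True 1 9 9 = 30" "amap True 1 9 24 = 9" "amap True 1 9 30 = 3"
  by (simp_all add: amap_verts3 verts3_def)

lemma bij_apexesI: "f ` {3, 9, 24, 30} = {3, 9, 24, 30} \<Longrightarrow> bij_betw f apexes apexes"
  using finite_apexes by (simp add: bij_betw_def eq_card_imp_inj_on flip: apexes_def)

lemma turns_bij: "g \<in> turns \<Longrightarrow> bij_betw g apexes apexes"
  and turns_onto: "x \<in> apexes \<Longrightarrow> \<exists>g\<in>turns. g 3 = x"
proof -
  show "g \<in> turns \<Longrightarrow> bij_betw g apexes apexes"
    unfolding turns_def by (intro bij_apexesI, elim insertE emptyE) (auto simp: turn_simps)
  show "x \<in> apexes \<Longrightarrow> \<exists>g\<in>turns. g 3 = x" by (auto simp: turns_def apexes_def turn_simps)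
qed

lemma N3: "N 3 = {5, 1, 15}"
proof -
  have "(3::nat) \<in> VV" by (simp add: VV_eq verts3_def)
  then show ?thesis by (auto simp: N_def table_na table_nV table_nc)
qed

lemma permuted_triple: "a \<in> {x, y, z} \<Longrightarrow> b \<in> {x, y, z} \<Longrightarrow> c \<in> {x, y, z} \<Longrightarrow> a \<noteq> b \<Longrightarrow> a \<noteq> c \<Longrightarrow> b \<noteq> c \<Longrightarrow>
    (a, b, c) \<in> {(x, y, z), (z, x, y), (y, z, x), (y, x, z), (x, z, y), (z, y, x)}"
  by (elim insertE emptyE) simp_all

lemma stab_nbrs: "(\<lambda>s. (s 5, s (Suc 0), s 15)) ` stab =
    {(5, Suc 0, 15), (15, 5, Suc 0), (Suc 0, 15, 5), (Suc 0, 5, 15), (5, 15, Suc 0), (15, Suc 0, 5)}"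
  by (simp add: stab_def mir3_simps rho_simps)

lemma stab_apexes: "(\<lambda>s. (s 9, s 24, s 30)) ` stab =
    {(9, 24, 30), (30, 9, 24), (24, 30, 9), (24, 9, 30), (9, 30, 24), (30, 24, 9)}"
  by (simp add: stab_def mir3_simps rho_simps) auto

lemma stab_3: "s \<in> stab \<Longrightarrow> s 3 = 3"
  by (auto simp: stab_def mir3_simps rho_simps)

text \<open>The six elements of \<open>stab\<close> already realise all arrangements of the three
  neighbours 5, 1, 15 of the vertex 3; by rigidity there are no others.\<close>

lemma Aut_stab:
  assumes f: "f \<in> Aut" and f3: "f 3 = 3" shows "f \<in> stab"
proof -
  have V3: "(3::nat) \<in> VV" by (simp add: VV_eq verts3_def)
  have "f u \<in> {5, 1, 15}" if "u \<in> {5, 1, 15}" for u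
    using Aut_edge[OF f V3, of u] that f3 by (simp only: N3)
  then have "f 5 \<in> {5, Suc 0, 15}" "f (Suc 0) \<in> {5, Suc 0, 15}" "f 15 \<in> {5, Suc 0, 15}"
    unfolding One_nat_def by blast+
  moreover have "f 5 \<noteq> f (Suc 0)" "f 5 \<noteq> f 15" "f (Suc 0) \<noteq> f 15"
    using permutes_inj[OF Aut_permutes[OF f]] by (simp_all add: inj_eq)
  ultimately have "(f 5, f (Suc 0), f 15) \<in> (\<lambda>s. (s 5, s (Suc 0), s 15)) ` stab"
    unfolding stab_nbrs by (rule permuted_triple)
  then obtain s where s: "s \<in> stab" "s 5 = f 5" "s (Suc 0) = f (Suc 0)" "s 15 = f 15" by auto
  have "f u = s u" if "u \<in> N 3" for u using that s unfolding N3 by auto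
  then have "f = s" using Aut_eqI[OF f stab_Aut[OF s(1)] V3] stab_3[OF s(1)] f3 by simp
  then show ?thesis using s by simp
qed

lemma stab_bij: "s \<in> stab \<Longrightarrow> bij_betw s apexes apexes"
  unfolding stab_def by (intro bij_apexesI, elim insertE emptyE) (auto simp: mir3_simps rho_simps)

lemma inv_turn:
  assumes "g \<in> Aut" shows "inv_into UNIV g (g x) = x" "g (inv_into UNIV g x) = x"
  using Aut_permutes[OF assms] by (simp_all add: permutes_inverses)

lemma Aut_decompose:
  assumes f: "f \<in> Aut" obtains g s where "g \<in> turns" "s \<in> stab" "f = g \<circ> s"
proof -
  have "f 3 \<in> apexes" using pentmid_apex pentmid_image[OF f pentmid_03] .
  then obtain g where g: "g \<in> turns" "g 3 = f 3" using turns_onto by blast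
  note gA = turns_Aut[OF g(1)]
  have "inv_into UNIV g \<circ> f \<in> stab"
    using inv_turn(1)[OF gA, of 3] g(2) by (intro Aut_stab Aut_comp Aut_inv gA f) simp
  moreover have "f = g \<circ> (inv_into UNIV g \<circ> f)" by (simp add: fun_eq_iff inv_turn[OF gA])
  ultimately show ?thesis using g that by blast
qed

lemma Aut_bij: "f \<in> Aut \<Longrightarrow> bij_betw f apexes apexes"
  by (metis Aut_decompose bij_betw_trans stab_bij turns_bij)

lemma Aut_apex_id:
  assumes f: "f \<in> Aut" and b: "\<And>b. b \<in> apexes \<Longrightarrow> f b = b" shows "f = id"
proof -
  have "f \<in> stab" using Aut_stab[OF f] b by (simp add: apexes_def)
  moreover have "f 9 = 9" "f 24 = 24" using b by (simp_all add: apexes_def)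
  ultimately show ?thesis unfolding stab_def by (auto simp: mir3_simps rho_simps)
qed

lemma Aut_apex_eqI:
  assumes f: "f \<in> Aut" and g: "g \<in> Aut" and b: "\<And>b. b \<in> apexes \<Longrightarrow> f b = g b" shows "f = g"
proof -
  have "inv_into UNIV g \<circ> f = id"
    using b inv_turn[OF g] by (intro Aut_apex_id Aut_comp Aut_inv f g) simp
  then show ?thesis using inv_turn[OF g] by (metis comp_apply id_apply ext)
qed

text \<open>An element of \<open>turns\<close> adjusts the image of 3; what remains permutes 9, 24,
  30, and \<open>stab\<close> induces all six permutations of these.\<close>

lemma Aut_realise:
  assumes \<sigma>: "bij_betw \<sigma> apexes apexes" shows "\<exists>f\<in>Aut. \<forall>b\<in>apexes. f b = \<sigma> b"
proof -
  have "\<sigma> 3 \<in> apexes" using \<sigma> by (auto simp: bij_betw_def apexes_def)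
  then obtain g where g: "g \<in> turns" "g 3 = \<sigma> 3" using turns_onto by blast
  note gA = turns_Aut[OF g(1)]
  define \<tau> where "\<tau> = inv_into UNIV g \<circ> \<sigma>"
  have \<tau>: "bij_betw \<tau> apexes apexes"
    unfolding \<tau>_def by (rule bij_betw_trans[OF \<sigma>]) (rule Aut_bij[OF Aut_inv[OF gA]])
  have \<tau>3: "\<tau> 3 = 3" using inv_turn(1)[OF gA, of 3] g(2) by (simp add: \<tau>_def)
  have "\<tau> b \<in> apexes" if "b \<in> apexes" for b using \<tau> that by (auto simp: bij_betw_def)
  then have in_ap: "\<tau> 9 \<in> {3, 9, 24, 30}" "\<tau> 24 \<in> {3, 9, 24, 30}" "\<tau> 30 \<in> {3, 9, 24, 30}"
    unfolding apexes_def by blast+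
  have "\<tau> b = \<tau> c \<longleftrightarrow> b = c" if "b \<in> apexes" "c \<in> apexes" for b c
    using \<tau> that by (auto simp: bij_betw_def inj_on_def)
  then have "\<tau> 9 \<noteq> \<tau> 3" "\<tau> 24 \<noteq> \<tau> 3" "\<tau> 30 \<noteq> \<tau> 3" "\<tau> 9 \<noteq> \<tau> 24" "\<tau> 9 \<noteq> \<tau> 30" "\<tau> 24 \<noteq> \<tau> 30"
    by (simp_all add: apexes_def)
  with in_ap have "(\<tau> 9, \<tau> 24, \<tau> 30) \<in> (\<lambda>s. (s 9, s 24, s 30)) ` stab"
    unfolding stab_apexes \<tau>3 by (intro permuted_triple) blast+
  then obtain s where s: "s \<in> stab" "s 9 = \<tau> 9" "s 24 = \<tau> 24" "s 30 = \<tau> 30" by auto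
  have "(g \<circ> s) b = \<sigma> b" if "b \<in> apexes" for b
  proof -
    have "s b = \<tau> b" using that s stab_3[OF s(1)] \<tau>3 by (auto simp: apexes_def)
    then show ?thesis by (simp add: \<tau>_def inv_turn[OF gA])
  qed
  then show ?thesis using Aut_comp[OF gA stab_Aut[OF s(1)]] by blast
qed

text \<open>The agreement of orientation and determinant, phrased so as to be closed under
  composition. It then needs checking only for \<open>turns\<close>, \<open>rho\<close> and
  \<open>mir3\<close>.\<close>

definition oriented :: "(nat \<Rightarrow> nat) \<Rightarrow> bool" where
  "oriented f \<longleftrightarrow> f \<in> Aut \<and> (preserving f \<and> det (apex_matrix f) = 1 \<or> reversing f \<and> det (apex_matrix f) = -1)"

lemma oriented_comp: "oriented f \<Longrightarrow> oriented g \<Longrightarrow> oriented (f \<circ> g)"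
  unfolding oriented_def
  using preserving_comp[of f g] preserving_reversing[of f g] reversing_preserving[of f g] reversing_comp[of f g]
  by (auto simp: Aut_comp apex_matrix_comp[OF Aut_bij Aut_bij] det_mul)

lemma oriented_Aut:
  assumes f: "f \<in> Aut" shows "oriented f"
proof -
  have id: "id \<in> Aut" using turns_Aut[of id] by (simp add: turns_def)
  have D: "det (apex_matrix \<sigma>) = det (\<chi> i j. (apex 3 $ j * apex (\<sigma> 3) $ i + apex 9 $ j * apex (\<sigma> 9) $ i +
      apex 24 $ j * apex (\<sigma> 24) $ i + apex 30 $ j * apex (\<sigma> 30) $ i) / 4 :: real^3^3)" for \<sigma>
    by (simp add: apex_matrix_def sum_apexes)
  have a: "preserving id" "preserving (amap False 1 6)" "reversing (amap True 1 3)" "reversing (amap True 1 9)"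
    using amap_preserving[of False 1 0] amap_preserving[OF admissibles(1)] amap_reversing[OF admissibles(2)]
      amap_reversing[OF admissibles(3)] amap_id by (simp_all add: admissible_def)
  have m: "reversing mir3" using amap_reversing[OF admissibles(4)] by (simp add: mir3_def)
  have turns: "oriented g" if "g \<in> turns" for g
    using that turns_Aut[OF that] a unfolding turns_def oriented_def D
    by (elim insertE emptyE) (simp_all add: turn_simps det_3)
  have rho: "oriented rho" unfolding oriented_def D using rho_Aut rho_preserving by (simp add: rho_simps det_3)
  have mir: "oriented mir3" unfolding oriented_def D using mir3_Aut m by (simp add: mir3_simps det_3)
  have stab: "oriented s" if "s \<in> stab" for s
    using that turns[of id] rho mir unfolding stab_def by (auto simp: turns_def intro!: oriented_comp)
  obtain g s where "g \<in> turns" "s \<in> stab" "f = g \<circ> s" using f by (rule Aut_decompose)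
  then show ?thesis using turns stab oriented_comp by blast
qed

text \<open>The permutation \<open>\<sigma>\<close> is induced by an automorphism \<open>h\<close>.
  Since the apexes determine an automorphism, \<open>h\<close> conjugates \<open>f\<close> into
  \<open>g\<close> on all vertices and carries fixed cells to fixed cells.\<close>

lemma Aut_conj:
  assumes f: "f \<in> Aut" and g: "g \<in> Aut" and \<sigma>: "bij_betw \<sigma> apexes apexes"
    and eq: "\<And>b. b \<in> apexes \<Longrightarrow> \<sigma> (f b) = g (\<sigma> b)"
  shows "(\<exists>c\<in>cells G rot. f ` c = c) \<longleftrightarrow> (\<exists>c\<in>cells G rot. g ` c = c)"
proof -
  obtain h where h: "h \<in> Aut" "\<And>b. b \<in> apexes \<Longrightarrow> h b = \<sigma> b" using Aut_realise[OF \<sigma>] by blast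
  have fa: "f b \<in> apexes" if "b \<in> apexes" for b using Aut_bij[OF f] that by (auto simp: bij_betw_def)
  have hf: "h \<circ> f = g \<circ> h"
    using h eq fa by (intro Aut_apex_eqI Aut_comp f g) auto
  have "inv_into UNIV h \<circ> g = f \<circ> inv_into UNIV h"
  proof
    fix x
    have "g x = h (f (inv_into UNIV h x))" using hf inv_turn(2)[OF h(1)] by (metis comp_apply)
    then show "(inv_into UNIV h \<circ> g) x = (f \<circ> inv_into UNIV h) x" by (simp add: inv_turn[OF h(1)])
  qed
  then show ?thesis
    using fixes_cell_conj[OF h(1) g hf] fixes_cell_conj[OF Aut_inv[OF h(1)] f] by blast
qed

section \<open>Fixed cells against fixed points of the sphere\<close>

lemma fixed_apex:
  assumes f: "f \<in> Aut" and b: "b \<in> apexes" "f b = b"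
  shows "\<exists>x. x \<noteq> 0 \<and> apex_matrix f *v x = x" "\<exists>c\<in>cells G rot. f ` c = c"
proof -
  have "apex b \<noteq> 0" using inner_apex[OF b(1) b(1)] by auto
  moreover have "apex_matrix f *v apex b = apex b" using apex_matrix_apex[OF Aut_bij[OF f] b(1)] b(2) by simp
  ultimately show "\<exists>x. x \<noteq> 0 \<and> apex_matrix f *v x = x" by blast
  have "{b} \<in> cells G rot" using apexes_VV[OF b(1)] by (simp add: cells_G)
  moreover have "f ` {b} = {b}" using b(2) by simp
  ultimately show "\<exists>c\<in>cells G rot. f ` c = c" by blast
qed

text \<open>By cycle type on the four apexes: a fixed apex yields both kinds of fixed object, a
  double transposition is conjugate to the half-turn of the tube and has both, and a four-cycle is
  conjugate to a rotary reflection of the tube and has neither.\<close>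

lemma fixed_iff:
  assumes f: "f \<in> Aut"
  shows "(\<exists>x. x \<noteq> 0 \<and> apex_matrix f *v x = x) \<longleftrightarrow> (\<exists>c\<in>cells G rot. f ` c = c)"
proof (cases "\<exists>b\<in>apexes. f b = b")
  case True
  then show ?thesis using fixed_apex[OF f] by blast
next
  case False
  note bij = Aut_bij[OF f]
  have fa: "f b \<in> apexes" if "b \<in> apexes" for b using bij that by (auto simp: bij_betw_def)
  have inj: "f b = f c \<longleftrightarrow> b = c" for b c using permutes_inj[OF Aut_permutes[OF f]] by (simp add: inj_eq)
  have nf: "f b \<noteq> b" if "b \<in> apexes" for b using False that by blast
  have A3: "(3::nat) \<in> apexes" by (simp add: apexes_def)
  show ?thesis
  proof (cases "f (f 3) = 3")
    case True
    obtain y where y: "y \<in> apexes" "y \<noteq> 3" "y \<noteq> f 3"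
      using fa[OF A3] by (metis (no_types, opaque_lifting) apexes_def insertCI numeral_eq_iff semiring_norm(83,85,87,88,89,90))
    define z where "z = f y"
    have z: "z \<in> apexes" "z \<noteq> 3" "z \<noteq> f 3" "z \<noteq> y"
      unfolding z_def using fa[OF y(1)] nf[OF y(1)] y True inj by metis+
    have B: "apexes = {3, f 3, y, z}"
      using y z fa[OF A3] nf[OF A3] by (auto simp: apexes_def)
    have fy: "f y = z" by (simp add: z_def)
    have fz: "f z = y"
    proof -
      have "f z \<in> {3, f 3, y, z}" using fa[OF z(1)] B by simp
      moreover have "f z \<noteq> f (f 3)" "f z \<noteq> f 3" "f z \<noteq> z" using z nf inj by auto
      ultimately show ?thesis using True by simp
    qed
    \<comment> \<open>The half-turn \<open>amap False 1 6\<close> exchanges 3 with 9 and 24 with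
      30.\<close>
    define \<sigma> where "\<sigma> = (\<lambda>b. if b = 3 then 3 else if b = f 3 then 9 else if b = y then 24 else (30::nat))"
    have \<sigma>: "\<sigma> 3 = 3" "\<sigma> (f 3) = 9" "\<sigma> y = 24" "\<sigma> z = 30" using y z nf[OF A3] by (simp_all add: \<sigma>_def)
    have "bij_betw \<sigma> apexes apexes"
    proof -
      have "\<sigma> ` apexes = {3, 9, 24, 30}" unfolding B by (simp add: \<sigma>)
      then have "\<sigma> ` apexes = apexes" by (auto simp: apexes_def)
      then show ?thesis using finite_apexes by (simp add: bij_betw_def eq_card_imp_inj_on)
    qed
    moreover have "\<sigma> (f b) = amap False 1 6 (\<sigma> b)" if "b \<in> apexes" for b
      using that unfolding B by (elim insertE emptyE) (simp_all only: True fz fy \<sigma> turn_simps)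
    ultimately have "(\<exists>c\<in>cells G rot. f ` c = c) \<longleftrightarrow> (\<exists>c\<in>cells G rot. amap False 1 6 ` c = c)"
      by (intro Aut_conj f amap_Aut admissibles)
    moreover have "\<exists>c\<in>cells G rot. amap False 1 6 ` c = c"
      using fixes_cell_amap[OF admissibles(1)] by (simp add: fixes_cell_def)
    \<comment> \<open>The fixed axis runs through the midpoint of an edge of the tetrahedron whose
      ends are exchanged.\<close>
    moreover have "apex_matrix f *v (apex 3 + apex (f 3)) = apex 3 + apex (f 3)"
      using fa[OF A3] A3 True by (simp only: matrix_vector_right_distrib apex_matrix_apex[OF bij] add.commute)
    moreover have "(apex 3 + apex (f 3)) \<bullet> apex 3 = 2"
      using inner_apex[OF A3 A3] inner_apex[OF fa[OF A3] A3] nf[OF A3] by (simp only: inner_add_left) simp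
    then have "apex 3 + apex (f 3) \<noteq> 0" by auto
    ultimately show ?thesis by blast
  next
    case ff: False
    define x y z where "x = f 3" and "y = f x" and "z = f y"
    have x: "x \<in> apexes" "x \<noteq> 3" unfolding x_def using fa nf A3 by auto
    have y: "y \<in> apexes" "y \<noteq> 3" "y \<noteq> x" unfolding y_def using fa nf x ff by (auto simp: x_def)
    have z: "z \<in> apexes" "z \<noteq> x" "z \<noteq> y" unfolding z_def using fa nf y x inj[of y 3] by (auto simp: x_def)
    \<comment> \<open>A three-cycle would leave the fourth apex fixed.\<close>
    have "z \<noteq> 3"
    proof
      assume z3: "z = 3"
      obtain w where w: "w \<in> apexes" "w \<notin> {3, x, y}"
      proof -
        have "card {3, x, y} < card apexes" using x y by (simp add: apexes_def)
        then show ?thesis using that by (metis card_mono finite.emptyI finite.insertI not_le subsetI)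
      qed
      then have "apexes = {3, x, y, w}" using x y by (auto simp: apexes_def)
      then have "f w \<in> {3, x, y, w}" using fa[OF w(1)] by blast
      moreover have "f w \<noteq> f 3" "f w \<noteq> f x" "f w \<noteq> f y" using w inj by auto
      ultimately have "f w = w" using z3 by (auto simp: x_def[symmetric] y_def[symmetric] z_def[symmetric])
      then show False using nf w by blast
    qed
    note z = z this
    have B: "apexes = {3, x, y, z}" using x y z by (auto simp: apexes_def)
    have fz: "f z = 3"
    proof -
      have "f z \<in> {3, x, y, z}" using fa[OF z(1)] B by simp
      moreover have "f z \<noteq> f 3" "f z \<noteq> f x" "f z \<noteq> z" using z nf inj by auto
      ultimately show ?thesis by (auto simp: x_def[symmetric] y_def[symmetric])
    qed
    note fs' = x_def[symmetric] y_def[symmetric] z_def[symmetric] fz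
    \<comment> \<open>The sequence 3, 30, 9, 24 is the cycle of
      \<open>amap True 1 3\<close>.\<close>
    define \<sigma> where "\<sigma> = (\<lambda>b. if b = 3 then 3 else if b = x then 30 else if b = y then 9 else (24::nat))"
    have \<sigma>: "\<sigma> 3 = 3" "\<sigma> x = 30" "\<sigma> y = 9" "\<sigma> z = 24" using x y z by (simp_all add: \<sigma>_def)
    have "bij_betw \<sigma> apexes apexes"
    proof -
      have "\<sigma> ` apexes = {3, 30, 9, 24}" unfolding B by (simp add: \<sigma>)
      then have "\<sigma> ` apexes = apexes" by (auto simp: apexes_def)
      then show ?thesis using finite_apexes by (simp add: bij_betw_def eq_card_imp_inj_on)
    qed
    moreover have "\<sigma> (f b) = amap True 1 3 (\<sigma> b)" if "b \<in> apexes" for b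
      using that unfolding B by (elim insertE emptyE) (simp_all only: fs' \<sigma> turn_simps)
    ultimately have "(\<exists>c\<in>cells G rot. f ` c = c) \<longleftrightarrow> (\<exists>c\<in>cells G rot. amap True 1 3 ` c = c)"
      by (intro Aut_conj f amap_Aut admissibles)
    moreover have "\<not> (\<exists>c\<in>cells G rot. amap True 1 3 ` c = c)"
      using fixes_cell_amap[OF admissibles(2)] by (simp add: fixes_cell_def)
    \<comment> \<open>A fixed vector has the same inner product with every apex, as these form one
      cycle; the frame expansion then makes it a multiple of their sum, which is zero.\<close>
    moreover have "v = 0" if v: "apex_matrix f *v v = v" for v
    proof -
      have "orthogonal_transformation ((*v) (apex_matrix f))"
        using apex_matrix_orthogonal[OF bij] by (simp add: orthogonal_transformation_matrix)
      then have "v \<bullet> apex (f b) = v \<bullet> apex b" if "b \<in> apexes" for b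
        using apex_matrix_apex[OF bij that] v unfolding orthogonal_transformation_def by metis
      then have "v \<bullet> apex x = v \<bullet> apex 3" "v \<bullet> apex y = v \<bullet> apex x" "v \<bullet> apex z = v \<bullet> apex y"
        using x y z A3 by (simp_all add: x_def y_def z_def)
      then have "v \<bullet> apex b = v \<bullet> apex 3" if "b \<in> apexes" for b using that unfolding B by auto
      then have "v = (\<Sum>b\<in>apexes. (v \<bullet> apex 3 / 4) *\<^sub>R apex b)"
        using apex_expansion[of v] by simp
      also have "\<dots> = 0" unfolding sum_apexes by (simp add: vec_eq_iff forall_3 del: apex_simps(1)) (simp add: vec_eq_iff forall_3)
      finally show ?thesis .
    qed
    ultimately show ?thesis by blast
  qed
qed

lemma symmetry_T_d: "has_symmetry_group G rot T_d"
proof -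
  have "bij_betw apex_matrix Aut T_d"
    unfolding bij_betw_def
  proof
    show "inj_on apex_matrix Aut"
      using apex_matrix_eqD[OF Aut_bij Aut_bij] Aut_apex_eqI by (intro inj_onI) blast
    show "apex_matrix ` Aut = T_d"
    proof (intro equalityI subsetI)
      fix A assume "A \<in> T_d"
      then obtain \<sigma> where \<sigma>: "bij_betw \<sigma> apexes apexes" "A = apex_matrix \<sigma>" by (rule T_d_apex_matrix)
      then obtain f where "f \<in> Aut" "\<forall>b\<in>apexes. f b = \<sigma> b" using Aut_realise by blast
      moreover from this have "apex_matrix f = A" unfolding \<sigma>(2) apex_matrix_def by (simp add: vec_eq_iff)
      ultimately show "A \<in> apex_matrix ` Aut" by blast
    qed (auto intro: apex_matrix_T_d Aut_bij)
  qed
  moreover have "apex_matrix \<in> hom (aut_group G rot) (O3\<lparr>carrier := T_d\<rparr>)"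
  proof (rule homI)
    fix f g assume "f \<in> Aut" "g \<in> Aut"
    then show "apex_matrix f \<in> carrier (O3\<lparr>carrier := T_d\<rparr>)"
      "apex_matrix (f \<otimes>\<^bsub>aut_group G rot\<^esub> g) = apex_matrix f \<otimes>\<^bsub>O3\<lparr>carrier := T_d\<rparr>\<^esub> apex_matrix g"
      using apex_matrix_T_d[OF Aut_bij] apex_matrix_comp[OF Aut_bij Aut_bij] by (simp_all add: aut_group_def O3_def)
  qed
  ultimately have "apex_matrix \<in> iso (aut_group G rot) (O3\<lparr>carrier := T_d\<rparr>)"
    by (simp add: iso_def)
  moreover have "(rotation_matrix (apex_matrix f) \<longleftrightarrow> orientation_preserving G rot f) \<and>
        ((\<exists>x. norm x = 1 \<and> apex_matrix f *v x = x) \<longleftrightarrow> (\<exists>c\<in>cells G rot. f ` c = c))" if f: "f \<in> Aut" for f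
  proof
    have v: "(3::nat) \<in> VV" by (simp add: VV_eq verts3_def)
    show "rotation_matrix (apex_matrix f) \<longleftrightarrow> orientation_preserving G rot f"
      using oriented_Aut[OF f] apex_matrix_orthogonal[OF Aut_bij[OF f]] preserving_orientation reversing_orientation[OF _ v]
      by (auto simp: oriented_def rotation_matrix_def)
    show "(\<exists>x. norm x = 1 \<and> apex_matrix f *v x = x) \<longleftrightarrow> (\<exists>c\<in>cells G rot. f ` c = c)"
      unfolding fixes_unit_iff by (rule fixed_iff[OF f])
  qed
  ultimately show ?thesis unfolding has_symmetry_group_def by blast
qed

end

lemma (in tube) symmetry_T_d: "n = 3 \<Longrightarrow> has_symmetry_group G rot T_d"
proof -
  assume n: "n = 3"
  interpret t: tube3 by unfold_locales simp_all
  show "has_symmetry_group G rot T_d" unfolding n by (rule t.symmetry_T_d)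
qed

theorem theorem7p1:
  fixes h :: nat
  assumes "even h" and "h \<ge> 2"
  shows "\<exists>(G :: nat pair_pre_digraph) rot.
           fullerene G rot \<and> card (pverts G) = 18 * h - 8 \<and>
           (\<exists>Z1\<in>zigzags G rot. \<exists>Z2\<in>zigzags G rot. Z1 \<noteq> Z2 \<and>
              simple_zigzag Z1 \<and> simple_zigzag Z2 \<and>
              card (zigzag_edges Z1 \<inter> zigzag_edges Z2) = h) \<and>
           (h = 2 \<longrightarrow> has_symmetry_group G rot T_d) \<and>
           (h \<ge> 4 \<and> even (h div 2) \<longrightarrow> has_symmetry_group G rot D_2h) \<and>
           (h \<ge> 4 \<and> odd (h div 2) \<longrightarrow> has_symmetry_group G rot D_2d)"
proof -
  obtain m where m: "h = 2 * m" using assms(1) by blast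
  then have hm: "h div 2 = m" "1 \<le> m" using assms(2) by simp_all
  define n where "n = 3 * int m"
  have h: "2 * (n div 3) = int h" unfolding n_def m by simp
  interpret tube n
    by standard (use hm(2) in \<open>simp_all add: n_def\<close>)
  have "int (card (pverts G)) = 18 * int h - 8"
    using card_VV unfolding pverts_G m by (simp add: n_def)
  then have "card (pverts G) = 18 * h - 8" by linarith
  moreover have "\<exists>Z1\<in>zigzags G rot. \<exists>Z2\<in>zigzags G rot. Z1 \<noteq> Z2 \<and> simple_zigzag Z1 \<and> simple_zigzag Z2 \<and>
      card (zigzag_edges Z1 \<inter> zigzag_edges Z2) = h"
    using zigzags_meet unfolding h of_nat_eq_iff .
  \<comment> \<open>The number of layers is three times \<open>h div 2\<close> and has the same
    parity.\<close>
  moreover have "h = 2 \<longrightarrow> n = 3" "4 \<le> h \<longrightarrow> 6 \<le> n" "even n \<longleftrightarrow> even (h div 2)"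
    unfolding hm unfolding n_def m by simp_all
  then have "h = 2 \<longrightarrow> has_symmetry_group G rot T_d" "4 \<le> h \<and> even (h div 2) \<longrightarrow> has_symmetry_group G rot D_2h"
    "4 \<le> h \<and> odd (h div 2) \<longrightarrow> has_symmetry_group G rot D_2d"
    using symmetry_T_d symmetry_D_2h symmetry_D_2d by blast+
  ultimately show ?thesis using fullerene_G by blast
qed

end
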